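(* Let $H$ be a finite abelian and strongly sequenceable group. There exists a constant $c>0$ such that the following holds. For every prime $p$, every group homomorphism $\varphi: H\to \mathrm{Aut}(\mathbb{Z}_p)$ satisfying $\varphi(h)\in\{id,-id\}$ for each $h\in H$, and every subset $A\subseteq (\mathbb{Z}_p\rtimes_\varphi H)\setminus\{id\}$ of size $$|A|\le e^{c(\log p)^{1/4}},$$ the set $A$ has a sequencing.
   Context: Let $A$ be a finite subset of a group $(G,\cdot)$. An ordering $a_1,\ldots,a_{|A|}$ of $A$ is valid if the partial products $p_1=a_1,\ p_2=a_1 a_2,\ \ldots,\ p_{|A|}=a_1a_2\cdots a_{|A|}$ are all distinct. The ordering is a sequencing if it is valid and moreover $p_i\neq id$ for every $i\in[1,|A|-1]$; in this case $A$ is called sequenceable. A group $G$ is strongly sequenceable if all the subsets of $G\setminus\{id\}$ are sequenceable. For a homomorphism $\varphi:H\to\mathrm{Aut}(\mathbb{Z}_p)$ the group $\mathbb{Z}_p\rtimes_\varphi H$ consists of pairs $(x,a)$ with $x\in\mathbb{Z}_p$, $a\in H$, with operation $(x_1,a_1)(x_2,a_2)=(x_1+\varphi(a_1)(x_2),\,a_1a_2)$. Here $-id$ denotes the map $x\mapsto -x$ on $\mathbb{Z}_p$, and $id$ denotes the identity map or the identity element of a group, according to context. *)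

theory Defs
  imports Complex_Main "HOL-Algebra.Algebra" "HOL-Computational_Algebra.Primes"
begin

definition ordering_of :: "'a list \<Rightarrow> 'a set \<Rightarrow> bool"
  where "ordering_of as A \<longleftrightarrow> distinct as \<and> set as = A"

text \<open>With \<open>as = [a\<^sub>1, \<dots>, a\<^sub>n]\<close>, this is the product of the first \<open>i\<close> entries, in that order.\<close>

definition partial_product :: "('a, 'm) monoid_scheme \<Rightarrow> 'a list \<Rightarrow> nat \<Rightarrow> 'a"
  where "partial_product G as i = foldr (\<otimes>\<^bsub>G\<^esub>) (take i as) \<one>\<^bsub>G\<^esub>"

text \<open>The empty product \<open>i = 0\<close> is not among the values required to be distinct. In a sequencing,
  the full product of all entries is allowed to be the identity.\<close>

definition valid_ordering :: "('a, 'm) monoid_scheme \<Rightarrow> 'a set \<Rightarrow> 'a list \<Rightarrow> bool"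
  where "valid_ordering G A as \<longleftrightarrow>
    ordering_of as A \<and> inj_on (partial_product G as) {1..card A}"

definition sequencing :: "('a, 'm) monoid_scheme \<Rightarrow> 'a set \<Rightarrow> 'a list \<Rightarrow> bool"
  where "sequencing G A as \<longleftrightarrow>
    valid_ordering G A as \<and> (\<forall>i\<in>{1..card A - 1}. partial_product G as i \<noteq> \<one>\<^bsub>G\<^esub>)"

definition sequenceable :: "('a, 'm) monoid_scheme \<Rightarrow> 'a set \<Rightarrow> bool"
  where "sequenceable G A \<longleftrightarrow> (\<exists>as. sequencing G A as)"

text \<open>Sequenceability is a notion for finite sets only, hence the finiteness premise; it is
  automatic when \<open>G\<close> is finite.\<close>

definition strongly_sequenceable :: "('a, 'm) monoid_scheme \<Rightarrow> bool"
  where "strongly_sequenceable G \<longleftrightarrow>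
    (\<forall>A. A \<subseteq> carrier G - {\<one>\<^bsub>G\<^esub>} \<and> finite A \<longrightarrow> sequenceable G A)"

definition semidirect_product ::
    "('n, 'k) monoid_scheme \<Rightarrow> ('h \<Rightarrow> 'n \<Rightarrow> 'n) \<Rightarrow> ('h, 'm) monoid_scheme \<Rightarrow> ('n \<times> 'h) monoid"
  where "semidirect_product N \<phi> H =
    \<lparr>carrier = carrier N \<times> carrier H,
     monoid.mult = (\<lambda>(x\<^sub>1, a\<^sub>1) (x\<^sub>2, a\<^sub>2). (x\<^sub>1 \<otimes>\<^bsub>N\<^esub> \<phi> a\<^sub>1 x\<^sub>2, a\<^sub>1 \<otimes>\<^bsub>H\<^esub> a\<^sub>2)),
     one = (\<one>\<^bsub>N\<^esub>, \<one>\<^bsub>H\<^esub>)\<rparr>"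

text \<open>Elements of \<^const>\<open>AutoGroup\<close> are extensional functions, so the maps \<open>id\<close> and \<open>-id\<close>
  have to be restricted to the carrier.\<close>

definition id_aut :: "('n, 'k) monoid_scheme \<Rightarrow> 'n \<Rightarrow> 'n"
  where "id_aut N = (\<lambda>x\<in>carrier N. x)"

definition neg_id_aut :: "('n, 'k) monoid_scheme \<Rightarrow> 'n \<Rightarrow> 'n"
  where "neg_id_aut N = (\<lambda>x\<in>carrier N. inv\<^bsub>N\<^esub> x)"

end

theory Submission
  imports Defs "HOL-Library.Sublist"
begin

text \<open>
  An ordering of \<open>A\<close> is a sequencing as soon as no proper segment has trivial product. If the first
  coordinates of \<open>A\<close> lie in the span of few of them, with bounded coefficients, then by Dirichlet's
  theorem a dilation moves them into an interval so short that no sum wraps around modulo \<open>p\<close>, and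
  one may argue in \<open>\<int> \<rtimes> H\<close>. There the ordering makes the partial sums monotone: reflections are
  alternately large and small (after moving their median to \<open>0\<close>), and the elements with
  coordinate \<open>0\<close> are ordered by the hypothesis on \<open>H\<close>. If there are no reflections, positive and
  negative elements are put on the two sides of the word and ordered from the outside inwards.

  Otherwise \<open>A\<close> contains an independent set with more than \<open>C (ln \<bar>A\<bar>)\<^sup>3\<close> elements. Up to a remainder
  \<open>R\<close> of small dimension, which is ordered as above, \<open>A\<close> splits into dissociated sets of elements
  with equal second coordinate. Their elements are paired and the pairs arranged cyclically so that
  any \<open>q\<close> consecutive pairs are dissociated, where \<open>q\<close> is a multiple of \<open>ln \<bar>A\<bar>\<close>. The word runs twice
  through the cycle, taking one element of each pair at each turn. Exchanging the two elements of a
  pair preserves all signs, so a segment containing exactly one element of at least \<open>q\<close> consecutive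
  pairs is trivial for a proportion of at most \<open>2\<^sup>-\<^sup>q\<close> of the choices. Short segments are nontrivial
  by dissociativity. The remaining ones, and those meeting \<open>R\<close> and little else, are handled by
  placing at both ends of the word elements that are independent over the span of \<open>R\<close>.
\<close>

section \<open>Words in a semidirect product\<close>

text \<open>The exponent \<open>1/4\<close> comes from counting. With \<open>n = card A\<close>,
  about \<open>ln n\<close> bits (\<open>q\<close>) are needed to beat the number of segments.
  Dissociated elements lie in the bounded span of \<open>v\<close> elements only if their number is
  at most about \<open>v\<close> times a logarithm. Blocks of order \<open>q ^ 2\<close> suffice to
  link windows of \<open>q\<close> pairs, so for fixed \<open>H\<close> the remainder
  \<open>R\<close> has dimension of this order, and order \<open>q ^ 3\<close> independent elements
  suffice to find \<open>Q\<close> outside its span. Below that dimension, dilation asks for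
  \<open>T ^ dim < p\<close> with \<open>ln T\<close> of order \<open>ln n\<close>, that is, for
  \<open>(ln n) ^ 4\<close> small against \<open>ln p\<close>. The obstacle is a segment containing
  almost the whole word: it separates too few pairs for the bits to help, and it may really be
  trivial. Therefore two words are compared that use the same bits and differ by exchanging the
  halves of \<open>Q\<close>. If both had such a segment, subtracting the two relations would cancel
  the chain of pairs and leave a relation on \<open>Q\<close> over the span of \<open>R\<close> with
  coefficients at most \<open>2\<close>. This is why independence carries a coefficient bound
  \<open>m\<close>, with values \<open>1\<close> and \<open>2\<close>.\<close>

lemma sublistE:
  assumes "sublist v l" obtains ps ss where "l = ps @ v @ ss"
  using assms unfolding sublist_def by blast

lemma successively_sublist:
  assumes "successively P l" "sublist v l"
  shows "successively P v"
  using assms by (auto simp: sublist_def successively_append_iff)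

lemma sublist_append_hd:
  assumes "sublist v (x @ y)" "y = [] \<or> hd y \<notin> set v"
  shows "sublist v x \<or> sublist v y"
proof -
  have "sublist v x" if "v = a @ b" "suffix a x" "prefix b y" for a b
    using that assms(2) by (cases b; cases y) auto
  then show ?thesis using assms(1) unfolding sublist_append by blast
qed

lemma sublist_append_last:
  assumes "sublist v (x @ y)" "x = [] \<or> last x \<notin> set v"
  shows "sublist v x \<or> sublist v y"
proof -
  have "sublist v y" if ab: "v = a @ b" "suffix a x" "prefix b y" for a b
  proof (cases "a = []")
    case False
    then have "last a = last x" "x \<noteq> []" using ab(2) by (auto simp: suffix_def)
    then show ?thesis using assms(2) False ab(1) last_in_set[of a] by auto
  qed (use ab in auto)
  then show ?thesis using assms(1) unfolding sublist_append by blast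
qed

text \<open>A nonempty segment of such a word in which all coordinates vanish is a single
  letter.\<close>

abbreviation isolated_zeros :: "(int \<times> 'h) list \<Rightarrow> bool"
  where "isolated_zeros \<equiv> successively (\<lambda>a b. fst a \<noteq> 0 \<or> fst b \<noteq> 0)"

locale signed_group = comm_group H for H :: "('h, 'm) monoid_scheme" (structure) +
  fixes e :: "'h \<Rightarrow> int"
  assumes e_cases: "h \<in> carrier H \<Longrightarrow> e h = 1 \<or> e h = -1"
    and e_mult: "g \<in> carrier H \<Longrightarrow> h \<in> carrier H \<Longrightarrow> e (g \<otimes> h) = e g * e h"
begin

lemma e_one [simp]: "e \<one> = 1"
  using e_mult[of \<one> \<one>] e_cases[of \<one>] by auto

primrec xc :: "(int \<times> 'h) list \<Rightarrow> int" where
  "xc [] = 0"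
| "xc (a # l) = fst a + e (snd a) * xc l"

primrec hp :: "(int \<times> 'h) list \<Rightarrow> 'h" where
  "hp [] = \<one>"
| "hp (a # l) = snd a \<otimes> hp l"

text \<open>The product of a word in \<open>\<int>\<^sub>p \<rtimes> H\<close> has coordinates \<open>xc l mod p\<close> and \<open>hp l\<close>. The modulus
  \<open>p = 0\<close> stands for the group \<open>\<int> \<rtimes> H\<close>.\<close>

definition triv :: "int \<Rightarrow> (int \<times> 'h) list \<Rightarrow> bool"
  where "triv p l \<longleftrightarrow> hp l = \<one> \<and> p dvd xc l"

definition admissible :: "int \<Rightarrow> (int \<times> 'h) list \<Rightarrow> bool"
  where "admissible p l \<longleftrightarrow> (\<forall>v. sublist v l \<and> v \<noteq> [] \<and> v \<noteq> l \<longrightarrow> \<not> triv p v)"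

lemma hp_closed [simp]: "snd ` set l \<subseteq> carrier H \<Longrightarrow> hp l \<in> carrier H"
  by (induction l) auto

lemma hp_append: "snd ` set l \<subseteq> carrier H \<Longrightarrow> snd ` set l' \<subseteq> carrier H \<Longrightarrow>
    hp (l @ l') = hp l \<otimes> hp l'"
  by (induction l) (auto simp: m_assoc)

lemma xc_append: "snd ` set l \<subseteq> carrier H \<Longrightarrow> xc (l @ l') = xc l + e (hp l) * xc l'"
  by (induction l) (auto simp: e_mult algebra_simps)

lemma hp_foldr: "hp l = foldr (\<otimes>) (map snd l) \<one>"
  by (induction l) auto

lemma hp_cong: "map snd l = map snd l' \<Longrightarrow> hp l = hp l'"
  by (simp add: hp_foldr)

lemma carr_sublist: "sublist v l \<Longrightarrow> snd ` set l \<subseteq> carrier H \<Longrightarrow> snd ` set v \<subseteq> carrier H"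
  using set_mono_sublist by fastforce

text \<open>The running sign \<open>s\<close> flips at each reflection and is the sign with which
  the next letter enters the sum. Hence \<open>s * xc l\<close> is a sum of nonnegative terms, and
  nothing can cancel.\<close>

primrec mon :: "int \<Rightarrow> (int \<times> 'h) list \<Rightarrow> bool" where
  "mon s [] = True"
| "mon s (a # l) = (0 \<le> s * fst a \<and> mon (s * e (snd a)) l)"

lemma mon_append: "snd ` set l \<subseteq> carrier H \<Longrightarrow>
    mon s (l @ l') \<longleftrightarrow> mon s l \<and> mon (s * e (hp l)) l'"
  by (induction l arbitrary: s) (auto simp: e_mult mult.assoc)

lemma mon_zero: "(\<And>a. a \<in> set l \<Longrightarrow> fst a = 0) \<Longrightarrow> mon s l"
  by (induction l arbitrary: s) auto

lemma mon_xc: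
  assumes "mon s l" "s = 1 \<or> s = -1" "snd ` set l \<subseteq> carrier H"
  shows "0 \<le> s * xc l \<and> ((\<exists>a\<in>set l. fst a \<noteq> 0) \<longrightarrow> 0 < s * xc l)"
  using assms
proof (induction l arbitrary: s)
  case (Cons a l)
  have c: "s * e (snd a) = 1 \<or> s * e (snd a) = -1"
    using Cons.prems e_cases[of "snd a"] by auto
  have "0 \<le> s * e (snd a) * xc l \<and> ((\<exists>a\<in>set l. fst a \<noteq> 0) \<longrightarrow> 0 < s * e (snd a) * xc l)"
    using Cons.IH[OF _ c] Cons.prems by auto
  moreover have "s * xc (a # l) = s * fst a + s * e (snd a) * xc l"
    by (simp add: algebra_simps)
  moreover have "0 \<le> s * fst a" "fst a \<noteq> 0 \<longrightarrow> 0 < s * fst a"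
    using Cons.prems by (auto simp: less_le)
  ultimately show ?case by auto
qed auto

lemma mon_sublist:
  assumes "mon s l" "s = 1 \<or> s = -1" "snd ` set l \<subseteq> carrier H" "sublist v l"
  obtains s' where "mon s' v" "s' = 1 \<or> s' = -1"
proof -
  obtain ps ss where l: "l = ps @ v @ ss" using assms(4) by (rule sublistE)
  have c: "snd ` set ps \<subseteq> carrier H" "snd ` set v \<subseteq> carrier H" using assms(3) l by auto
  have "mon (s * e (hp ps)) v" using assms(1) unfolding l by (simp add: mon_append c)
  moreover have "s * e (hp ps) = 1 \<or> s * e (hp ps) = -1"
    using assms(2) e_cases[OF hp_closed[OF c(1)]] by auto
  ultimately show ?thesis using that by blast
qed

lemma mon_sublist_nontriv:
  assumes "mon s l" "s = 1 \<or> s = -1" "snd ` set l \<subseteq> carrier H" "sublist v l"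
    "\<exists>a\<in>set v. fst a \<noteq> 0"
  shows "\<not> triv 0 v"
proof -
  obtain s' where "mon s' v" "s' = 1 \<or> s' = -1" by (rule mon_sublist[OF assms(1-4)])
  then show ?thesis
    using mon_xc[of s' v] carr_sublist[OF assms(4,3)] assms(5) by (auto simp: triv_def)
qed

text \<open>The product of all of \<open>w\<close> may be trivial, so its first entry is moved to the other end.\<close>

lemma admissible_insert_monotone:
  assumes rem: "rem \<noteq> []" "mon s rem" "s = 1 \<or> s = -1" "fst (hd rem) \<noteq> 0" "fst (last rem) \<noteq> 0"
    and succ: "isolated_zeros rem"
    and w: "\<And>a. a \<in> set w \<Longrightarrow> fst a = 0"
    and wseq: "\<And>v. sublist v w \<Longrightarrow> v \<noteq> [] \<Longrightarrow> v \<noteq> w \<Longrightarrow> hp v \<noteq> \<one>"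
    and carr: "snd ` set rem \<subseteq> carrier H" "snd ` set w \<subseteq> carrier H"
    and id: "(0, \<one>) \<notin> set rem" "(0, \<one>) \<notin> set w"
  shows "admissible 0 (take 1 w @ rem @ drop 1 w)"
proof -
  let ?l = "take 1 w @ rem @ drop 1 w"
  have c1: "snd ` set (take 1 w) \<subseteq> carrier H" "snd ` set (drop 1 w) \<subseteq> carrier H"
    using carr(2) set_take_subset[of 1 w] set_drop_subset[of 1 w] by auto
  have cl: "snd ` set ?l \<subseteq> carrier H" using c1 carr by auto
  define s' where "s' = s * e (hp (take 1 w))"
  have s': "s' = 1 \<or> s' = -1" "s' * e (hp (take 1 w)) = s"
    using rem(3) e_cases[OF hp_closed[OF c1(1)]] by (auto simp: s'_def)
  have "mon s' (take 1 w)"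
    by (rule mon_zero) (use w set_take_subset[of 1 w] in auto)
  moreover have "mon (s * e (hp rem)) (drop 1 w)"
    by (rule mon_zero) (use w set_drop_subset[of 1 w] in auto)
  ultimately have ml: "mon s' ?l"
    using s'(2) rem(2) by (simp only: mon_append[OF c1(1)] mon_append[OF carr(1)] s'(2))
  show ?thesis
    unfolding admissible_def
  proof (intro allI impI)
    fix v assume v: "sublist v ?l \<and> v \<noteq> [] \<and> v \<noteq> ?l"
    have single: "\<not> triv 0 [a]" if "a \<in> set rem \<union> set w" for a
      using that id carr by (cases a) (auto simp: triv_def)
    show "\<not> triv 0 v"
    proof (cases "\<exists>a\<in>set v. fst a \<noteq> 0")
      case True
      then show ?thesis using mon_sublist_nontriv[OF ml s'(1) cl] v by blast
    next
      case False
      \<comment> \<open>Both ends of \<open>rem\<close> have nonzero coordinate, so a segment of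
        zero coordinates cannot pass from one of the three pieces to another.\<close>
      have "hd rem \<notin> set v" "last rem \<notin> set v" using False rem(4,5) by auto
      then have "sublist v (take 1 w) \<or> sublist v rem \<or> sublist v (drop 1 w)"
        using sublist_append_hd[of v "take 1 w" "rem @ drop 1 w"] sublist_append_last[of v rem "drop 1 w"]
          v rem(1) by auto
      then consider "sublist v (take 1 w)" | "sublist v (drop 1 w)" | "sublist v rem" by blast
      then show ?thesis
      proof cases
        case 1
        obtain a v' where v': "v = a # v'" using v by (cases v) auto
        have "length v \<le> length (take 1 w)" using 1 by (rule sublist_length_le)
        then have "v = [a]" using v' by auto
        moreover have "a \<in> set w"
          using set_mono_sublist[OF 1] set_take_subset[of 1 w] v' by auto
        ultimately have "v = [a]" "a \<in> set w" by auto
        then show ?thesis using single by auto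
      next
        case 2
        have "w \<noteq> []" using 2 v by auto
        then have "length v < length w"
          using sublist_length_le[OF 2] by (cases w) auto
        moreover have "sublist v w"
          using 2 sublist_drop sublist_order.order_trans by blast
        ultimately show ?thesis using wseq[of v] v by (auto simp: triv_def)
      next
        case 3
        have "isolated_zeros v" using succ 3 by (rule successively_sublist)
        moreover obtain a v' where v': "v = a # v'" using v by (cases v) auto
        ultimately have "v' = []" using False by (cases v') auto
        then have "v = [a]" using v' by simp
        moreover have "a \<in> set rem" using 3 \<open>v = [a]\<close> set_mono_sublist by fastforce
        ultimately show ?thesis using single by auto
      qed
    qed
  qed
qed

end

section \<open>Sets of integers with signs: rotations\<close>

lemma sublist_length_less:
  assumes "sublist v l" "v \<noteq> l"
  shows "length v < length l"
proof -
  obtain ps ss where "l = ps @ v @ ss" using assms(1) by (rule sublistE)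
  then show ?thesis using assms(2) by (cases ps; cases ss) auto
qed

context signed_group
begin

text \<open>The map has to carry triviality forward only: a trivial proper segment would go to a
  trivial proper segment. This covers negation, translation and the passage to representatives in
  the integers.\<close>

lemma admissible_transfer:
  assumes f: "inj_on f A"
    and triv: "\<And>l. distinct l \<Longrightarrow> set l \<subseteq> A \<Longrightarrow> triv p l \<Longrightarrow> triv p' (map f l)"
    and l': "distinct l'" "set l' = f ` A" "admissible p' l'"
  shows "\<exists>l. distinct l \<and> set l = A \<and> admissible p l"
proof -
  define l where "l = map (inv_into A f) l'"
  have fl: "map f l = l'"
    unfolding l_def map_map by (rule map_idI) (use l'(2) in \<open>auto simp: f_inv_into_f\<close>)
  have sl: "set l = A" using f l'(2) by (auto simp: l_def inv_into_image_cancel)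
  have dl: "distinct l" using fl l'(1) by (metis distinct_map)
  have "\<not> triv p v" if v: "sublist v l" "v \<noteq> []" "v \<noteq> l" for v
  proof
    assume t: "triv p v"
    obtain ps ss where d: "l = ps @ v @ ss" using v(1) by (rule sublistE)
    have "sublist (map f v) l'" unfolding fl[symmetric] d by simp
    moreover have "length (map f v) < length l'"
      using sublist_length_less[OF v(1,3)] by (simp add: l_def)
    then have "map f v \<noteq> l'" by auto
    ultimately have "\<not> triv p' (map f v)" using l'(3) v(2) by (auto simp: admissible_def)
    moreover have "set v \<subseteq> A" "distinct v" using d sl dl by auto
    ultimately show False using triv t by blast
  qed
  then show ?thesis using dl sl by (auto simp: admissible_def)
qed

text \<open>A trivial segment makes the partial products at its two ends equal or, at the start of
  the word, makes one of them the identity.\<close>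

lemma sequencing_sublist_nontrivial:
  assumes "sequencing H S as" "S \<subseteq> carrier H" "sublist v as" "v \<noteq> []" "v \<noteq> as"
  shows "foldr (\<otimes>) v \<one> \<noteq> \<one>"
proof
  assume v1: "foldr (\<otimes>) v \<one> = \<one>"
  have as: "distinct as" "set as = S" "inj_on (partial_product H as) {1..card S}"
    "\<forall>i\<in>{1..card S - 1}. partial_product H as i \<noteq> \<one>"
    using assms(1) by (auto simp: sequencing_def valid_ordering_def ordering_of_def)
  then have card: "card S = length as" using distinct_card by fastforce
  obtain ps ss where d: "as = ps @ v @ ss" using assms(3) by (rule sublistE)
  have c: "set ps \<subseteq> carrier H" "set v \<subseteq> carrier H" using as(2) assms(2) d by auto
  \<comment> \<open>Letters of \<open>H\<close> receive coordinate \<open>0\<close>, so that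
    \<open>hp_append\<close> applies to words in \<open>H\<close>.\<close>
  have fold: "foldr (\<otimes>) u \<one> = hp (map (Pair 0) u)" for u by (simp add: hp_foldr comp_def)
  have ci: "snd ` set (map (Pair (0::int)) u) = set u" for u :: "'h list" by force
  have 1: "partial_product H as (length ps) = hp (map (Pair 0) ps)"
    using d by (simp add: partial_product_def fold)
  have "partial_product H as (length ps + length v) = foldr (\<otimes>) (ps @ v) \<one>"
    using d by (simp add: partial_product_def)
  also have "\<dots> = hp (map (Pair 0) ps @ map (Pair 0) v)" by (simp only: fold map_append)
  also have "\<dots> = hp (map (Pair 0) ps) \<otimes> hp (map (Pair 0) v)"
    using c by (intro hp_append) (simp_all only: ci)
  also have "\<dots> = hp (map (Pair 0) ps)"
    using v1 hp_closed[of "map (Pair 0) ps", unfolded ci, OF c(1)] by (simp add: fold)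
  finally have 2: "partial_product H as (length ps + length v) = partial_product H as (length ps)"
    using 1 by simp
  show False
  proof (cases "ps = []")
    case True
    then have "partial_product H as (length v) = \<one>" using 2 by (simp add: partial_product_def)
    moreover have "length v \<in> {1..card S - 1}"
      using assms(4,5) True d unfolding card by (cases v; cases ss) auto
    ultimately show False using as(4) by blast
  next
    case False
    then have "length ps \<in> {1..card S}" "length ps + length v \<in> {1..card S}"
      using d unfolding card by (cases ps; auto)+
    then show False using inj_onD[OF as(3) 2] assms(4) by simp
  qed
qed

text \<open>Elements with coordinate \<open>0\<close> are determined by their second coordinate, so
  a sequencing of the image in \<open>H\<close> lifts. The assumption
  \<open>strongly_sequenceable H\<close> is unfolded only here.\<close>

lemma sequence_zero_part:
  assumes ss: "strongly_sequenceable H" and fin: "finite A"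
    and A: "\<And>a. a \<in> A \<Longrightarrow> fst a = 0 \<and> snd a \<in> carrier H \<and> snd a \<noteq> \<one>"
  obtains w where "distinct w" "set w = A"
    "\<And>v. sublist v w \<Longrightarrow> v \<noteq> [] \<Longrightarrow> v \<noteq> w \<Longrightarrow> hp v \<noteq> \<one>"
proof -
  let ?S = "snd ` A"
  have S: "?S \<subseteq> carrier H - {\<one>}" "finite ?S" using A fin by auto
  then obtain as where as: "sequencing H ?S as"
    using ss unfolding strongly_sequenceable_def sequenceable_def by blast
  then have das: "distinct as" "set as = ?S"
    by (auto simp: sequencing_def valid_ordering_def ordering_of_def)
  let ?w = "map (Pair (0::int)) as"
  have "a \<in> Pair 0 ` snd ` A" if "a \<in> A" for a
    using A[OF that] that by (cases a) force
  moreover have "Pair 0 (snd a) \<in> A" if "a \<in> A" for a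
    using A[OF that] that by (cases a) auto
  ultimately have "set ?w = A" using das by auto
  moreover have "distinct ?w" using das by (simp add: distinct_map inj_on_def)
  moreover have "hp v \<noteq> \<one>" if v: "sublist v ?w" "v \<noteq> []" "v \<noteq> ?w" for v
  proof -
    obtain ps ss where d: "?w = ps @ v @ ss" using v(1) by (rule sublistE)
    have "as = map snd ?w" by (simp add: comp_def)
    then have e: "as = map snd ps @ map snd v @ map snd ss" unfolding d by simp
    have "length (map snd v) < length as"
      using sublist_length_less[OF v(1,3)] by simp
    then have "map snd v \<noteq> as" by auto
    moreover have "sublist (map snd v) as" unfolding e by simp
    ultimately have "foldr (\<otimes>) (map snd v) \<one> \<noteq> \<one>"
      using sequencing_sublist_nontrivial[OF as] S v(2) by auto
    then show ?thesis by (simp add: hp_foldr)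
  qed
  ultimately show ?thesis using that by blast
qed

definition rot :: "(int \<times> 'h) set \<Rightarrow> bool"
  where "rot S \<longleftrightarrow> (\<forall>a\<in>S. snd a \<in> carrier H \<and> e (snd a) = 1)"

lemma rot_carrier: "rot S \<Longrightarrow> snd ` S \<subseteq> carrier H" by (auto simp: rot_def)

lemma e_hp_rot: "rot (set l) \<Longrightarrow> e (hp l) = 1"
  by (induction l) (auto simp: rot_def e_mult image_subset_iff)

lemma xc_rot: "rot (set l) \<Longrightarrow> xc l = (\<Sum>a\<leftarrow>l. fst a)"
  by (induction l) (auto simp: rot_def)

lemma hp_finprod: "distinct l \<Longrightarrow> snd ` set l \<subseteq> carrier H \<Longrightarrow> hp l = finprod H snd (set l)"
proof (induction l)
  case (Cons a l)
  then show ?case by (simp add: finprod_insert image_subset_iff Pi_iff)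
qed auto

lemma mon_rot: "rot (set l) \<Longrightarrow> mon s l \<longleftrightarrow> (\<forall>a\<in>set l. 0 \<le> s * fst a)"
  by (induction l arbitrary: s) (auto simp: rot_def)

text \<open>Elements of sign \<open>1\<close> commute with one another, since \<open>H\<close> is
  abelian.\<close>

lemma triv_rev:
  assumes "rot (set l)"
  shows "triv p (rev l) \<longleftrightarrow> triv p l"
proof -
  have "xc (rev l) = xc l" using assms by (simp add: xc_rot rev_map[symmetric])
  moreover have "hp (rev l) = hp l" using rot_carrier[OF assms]
    by (induction l) (auto simp: hp_append m_comm)
  ultimately show ?thesis by (simp add: triv_def)
qed

text \<open>The intended word is \<open>pl @ c @ nl\<close>, with positive coordinates on one side,
  negative ones on the other and zeros in \<open>c\<close>. Only segments across \<open>c\<close>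
  are restricted: in any other the nonzero coordinates have one sign. The whole word is exempt, as
  its product does not depend on the order.\<close>

definition balanced :: "(int \<times> 'h) list \<Rightarrow> (int \<times> 'h) set \<Rightarrow> (int \<times> 'h) set \<Rightarrow> bool"
  where "balanced c P N \<longleftrightarrow> (\<exists>pl nl. distinct pl \<and> set pl = P \<and> distinct nl \<and> set nl = N \<and>
    (\<forall>s t. suffix s pl \<longrightarrow> prefix t nl \<longrightarrow> s \<noteq> [] \<longrightarrow> t \<noteq> [] \<longrightarrow> s \<noteq> pl \<or> t \<noteq> nl \<longrightarrow>
       \<not> triv 0 (s @ c @ t)))"

text \<open>The mirror image allows the side of larger total to be taken as the left one.\<close>

lemma balanced_rev:
  assumes "balanced (rev c) N P" "rot P" "rot N" "rot (set c)"
  shows "balanced c P N"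
proof -
  obtain pl nl where l: "distinct pl" "set pl = N" "distinct nl" "set nl = P"
    and b: "\<And>s t. suffix s pl \<Longrightarrow> prefix t nl \<Longrightarrow> s \<noteq> [] \<Longrightarrow> t \<noteq> [] \<Longrightarrow> s \<noteq> pl \<or> t \<noteq> nl \<Longrightarrow>
       \<not> triv 0 (s @ rev c @ t)"
    using assms(1) unfolding balanced_def by blast
  have "\<not> triv 0 (s @ c @ t)"
    if st: "suffix s (rev nl)" "prefix t (rev pl)" "s \<noteq> []" "t \<noteq> []" "s \<noteq> rev nl \<or> t \<noteq> rev pl" for s t
  proof -
    have "rot (set (rev (s @ c @ t)))"
      using assms l set_mono_suffix[OF st(1)] set_mono_prefix[OF st(2)] by (auto simp: rot_def)
    moreover have "\<not> triv 0 (rev t @ rev c @ rev s)"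
      using st by (intro b) (auto simp: suffix_to_prefix)
    ultimately show ?thesis using triv_rev[of "rev (s @ c @ t)" 0] by simp
  qed
  then show ?thesis using l unfolding balanced_def
    by (intro exI[of _ "rev nl"] exI[of _ "rev pl"]) auto
qed

lemma sum_list_pos: "l \<noteq> [] \<Longrightarrow> (\<And>a. a \<in> set l \<Longrightarrow> 0 < k * fst a) \<Longrightarrow> 0 < k * (\<Sum>a\<leftarrow>l. fst a :: int)"
  by (induction l rule: list_nonempty_induct) (auto simp: distrib_left add_pos_pos)

text \<open>The orderings are built from the outside inwards: an outermost entry \<open>a\<close> is removed on the side
  of larger total, and it is chosen so that what remains is not trivial. At most one choice is bad,
  since the remainder determines the removed entry.\<close>

lemma balanced_step:
  assumes fin: "finite P" "finite N" and rot: "rot P" "rot N" "rot (set c)" and c: "\<forall>a\<in>set c. fst a = 0"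
    and N: "\<forall>a\<in>N. 0 < - k * fst a" and le: "0 \<le> k * (sum fst P + sum fst N)"
    and ne: "P \<noteq> {}" and IH: "\<And>a. a \<in> P \<Longrightarrow> balanced c (P - {a}) N"
  shows "balanced c P N"
proof -
  note carr = rot_carrier[OF rot(1)] rot_carrier[OF rot(2)] rot_carrier[OF rot(3)]
  have c0: "(\<Sum>a\<leftarrow>c. fst a) = 0" using c by (induction c) auto
  \<comment> \<open>The product of all of \<open>P\<close>, \<open>c\<close> and \<open>N\<close>.
    Once \<open>a\<close> is removed the rest can be trivial only if \<open>a = (xs, hs)\<close>. If
    this is the only element of \<open>P\<close>, no nonempty left part remains to be
    checked.\<close>
  define xs where "xs = sum fst P + sum fst N"
  define hs where "hs = finprod H snd P \<otimes> hp c \<otimes> finprod H snd N"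
  obtain a where a: "a \<in> P" "P - {a} = {} \<or> a \<noteq> (xs, hs)"
  proof (cases "P = {(xs, hs)}")
    case True then show ?thesis using that by auto
  next
    case False then show ?thesis using that ne by blast
  qed
  obtain pl nl where l: "distinct pl" "set pl = P - {a}" "distinct nl" "set nl = N"
    and bal: "\<And>s t. suffix s pl \<Longrightarrow> prefix t nl \<Longrightarrow> s \<noteq> [] \<Longrightarrow> t \<noteq> [] \<Longrightarrow> s \<noteq> pl \<or> t \<noteq> nl \<Longrightarrow>
        \<not> triv 0 (s @ c @ t)"
    using IH[OF a(1)] unfolding balanced_def by blast
  have rl: "rot (set pl)" "rot (set nl)" "rot (set (a # pl))"
    using l rot(1,2) a(1) by (auto simp: rot_def)
  have xcapp: "xc (s @ c @ t) = (\<Sum>a\<leftarrow>s. fst a) + (\<Sum>a\<leftarrow>t. fst a)" if "rot (set s)" "rot (set t)" for s t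
  proof -
    have "rot (set (s @ c @ t))" using that rot(3) by (auto simp: rot_def)
    then show ?thesis using c0 by (simp add: xc_rot)
  qed
  have "\<not> triv 0 (s @ c @ t)"
    if st: "suffix s (a # pl)" "prefix t nl" "s \<noteq> []" "t \<noteq> []" "s \<noteq> a # pl \<or> t \<noteq> nl" for s t
  proof (cases "s = a # pl")
    case True
    \<comment> \<open>The missing tail \<open>t'\<close> has the sign opposite to \<open>k\<close>,
      so dropping it from the nonnegative total leaves something strictly positive.\<close>
    obtain t' where t': "nl = t @ t'" using st(2) by (auto simp: prefix_def)
    then have "t' \<noteq> []" using st(5) True by auto
    then have pos: "0 < - k * (\<Sum>a\<leftarrow>t'. fst a)" using l(4) t' N by (intro sum_list_pos) auto
    have "(\<Sum>a\<leftarrow>s. fst a) = sum fst P"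
      using True l(1,2) a(1) fin(1) by (simp add: sum_list_distinct_conv_sum_set sum.remove)
    moreover have "(\<Sum>a\<leftarrow>t. fst a) = sum fst N - (\<Sum>a\<leftarrow>t'. fst a)"
      using l(3,4) sum_list_distinct_conv_sum_set[of nl fst] t' by simp
    moreover have "xc (s @ c @ t) = (\<Sum>a\<leftarrow>s. fst a) + (\<Sum>a\<leftarrow>t. fst a)"
      using rl True t' by (intro xcapp) (auto simp: rot_def)
    ultimately have x: "xc (s @ c @ t) = sum fst P + (sum fst N - (\<Sum>a\<leftarrow>t'. fst a))" by (simp only:)
    have "k * xc (s @ c @ t) = k * (sum fst P + sum fst N) + - k * (\<Sum>a\<leftarrow>t'. fst a)"
      unfolding x by (simp add: algebra_simps)
    then have "0 < k * xc (s @ c @ t)" using pos le by linarith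
    then show ?thesis by (auto simp: triv_def)
  next
    case False
    then have s: "suffix s pl" using st(1) by (simp add: suffix_Cons)
    show ?thesis
    proof (cases "s = pl \<and> t = nl")
      case True
      show ?thesis
      proof
        assume t: "triv 0 (s @ c @ t)"
        have pc: "finprod H snd (P - {a}) \<in> carrier H" "finprod H snd N \<in> carrier H" "hp c \<in> carrier H"
          "snd a \<in> carrier H" using carr a(1) by (auto intro!: finprod_closed)
        have "finprod H snd P = snd a \<otimes> finprod H snd (P - {a})"
          using a(1) fin(1) carr(1) finprod_insert[of "P - {a}" a snd]
          by (auto simp: insert_absorb image_subset_iff Pi_iff)
        then have "hs = snd a \<otimes> (finprod H snd (P - {a}) \<otimes> hp c \<otimes> finprod H snd N)"
          using pc by (simp add: hs_def m_assoc)
        also have "finprod H snd (P - {a}) \<otimes> hp c \<otimes> finprod H snd N = hp (pl @ c @ nl)"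
        proof -
          have c1: "snd ` set pl \<subseteq> carrier H" "snd ` set nl \<subseteq> carrier H"
            using rot_carrier[OF rl(1)] rot_carrier[OF rl(2)] .
          have "hp (pl @ c @ nl) = hp pl \<otimes> (hp c \<otimes> hp nl)"
            using c1 carr(3) by (simp add: hp_append image_Un)
          then show ?thesis
            using hp_finprod[OF l(1) c1(1)] hp_finprod[OF l(3) c1(2)] l(2,4) pc by (simp add: m_assoc)
        qed
        finally have "hs = snd a" using t True pc by (simp add: triv_def)
        moreover have "xs = fst a"
          using t True xcapp[OF rl(1,2)] l a(1) fin(1)
          by (simp add: triv_def xs_def sum_list_distinct_conv_sum_set sum.remove)
        moreover have "set pl \<noteq> {}" using st(3) True by simp
        ultimately show False using a(2) l(2) by (auto simp: prod_eq_iff)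
      qed
    next
      case False
      then show ?thesis using bal s st by blast
    qed
  qed
  moreover have "distinct (a # pl)" "set (a # pl) = P" using l a(1) by auto
  ultimately show ?thesis using l unfolding balanced_def by (intro exI[of _ "a # pl"] exI[of _ nl]) auto
qed

text \<open>Induction on the number of entries: \<open>balanced_step\<close> removes one from the
  dominating side, after a reversal if that is the right one. The factor \<open>k\<close> records
  which side is positive.\<close>

lemma balanced_ordering:
  assumes "finite P" "finite N" "rot P" "rot N" "\<forall>a\<in>P. 0 < k * fst a" "\<forall>a\<in>N. 0 < - k * fst a"
    "rot (set c)" "\<forall>a\<in>set c. fst a = 0"
  shows "balanced c P N"
  using assms
proof (induction "card P + card N" arbitrary: P N c k rule: less_induct)
  case less
  have r: "rot (S - {a})" if "rot S" for S a using that by (simp add: rot_def)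
  show ?case
  proof (cases "P = {} \<or> N = {}")
    case True
    obtain pl nl where "distinct pl" "set pl = P" "distinct nl" "set nl = N"
      using finite_distinct_list less.prems(1,2) by metis
    then show ?thesis using True unfolding balanced_def by (intro exI[of _ pl] exI[of _ nl]) auto
  next
    case ne: False
    show ?thesis
    proof (cases "0 \<le> k * (sum fst P + sum fst N)")
      case True
      show ?thesis
      proof (rule balanced_step[OF less.prems(1-4,7,8,6) True])
        fix a assume "a \<in> P"
        then have "card (P - {a}) + card N < card P + card N"
          using less.prems(1) by (meson add_strict_right_mono card_Diff1_less)
        then show "balanced c (P - {a}) N"
          by (rule less.hyps[of _ _ k]) (use less.prems r in auto)
      qed (use ne in simp)
    next
      case False
      have rc: "rot (set (rev c))" "\<forall>a\<in>set (rev c). fst a = 0" "\<forall>a\<in>P. 0 < - (- k) * fst a"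
        using less.prems by auto
      have "0 \<le> - k * (sum fst N + sum fst P)" using False by (simp add: algebra_simps)
      then have "balanced (rev c) N P"
      proof (rule balanced_step[OF less.prems(2,1,4,3) rc])
        fix a assume "a \<in> N"
        then have "card (N - {a}) + card P < card P + card N"
          using less.prems(2) card_Diff1_less[of N a] by linarith
        then show "balanced (rev c) (N - {a}) P"
          by (rule less.hyps[of _ _ "- k"]) (use less.prems r in auto)
      qed (use ne in simp)
      then show ?thesis using balanced_rev less.prems(3,4,7) by blast
    qed
  qed
qed

lemma successively_nonzero:
  "(\<And>a. a \<in> set l \<Longrightarrow> fst a \<noteq> 0) \<Longrightarrow> isolated_zeros l"
  by (induction l rule: induct_list012) auto

lemma rot_sublist_positive:
  assumes "rot (set l)" "\<forall>a\<in>set l. 0 \<le> fst a" "\<exists>a\<in>set l. 0 < fst a"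
  shows "\<not> triv 0 l"
proof -
  have "mon 1 l" using assms by (simp add: mon_rot)
  moreover have "\<exists>a\<in>set l. fst a \<noteq> 0" using assms(3) by force
  ultimately show ?thesis using mon_xc[of 1 l] rot_carrier[OF assms(1)] by (auto simp: triv_def)
qed

lemma rot_sublist_negative:
  assumes "rot (set l)" "\<forall>a\<in>set l. fst a \<le> 0" "\<exists>a\<in>set l. fst a < 0"
  shows "\<not> triv 0 l"
proof -
  have "mon (-1) l" using assms by (simp add: mon_rot)
  moreover have "\<exists>a\<in>set l. fst a \<noteq> 0" using assms(3) by force
  ultimately show ?thesis using mon_xc[of "-1" l] rot_carrier[OF assms(1)] by (auto simp: triv_def)
qed

text \<open>The product of all zero elements may be trivial, whereas no segment of \<open>c\<close>
  may be, not even \<open>c\<close> itself; so one of them can be set apart in \<open>G\<close>.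
  Then \<open>pl @ c @ nl\<close> is a proper segment, which the last hypothesis takes care of. A
  segment that starts with \<open>G\<close> and meets \<open>nl\<close> lacks a negative tail, so
  its sum is positive.\<close>

lemma admissible_balanced:
  assumes r: "rot (set pl)" "rot (set c)" "rot (set nl)" "rot (set G)"
    and sgn: "\<forall>a\<in>set pl. 0 < fst a" "\<forall>a\<in>set nl. fst a < 0" "\<forall>a\<in>set c. fst a = 0" "\<forall>a\<in>set G. fst a = 0"
    and sum: "0 \<le> (\<Sum>a\<leftarrow>pl. fst a) + (\<Sum>a\<leftarrow>nl. fst a)"
    and ne: "pl \<noteq> []"
    and cc: "\<And>v. sublist v c \<Longrightarrow> v \<noteq> [] \<Longrightarrow> hp v \<noteq> \<one>"
    and bal: "\<And>s t. suffix s pl \<Longrightarrow> prefix t nl \<Longrightarrow> s \<noteq> [] \<Longrightarrow> t \<noteq> [] \<Longrightarrow> s \<noteq> pl \<or> t \<noteq> nl \<Longrightarrow>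
            \<not> triv 0 (s @ c @ t)"
    and G: "G = [] \<or> G = [g] \<and> snd g \<noteq> \<one> \<and> \<not> triv 0 (pl @ c @ nl)"
  shows "admissible 0 (G @ pl @ c @ nl)"
  unfolding admissible_def
proof (intro allI impI)
  fix v assume v: "sublist v (G @ pl @ c @ nl) \<and> v \<noteq> [] \<and> v \<noteq> G @ pl @ c @ nl"
  have rv: "rot (set v)" using v r set_mono_sublist[of v "G @ pl @ c @ nl"] by (auto simp: rot_def)
  show "\<not> triv 0 v"
  proof (cases "(\<exists>a\<in>set v. 0 < fst a) \<and> (\<exists>a\<in>set v. fst a < 0)")
    case False
    show ?thesis
    proof (cases "\<exists>a\<in>set v. fst a \<noteq> 0")
      case True
      then show ?thesis
        using False rot_sublist_positive[OF rv] rot_sublist_negative[OF rv] by (meson not_less linorder_neqE)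
    next
      case zero: False
      have no: "a \<notin> set v" if "a \<in> set pl \<union> set nl" for a
        using that zero sgn(1,2) by force
      have "sublist v G \<or> sublist v (pl @ c @ nl)"
        using sublist_append_hd[of v G "pl @ c @ nl"] v ne no[of "hd pl"] by simp
      moreover have "sublist v pl \<or> sublist v (c @ nl)" if "sublist v (pl @ c @ nl)"
        using sublist_append_last[OF that] ne no[of "last pl"] by simp
      moreover have "sublist v c \<or> sublist v nl" if "sublist v (c @ nl)"
        using sublist_append_hd[OF that] no[of "hd nl"] by (cases nl) auto
      moreover have "\<not> sublist v pl" "\<not> sublist v nl"
        using v no set_mono_sublist[of v pl] set_mono_sublist[of v nl] by (cases v; auto)+
      ultimately have "sublist v G \<or> sublist v c" by blast
      then show ?thesis
      proof
        assume sv: "sublist v G"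
        then have "G = [g]" "snd g \<noteq> \<one>" using G v by auto
        moreover have "v = [g]" using sv v \<open>G = [g]\<close> sublist_length_less[of v "[g]"] by (cases "v = [g]") auto
        ultimately show ?thesis using r(4) by (auto simp: triv_def rot_def)
      next
        assume "sublist v c" then show ?thesis using cc v by (auto simp: triv_def)
      qed
    qed
  next
    case both: True
    have "\<not> sublist v (G @ pl @ c)" "\<not> sublist v nl"
      using both sgn set_mono_sublist[of v "G @ pl @ c"] set_mono_sublist[of v nl] by force+
    then obtain a t where at: "v = a @ t" "suffix a (G @ pl @ c)" "prefix t nl"
      using v sublist_append[of v "G @ pl @ c" nl] by auto
    have sets: "set a \<subseteq> set G \<union> set pl \<union> set c" "set t \<subseteq> set nl"
      using set_mono_suffix[OF at(2)] set_mono_prefix[OF at(3)] by auto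
    have "t \<noteq> []" using both at(1) sets(1) sgn by force
    have pos: "\<exists>x\<in>set a. 0 < fst x" using both at(1) sets(2) sgn(2) by force
    then have "\<not> suffix a c" using sgn(3) set_mono_suffix[of a c] by force
    then obtain a' where a': "a = a' @ c" "suffix a' (G @ pl)"
      using at(2) suffix_append[of a "G @ pl" c] by auto
    have "a' \<noteq> []" using pos a'(1) sgn(3) by force
    have "suffix a' pl \<or> G \<noteq> [] \<and> a' = G @ pl"
      using a'(2) G by (auto simp: suffix_append suffix_Cons)
    then show ?thesis
    proof
      assume "suffix a' pl"
      then have "\<not> triv 0 (a' @ c @ t)"
        using bal[OF _ at(3) \<open>a' \<noteq> []\<close> \<open>t \<noteq> []\<close>] v at(1) a'(1) G by auto
      then show ?thesis using at(1) a'(1) by simp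
    next
      assume "G \<noteq> [] \<and> a' = G @ pl"
      then have ve: "v = G @ pl @ c @ t" using at(1) a'(1) by simp
      obtain t' where t': "nl = t @ t'" using at(3) by (auto simp: prefix_def)
      then have "t' \<noteq> []" using v ve by auto
      then have "0 < -1 * (\<Sum>a\<leftarrow>t'. fst a)" using sgn(2) t' by (intro sum_list_pos) auto
      moreover have "(\<Sum>a\<leftarrow>c. fst a) = 0" "(\<Sum>a\<leftarrow>G. fst a) = 0" using sgn(3,4) by (induction c, auto, induction G, auto)
      then have "xc v = (\<Sum>a\<leftarrow>pl. fst a) + (\<Sum>a\<leftarrow>t. fst a)" using xc_rot[OF rv] by (simp add: ve)
      ultimately show ?thesis using sum t' by (auto simp: triv_def)
    qed
  qed
qed

lemma rotations_admissible_nonneg: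
  assumes ss: "strongly_sequenceable H" and A: "finite A" "rot A" "(0, \<one>) \<notin> A"
    and pn: "\<exists>a\<in>A. 0 < fst a" "0 \<le> sum fst A"
  shows "\<exists>l. distinct l \<and> set l = A \<and> admissible 0 l"
proof -
  define P where "P = {a\<in>A. 0 < fst a}"
  define N where "N = {a\<in>A. fst a < 0}"
  define Z where "Z = {a\<in>A. fst a = 0}"
  have A_eq: "A = P \<union> Z \<union> N" and dj: "P \<inter> N = {}" "P \<inter> Z = {}" "Z \<inter> N = {}"
    by (auto simp: P_def N_def Z_def)
  have fin: "finite P" "finite N" "finite Z" using A(1) by (auto simp: P_def N_def Z_def)
  have r: "rot P" "rot N" "rot Z" using A(2) by (auto simp: rot_def P_def N_def Z_def)
  have sg: "\<forall>a\<in>P. 0 < fst a" "\<forall>a\<in>N. fst a < 0" "\<forall>a\<in>Z. fst a = 0"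
    by (auto simp: P_def N_def Z_def)
  have "P \<noteq> {}" using pn by (auto simp: P_def)
  have Zid: "fst a = 0 \<and> snd a \<in> carrier H \<and> snd a \<noteq> \<one>" if "a \<in> Z" for a
    using that A r(3) by (cases a) (auto simp: Z_def rot_def)
  obtain w where w: "distinct w" "set w = Z"
    "\<And>v. sublist v w \<Longrightarrow> v \<noteq> [] \<Longrightarrow> v \<noteq> w \<Longrightarrow> hp v \<noteq> \<one>"
    by (rule sequence_zero_part[OF ss fin(3) Zid]) auto
  have "sum fst A = sum fst P + sum fst Z + sum fst N"
    unfolding A_eq using fin dj by (subst sum.union_disjoint, auto)+
  moreover have "sum fst Z = 0" using sg(3) by simp
  ultimately have sPN: "0 \<le> sum fst P + sum fst N" using pn(2) by simp
  \<comment> \<open>If \<open>w\<close> has at least two letters, an end letter \<open>g\<close> is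
    put in front, which leaves a proper segment \<open>c\<close> of \<open>w\<close>. The rest of
    the final word can be trivial only if \<open>g\<close> carries the product of all of
    \<open>A\<close>, and this holds for at most one of the two ends.\<close>
  obtain G c where Gc: "distinct (G @ c)" "set G \<union> set c = Z"
    "\<And>v. sublist v c \<Longrightarrow> v \<noteq> [] \<Longrightarrow> hp v \<noteq> \<one>"
    "G = [] \<or> (\<exists>g. G = [g] \<and> (0, finprod H snd A) \<noteq> g)"
  proof (cases "length w \<le> 1")
    case True
    have "hp v \<noteq> \<one>" if v: "sublist v w" "v \<noteq> []" for v
    proof -
      have "length v \<le> length w" using v(1) by (rule sublist_length_le)
      moreover have "length v \<noteq> 0" using v(2) by simp
      ultimately have "length v = Suc 0" using True by linarith
      then obtain a where a: "v = [a]" by (auto simp: length_Suc_conv)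
      then have "a \<in> Z" using w(2) set_mono_sublist[OF v(1)] by auto
      then show ?thesis using Zid a by auto
    qed
    then show ?thesis using that[of "[]" w] w by auto
  next
    case False
    note result = that
    have key: thesis if gc: "w = [g] @ c \<or> w = c @ [g]" "(0, finprod H snd A) \<noteq> g" for g c
    proof (rule result[of "[g]" c])
      show "hp v \<noteq> \<one>" if "sublist v c" "v \<noteq> []" for v
      proof (rule w(3))
        show "sublist v w" using that(1) gc(1) by (auto simp: sublist_Cons_right sublist_append)
        show "v \<noteq> w" using sublist_length_le[OF that(1)] gc(1) by auto
      qed (rule that)
    qed (use w gc in auto)
    show ?thesis
    proof (cases "(0, finprod H snd A) = hd w")
      case neq: False
      show ?thesis by (rule key[of "hd w" "tl w"]) (use False neq in \<open>cases w; auto\<close>)+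
    next
      case True
      obtain x xs where xs: "w = x # xs" using False by (cases w) auto
      then have "xs \<noteq> []" using False by auto
      then have "last xs \<noteq> x" using w(1) xs last_in_set[of xs] by auto
      then show ?thesis using True xs \<open>xs \<noteq> []\<close> by (intro key[of "last w" "butlast w"]) auto
    qed
  qed
  have rc: "rot (set c)" "rot (set G)" using Gc(2) r(3) by (auto simp: rot_def)
  have zc: "\<forall>a\<in>set c. fst a = 0" "\<forall>a\<in>set G. fst a = 0" using Gc(2) sg(3) by auto
  obtain pl nl where l: "distinct pl" "set pl = P" "distinct nl" "set nl = N"
    and bal: "\<forall>s t. suffix s pl \<longrightarrow> prefix t nl \<longrightarrow> s \<noteq> [] \<longrightarrow> t \<noteq> [] \<longrightarrow> s \<noteq> pl \<or> t \<noteq> nl \<longrightarrow>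
       \<not> triv 0 (s @ c @ t)"
    using balanced_ordering[of P N 1 c] fin r sg rc zc unfolding balanced_def by auto
  let ?l = "G @ pl @ c @ nl"
  have dl: "distinct ?l" using l Gc(1,2) dj by auto
  have sl: "set ?l = A" using l Gc(2) unfolding A_eq by auto
  have G: "G = [] \<or> (\<exists>g. G = [g] \<and> snd g \<noteq> \<one> \<and> \<not> triv 0 (pl @ c @ nl))"
  proof (cases "G = []")
    case False
    then obtain g where g: "G = [g]" "(0, finprod H snd A) \<noteq> g" using Gc(4) by blast
    have gZ: "g \<in> Z" using Gc(2) g by auto
    have "\<not> triv 0 (pl @ c @ nl)"
    proof
      assume t: "triv 0 (pl @ c @ nl)"
      have "hp ?l = snd g \<otimes> hp (pl @ c @ nl)" using g by simp
      then have "hp ?l = snd g" using t Zid[OF gZ] by (simp add: triv_def)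
      moreover have "hp ?l = finprod H snd A"
        using hp_finprod[OF dl] sl A(2) rot_carrier by simp
      ultimately show False using g(2) Zid[OF gZ] by (cases g) auto
    qed
    then show ?thesis using g Zid[OF gZ] by blast
  qed auto
  then obtain g where G': "G = [] \<or> G = [g] \<and> snd g \<noteq> \<one> \<and> \<not> triv 0 (pl @ c @ nl)" by blast
  have "admissible 0 ?l"
  proof (rule admissible_balanced[OF _ rc(1) _ rc(2) _ _ zc])
    show "rot (set pl)" "rot (set nl)" "\<forall>a\<in>set pl. 0 < fst a" "\<forall>a\<in>set nl. fst a < 0"
      using l r sg by auto
    show "0 \<le> (\<Sum>a\<leftarrow>pl. fst a) + (\<Sum>a\<leftarrow>nl. fst a)"
      using sPN l by (simp add: sum_list_distinct_conv_sum_set)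
    show "pl \<noteq> []" using l \<open>P \<noteq> {}\<close> by auto
    show "\<And>v. sublist v c \<Longrightarrow> v \<noteq> [] \<Longrightarrow> hp v \<noteq> \<one>" using Gc(3) .
    show "G = [] \<or> G = [g] \<and> snd g \<noteq> \<one> \<and> \<not> triv 0 (pl @ c @ nl)" using G' .
  qed (use bal in blast)
  then show ?thesis using dl sl by blast
qed

definition neg :: "int \<times> 'h \<Rightarrow> int \<times> 'h" where "neg a = (- fst a, snd a)"

lemma inj_neg: "inj_on neg S" by (auto simp: inj_on_def neg_def prod_eq_iff)

lemma snd_neg [simp]: "snd (neg a) = snd a" and fst_neg [simp]: "fst (neg a) = - fst a"
  by (simp_all add: neg_def)

lemma triv_neg: "triv 0 l \<Longrightarrow> triv 0 (map neg l)"
proof -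
  have "xc (map neg l) = - xc l" by (induction l) (auto simp: algebra_simps)
  moreover have "hp (map neg l) = hp l" by (rule hp_cong) simp
  ultimately show "triv 0 l \<Longrightarrow> triv 0 (map neg l)" by (simp add: triv_def)
qed

lemma neg_transfer:
  assumes "\<exists>l. distinct l \<and> set l = neg ` A \<and> admissible 0 l"
  shows "\<exists>l. distinct l \<and> set l = A \<and> admissible 0 l"
  using assms admissible_transfer[OF inj_neg[of A], of 0 0] triv_neg by blast

lemma zero_admissible:
  assumes ss: "strongly_sequenceable H" and fin: "finite A"
    and A: "\<And>a. a \<in> A \<Longrightarrow> fst a = 0 \<and> snd a \<in> carrier H \<and> snd a \<noteq> \<one>"
  shows "\<exists>l. distinct l \<and> set l = A \<and> admissible 0 l"
proof -
  obtain w where "distinct w" "set w = A"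
    "\<And>v. sublist v w \<Longrightarrow> v \<noteq> [] \<Longrightarrow> v \<noteq> w \<Longrightarrow> hp v \<noteq> \<one>"
    by (rule sequence_zero_part[OF ss fin A]) auto
  then show ?thesis by (auto simp: admissible_def triv_def)
qed

lemma rotations_admissible:
  assumes ss: "strongly_sequenceable H" and A: "finite A" "rot A" "(0, \<one>) \<notin> A"
  shows "\<exists>l. distinct l \<and> set l = A \<and> admissible 0 l"
proof (cases "\<exists>a\<in>A. fst a \<noteq> 0")
  case False
  have "fst a = 0 \<and> snd a \<in> carrier H \<and> snd a \<noteq> \<one>" if "a \<in> A" for a
    using that False A by (cases a) (force simp: rot_def)
  then show ?thesis using zero_admissible[OF ss A(1)] by blast
next
  case ne: True
  have neg: "\<exists>l. distinct l \<and> set l = A \<and> admissible 0 l"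
    if "\<exists>a\<in>A. fst a < 0" "sum fst A \<le> 0"
  proof (rule neg_transfer, rule rotations_admissible_nonneg[OF ss])
    show "finite (neg ` A)" "rot (neg ` A)" using A by (auto simp: rot_def)
    show "(0, \<one>) \<notin> neg ` A" using A(3) by (auto simp: neg_def)
    show "\<exists>a\<in>neg ` A. 0 < fst a" using that(1) by auto
    show "0 \<le> sum fst (neg ` A)" using that(2) by (simp add: sum.reindex[OF inj_neg] sum_negf)
  qed
  show ?thesis
  proof (cases "(\<exists>a\<in>A. 0 < fst a) \<and> 0 \<le> sum fst A")
    case True then show ?thesis using rotations_admissible_nonneg[OF ss A] by blast
  next
    case False
    have "sum fst A \<le> 0"
    proof (cases "\<exists>a\<in>A. 0 < fst a")
      case True then show ?thesis using False by auto
    next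
      case no: False
      show ?thesis by (rule sum_nonpos) (use no in force)
    qed
    moreover have "\<exists>a\<in>A. fst a < 0"
    proof (rule ccontr)
      assume n: "\<not> (\<exists>a\<in>A. fst a < 0)"
      then have "\<exists>a\<in>A. 0 < fst a" using ne by force
      moreover have "0 \<le> sum fst A" by (rule sum_nonneg) (use n in force)
      ultimately show False using False by blast
    qed
    ultimately show ?thesis using neg by blast
  qed
qed

end

section \<open>Sets of integers with signs: reflections\<close>

context signed_group
begin

text \<open>Reflections with coordinate \<open>0\<close> may already serve as separators in
  \<open>rem\<close>; what is left has coordinate \<open>0\<close> and is placed around it.\<close>

lemma admissible_from_monotone:
  assumes ss: "strongly_sequenceable H" and A: "finite A" "snd ` A \<subseteq> carrier H" "(0, \<one>) \<notin> A"
    and rem: "distinct rem" "set rem \<subseteq> A" "\<And>a. a \<in> A \<Longrightarrow> fst a \<noteq> 0 \<Longrightarrow> a \<in> set rem"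
      "rem \<noteq> []" "mon s rem" "s = 1 \<or> s = -1" "fst (hd rem) \<noteq> 0" "fst (last rem) \<noteq> 0"
      "isolated_zeros rem"
  shows "\<exists>l. distinct l \<and> set l = A \<and> admissible 0 l"
proof -
  define Y where "Y = A - set rem"
  have finY: "finite Y" using A(1) by (simp add: Y_def)
  have z: "fst a = 0 \<and> snd a \<in> carrier H \<and> snd a \<noteq> \<one>" if "a \<in> Y" for a
    using that rem(3) A(2,3) unfolding Y_def by (cases a) force
  obtain w where w: "distinct w" "set w = Y"
    "\<And>v. sublist v w \<Longrightarrow> v \<noteq> [] \<Longrightarrow> v \<noteq> w \<Longrightarrow> hp v \<noteq> \<one>"
    by (rule sequence_zero_part[OF ss finY z]) auto
  let ?l = "take 1 w @ rem @ drop 1 w"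
  have wA: "set w \<subseteq> A" using w(2) by (auto simp: Y_def)
  have c: "snd ` set rem \<subseteq> carrier H" "snd ` set w \<subseteq> carrier H"
    using image_mono[OF rem(2), of snd] image_mono[OF wA, of snd] A(2) by auto
  have "admissible 0 ?l"
    by (rule admissible_insert_monotone[OF rem(4-9) _ w(3) c]) (use z w(2) A(3) rem(2) wA in auto)
  moreover have td: "set w = set (take 1 w) \<union> set (drop 1 w)" by (metis append_take_drop_id set_append)
  then have "set ?l = A" using w(2) rem(2) by (auto simp: Y_def)
  moreover have "set (take 1 w) \<inter> set (drop 1 w) = {}"
    using w(1) by (intro set_take_disj_set_drop_if_distinct) auto
  then have "distinct ?l" using td w(1,2) rem(1) by (auto simp: Y_def)
  ultimately show ?thesis by blast
qed

lemma successively_append_nonzero: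
  assumes "\<And>a. a \<in> set xs \<Longrightarrow> fst a \<noteq> 0" "isolated_zeros l"
  shows "isolated_zeros (xs @ l)"
  using assms by (induction xs) (auto simp: successively_Cons)

lemma successively_splice:
  assumes "length ys = length bs" "\<And>b. b \<in> set bs \<Longrightarrow> fst b \<noteq> 0"
    "isolated_zeros t"
  shows "isolated_zeros (splice ys bs @ t)"
  using assms by (induction ys bs rule: list_induct2) (auto simp: successively_Cons)

lemma last_splice: "length ys = length bs \<Longrightarrow> bs \<noteq> [] \<Longrightarrow> last (splice ys bs) \<in> set bs"
proof (induction ys bs rule: list_induct2)
  case (Cons y ys b bs)
  then show ?case by (cases bs) auto
qed auto

lemma set_splice: "set (splice ys bs) = set ys \<union> set bs"
  by (induction ys bs rule: splice.induct) auto

lemma distinct_splice: "distinct (ys @ bs) \<Longrightarrow> distinct (splice ys bs)"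
  by (induction ys bs rule: splice.induct) (auto simp: set_splice)

text \<open>A reflection from \<open>ys\<close> is read with sign \<open>-1\<close>, the next one
  from \<open>bs\<close> with sign \<open>1\<close>, and each such pair restores the running
  sign.\<close>

lemma mon_splice:
  assumes "length ys = length bs" "\<forall>a\<in>set ys. fst a \<le> 0 \<and> e (snd a) = -1"
    "\<forall>a\<in>set bs. 0 \<le> fst a \<and> e (snd a) = -1" "mon (-1) t"
  shows "mon (-1) (splice ys bs @ t)"
  using assms by (induction ys bs rule: list_induct2) auto

lemma mon_rot_append:
  assumes "rot (set l)" "\<forall>a\<in>set l. 0 \<le> s * fst a" "mon s t"
  shows "mon s (l @ t)"
  using assms mon_append[OF rot_carrier[OF assms(1)]] by (simp add: mon_rot e_hp_rot)

text \<open>Positive rotations are read with sign \<open>1\<close>; a positive reflection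
  \<open>b0\<close> flips the sign, negative rotations follow, and then the other reflections
  alternate. By the cardinality conditions, reflections with coordinate \<open>0\<close> can replace
  the missing negative ones in this alternation.\<close>

lemma reflections_admissible:
  fixes A :: "(int \<times> 'h) set"
  defines "B \<equiv> {a\<in>A. e (snd a) = -1 \<and> 0 < fst a}"
    and "S \<equiv> {a\<in>A. e (snd a) = -1 \<and> fst a < 0}"
    and "Z \<equiv> {a\<in>A. e (snd a) = -1 \<and> fst a = 0}"
  assumes ss: "strongly_sequenceable H" and A: "finite A" "snd ` A \<subseteq> carrier H" "(0, \<one>) \<notin> A"
    and card: "card S \<le> card B" "card B \<le> card S + card Z" "B \<union> Z \<noteq> {}"
  shows "\<exists>l. distinct l \<and> set l = A \<and> admissible 0 l"
proof -
  define P where "P = {a\<in>A. e (snd a) = 1 \<and> 0 < fst a}"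
  define N where "N = {a\<in>A. e (snd a) = 1 \<and> fst a < 0}"
  have fin: "finite P" "finite N" "finite B" "finite S" "finite Z"
    using A(1) by (auto simp: P_def N_def B_def S_def Z_def)
  have nonzero: "a \<in> P \<union> N \<union> B \<union> S" if "a \<in> A" "fst a \<noteq> 0" for a
    using that A(2) e_cases[of "snd a"] by (auto simp: P_def N_def B_def S_def)
  obtain pl nl where l: "distinct pl" "set pl = P" "distinct nl" "set nl = N"
    using finite_distinct_list fin(1,2) by metis
  have r: "rot (set pl)" "rot (set nl)" using l A(2) by (auto simp: rot_def P_def N_def)
  have sg: "\<forall>a\<in>set pl. 0 \<le> 1 * fst a" "\<forall>a\<in>set nl. 0 \<le> -1 * fst a" "\<forall>a\<in>set pl. 0 < fst a"
     "\<forall>a\<in>set nl. fst a < 0"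
    using l by (auto simp: P_def N_def)
  have ends: "fst (hd u) \<noteq> 0 \<and> fst (last u) \<noteq> 0"
    if "u \<noteq> []" "(\<forall>a\<in>set u. 0 < fst a) \<or> (\<forall>a\<in>set u. fst a < 0)" for u :: "(int \<times> 'h) list"
    using that hd_in_set[of u] last_in_set[of u] by (metis less_irrefl)
  note concl = admissible_from_monotone[OF ss A]
  show ?thesis
  proof (cases "B = {}")
    case True
    then have "S = {}" using card(1) fin by auto
    have nz: "a \<in> P \<union> N" if "a \<in> A" "fst a \<noteq> 0" for a
      using nonzero[OF that] True \<open>S = {}\<close> by auto
    \<comment> \<open>Here all reflections have coordinate \<open>0\<close>, and \<open>z\<close> is
      used to flip the sign between \<open>pl\<close> and \<open>nl\<close>.\<close>
    obtain z where z: "z \<in> Z" using card(3) True by auto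
    have zp: "z \<in> A" "fst z = 0" "e (snd z) = -1" using z by (auto simp: Z_def)
    consider "P = {}" "N = {}" | "P \<noteq> {}" "N = {}" | "P = {}" "N \<noteq> {}" | "P \<noteq> {}" "N \<noteq> {}" by blast
    then show ?thesis
    proof cases
      case 1
      have "fst a = 0 \<and> snd a \<in> carrier H \<and> snd a \<noteq> \<one>" if "a \<in> A" for a
        using that nz[OF that] 1 A(2,3) by (cases a) auto
      then show ?thesis using zero_admissible[OF ss A(1)] by blast
    next
      case 2
      have ne: "pl \<noteq> []" using 2 l by auto
      show ?thesis
      proof (rule concl[of pl 1])
        show "mon 1 pl" using r sg by (simp add: mon_rot)
        show "fst (hd pl) \<noteq> 0" "fst (last pl) \<noteq> 0" using ends[of pl] ne sg(3) by auto
        show "isolated_zeros pl"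
          by (rule successively_nonzero) (use sg(3) in force)
      qed (use l nz 2 ne in \<open>auto simp: P_def\<close>)
    next
      case 3
      have ne: "nl \<noteq> []" using 3 l by auto
      show ?thesis
      proof (rule concl[of nl "-1"])
        show "mon (-1) nl" using r sg by (simp add: mon_rot)
        show "fst (hd nl) \<noteq> 0" "fst (last nl) \<noteq> 0" using ends[of nl] ne sg(4) by auto
        show "isolated_zeros nl"
          by (rule successively_nonzero) (use sg(4) in force)
      qed (use l nz 3 ne in \<open>auto simp: N_def\<close>)
    next
      case 4
      have ne: "pl \<noteq> []" "nl \<noteq> []" using 4 l by auto
      have zn: "z \<notin> set pl" "z \<notin> set nl" "set pl \<inter> set nl = {}" using zp l by (auto simp: P_def N_def)
      show ?thesis
      proof (rule concl[of "pl @ [z] @ nl" 1])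
        show "mon 1 (pl @ [z] @ nl)" using r(2) sg(2) zp
          by (intro mon_rot_append[OF r(1) sg(1)]) (simp add: mon_rot)
        show "fst (hd (pl @ [z] @ nl)) \<noteq> 0" "fst (last (pl @ [z] @ nl)) \<noteq> 0"
          using ends[of pl] ends[of nl] ne sg(3,4) by auto
        have nn: "fst (hd nl) \<noteq> 0" using ends[of nl] ne sg(4) by auto
        show "isolated_zeros (pl @ [z] @ nl)"
        proof (rule successively_append_nonzero)
          have "isolated_zeros nl"
            by (rule successively_nonzero) (use sg(4) in force)
          then show "isolated_zeros ([z] @ nl)"
            using nn by (simp add: successively_Cons)
        qed (use sg(3) in force)
        show "distinct (pl @ [z] @ nl)" using l zn by auto
        show "set (pl @ [z] @ nl) \<subseteq> A" using l zp by (auto simp: P_def N_def)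
        show "\<And>a. a \<in> A \<Longrightarrow> fst a \<noteq> 0 \<Longrightarrow> a \<in> set (pl @ [z] @ nl)" using nz l by auto
      qed auto
    qed
  next
    case False
    then obtain b0 where b0: "b0 \<in> B" by blast
    obtain bs where bs: "distinct bs" "set bs = B - {b0}" using finite_distinct_list fin(3) by blast
    have lb: "length bs = card B - 1"
      using distinct_card[OF bs(1)] bs(2) b0 fin(3) by simp
    \<comment> \<open>The alternation needs \<open>card B - 1\<close> entries in \<open>ys\<close>.
      If \<open>B\<close> and \<open>S\<close> are equally large, one negative reflection is left
      over and ends the word as \<open>tl\<close>; otherwise zeros fill up \<open>S\<close>.\<close>
    obtain ys tl where yt: "distinct (ys @ tl)" "length ys = length bs" "set ys \<subseteq> Z \<union> S"
      "S \<subseteq> set ys \<union> set tl" "tl = [] \<or> (\<exists>s. tl = [s] \<and> s \<in> S)"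
    proof (cases "card B = card S")
      case True
      then have "S \<noteq> {}" using False fin by auto
      then obtain s where s: "s \<in> S" by blast
      obtain ys where ys: "distinct ys" "set ys = S - {s}" using finite_distinct_list fin(4) by blast
      then have "length ys = length bs" using lb True s fin(4) distinct_card[OF ys(1)] by simp
      then show ?thesis using ys s by (intro that[of ys "[s]"]) auto
    next
      case ne: False
      then have "card B - card S - 1 \<le> card Z" using card by auto
      then obtain Z' where Z': "Z' \<subseteq> Z" "card Z' = card B - card S - 1" "finite Z'"
        using obtain_subset_with_card_n by metis
      obtain ys where ys: "distinct ys" "set ys = S \<union> Z'" using finite_distinct_list fin(4) Z'(3) by (meson finite_Un)
      have "S \<inter> Z' = {}" using Z'(1) by (auto simp: S_def Z_def)
      then have "length ys = card S + card Z'"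
        using distinct_card[OF ys(1)] ys(2) fin(4) Z'(3) by (simp add: card_Un_disjoint)
      then have "length ys = length bs" using lb Z'(2) ne card(1) by simp
      then show ?thesis using ys Z'(1) by (intro that[of ys "[]"]) auto
    qed
    let ?m = "splice ys bs @ tl"
    let ?rem = "pl @ [b0] @ nl @ ?m"
    have bp: "\<forall>a\<in>B. 0 < fst a \<and> e (snd a) = -1" "\<forall>a\<in>S. fst a < 0 \<and> e (snd a) = -1"
      "\<forall>a\<in>Z. fst a = 0 \<and> e (snd a) = -1"
      by (auto simp: B_def S_def Z_def)
    have yp: "\<forall>a\<in>set ys. fst a \<le> 0 \<and> e (snd a) = -1" using yt(3) bp(2,3) by force
    have tlS: "set tl \<subseteq> S" using yt(5) by auto
    have mtl: "mon (-1) tl" using yt(5) bp(2) by auto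
    have "\<forall>a\<in>set bs. 0 \<le> fst a \<and> e (snd a) = -1" using bs(2) bp(1) by auto
    then have mm: "mon (-1) ?m" by (intro mon_splice[OF yt(2) yp]) (simp_all add: mtl)
    have sets: "set ?m \<subseteq> (B - {b0}) \<union> S \<union> Z" using yt(3) tlS bs(2) by (auto simp: set_splice)
    have sub: "P \<subseteq> A" "N \<subseteq> A" "B \<subseteq> A" "S \<subseteq> A" "Z \<subseteq> A" by (auto simp: P_def N_def B_def S_def Z_def)
    have dj: "P \<inter> N = {}" "P \<inter> (B \<union> S \<union> Z) = {}" "N \<inter> (B \<union> S \<union> Z) = {}" "B \<inter> (S \<union> Z) = {}"
      by (auto simp: P_def N_def B_def S_def Z_def)
    show ?thesis
    proof (rule concl[of ?rem 1])
      have "mon (-1) (nl @ ?m)" by (rule mon_rot_append[OF r(2) sg(2) mm])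
      then have "mon 1 ([b0] @ nl @ ?m)" using b0 bp(1) by auto
      then show "mon 1 ?rem" by (rule mon_rot_append[OF r(1) sg(1)])
      have "isolated_zeros tl" using yt(5) by auto
      then have "isolated_zeros ?m"
        using bs(2) bp(1) by (intro successively_splice[OF yt(2)]) auto
      then have "isolated_zeros ((pl @ [b0] @ nl) @ ?m)"
        by (rule successively_append_nonzero[rotated]) (use sg(3,4) bp(1) b0 in force)
      then show "isolated_zeros ?rem" by simp
      show "fst (hd ?rem) \<noteq> 0"
        using ends[of pl] sg(3) bp(1) b0 by (cases "pl = []") auto
      show "fst (last ?rem) \<noteq> 0"
      proof (cases "?m = []")
        case True
        then show ?thesis using ends[of nl] sg(4) bp(1) b0 by (cases "nl = []") auto
      next
        case ne: False
        then have "last ((pl @ [b0] @ nl) @ ?m) = last ?m" by (rule last_appendR)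
        then have "last ?rem = last ?m" by (simp only: append_assoc)
        moreover have "last ?m \<in> B \<union> S"
        proof (cases "tl = []")
          case True
          then have "bs \<noteq> []" using ne yt(2) by auto
          then show ?thesis using last_splice[OF yt(2)] bs(2) True by auto
        next
          case False
          then have "last tl \<in> S" using tlS last_in_set[of tl] by blast
          then show ?thesis using False by simp
        qed
        ultimately show ?thesis using bp(1,2) by force
      qed
      have "distinct (ys @ bs)" using yt(1,3) bs dj(4) by auto
      moreover have "set bs \<inter> set tl = {}" using bs(2) tlS dj(4) by auto
      ultimately have "distinct ?m" using yt(1) distinct_splice[of ys bs] by (auto simp: set_splice)
      then show "distinct ?rem" using l sets b0 dj by auto
      show "set ?rem \<subseteq> A" using l sets b0 sub by auto
      show "a \<in> set ?rem" if "a \<in> A" "fst a \<noteq> 0" for a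
        using nonzero[OF that] l b0 bs(2) yt(4) by (auto simp: set_splice)
    qed auto
  qed
qed

text \<open>\<open>m\<close> is the least value above which at most half of \<open>R\<close> lies.
  Its predecessor among the values fails this condition, which gives the second inequality.\<close>

lemma median:
  fixes f :: "'a \<Rightarrow> int"
  assumes "finite R" "R \<noteq> {}"
  obtains m where "card {a\<in>R. m < f a} \<le> card {a\<in>R. f a \<le> m}"
    "card {a\<in>R. f a < m} \<le> card {a\<in>R. m \<le> f a}" "m \<in> f ` R"
proof -
  define G where "G = {v\<in>f ` R. card {a\<in>R. v < f a} \<le> card {a\<in>R. f a \<le> v}}"
  have "finite (f ` R)" "f ` R \<noteq> {}" using assms by auto
  have "{a\<in>R. Max (f ` R) < f a} = {}"
    using Max_ge[OF \<open>finite (f ` R)\<close>] by (auto simp: not_less)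
  then have "Max (f ` R) \<in> G"
    using Max_in[OF \<open>finite (f ` R)\<close> \<open>f ` R \<noteq> {}\<close>] unfolding G_def by (simp only: mem_Collect_eq) simp
  moreover have finG: "finite G" using assms by (auto simp: G_def)
  ultimately have mG: "Min G \<in> G" using Min_in[of G] by blast
  have "card {a\<in>R. f a < Min G} \<le> card {a\<in>R. Min G \<le> f a}"
  proof (cases "{a\<in>R. f a < Min G} = {}")
    case False
    define V where "V = {v\<in>f ` R. v < Min G}"
    have V: "finite V" "V \<noteq> {}" using assms False by (auto simp: V_def)
    then have MV: "Max V \<in> V" "\<And>v. v \<in> V \<Longrightarrow> v \<le> Max V" by auto
    have "\<forall>v\<in>V. v < Min G" by (simp add: V_def)
    then have "Max V < Min G" using MV(1) by blast
    then have "Max V \<notin> G" using Min_le[OF finG] leD by blast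
    then have "card {a\<in>R. f a \<le> Max V} \<le> card {a\<in>R. Max V < f a}"
    proof -
      have "Max V \<in> f ` R" using MV(1) unfolding V_def by blast
      then show ?thesis using \<open>Max V \<notin> G\<close> unfolding G_def mem_Collect_eq by linarith
    qed
    moreover have fV: "f a \<le> Max V \<longleftrightarrow> f a < Min G" if "a \<in> R" for a
    proof
      assume "f a < Min G"
      then have "f a \<in> V" using that by (simp add: V_def)
      then show "f a \<le> Max V" by (rule MV(2))
    qed (use \<open>Max V < Min G\<close> in linarith)
    then have "{a\<in>R. f a \<le> Max V} = {a\<in>R. f a < Min G}" "{a\<in>R. Max V < f a} = {a\<in>R. Min G \<le> f a}"
      by (auto simp flip: not_le)
    ultimately show ?thesis by simp
  next
    case True
    then show ?thesis by (simp only: card.empty)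
  qed
  then show ?thesis using that[of "Min G"] mG by (simp add: G_def)
qed

theorem integer_admissible:
  assumes ss: "strongly_sequenceable H" and A: "finite A" "snd ` A \<subseteq> carrier H" "(0, \<one>) \<notin> A"
  shows "\<exists>l. distinct l \<and> set l = A \<and> admissible 0 l"
proof (cases "\<exists>a\<in>A. e (snd a) = -1")
  case False
  then have "rot A" using A(2) e_cases by (auto simp: rot_def)
  then show ?thesis using rotations_admissible[OF ss A(1) _ A(3)] by blast
next
  case True
  define R where "R = {a\<in>A. e (snd a) = -1}"
  have R: "finite R" "R \<noteq> {}" using A(1) True unfolding R_def by (simp, blast)
  obtain m where m: "card {a\<in>R. m < fst a} \<le> card {a\<in>R. fst a \<le> m}"
    "card {a\<in>R. fst a < m} \<le> card {a\<in>R. m \<le> fst a}" "m \<in> fst ` R"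
    by (rule median[OF R, of fst])
  define pos where "pos k = {a\<in>R. 0 < k * (2 * fst a - 2 * m)}" for k
  define zero where "zero = {a\<in>R. fst a = m}"
  have pos1: "pos 1 = {a\<in>R. m < fst a}" "pos (-1) = {a\<in>R. fst a < m}" by (auto simp: pos_def)
  have u: "{a\<in>R. fst a \<le> m} = pos (-1) \<union> zero" "{a\<in>R. m \<le> fst a} = pos 1 \<union> zero"
    by (auto simp: pos1 zero_def)
  have le: "card (pos 1) \<le> card (pos (-1)) + card zero" "card (pos (-1)) \<le> card (pos 1) + card zero"
    using m(1,2) card_Un_le[of "pos 1" zero] card_Un_le[of "pos (-1)" zero] unfolding u pos1 by linarith+
  obtain k :: int where k: "k = 1 \<or> k = -1" "card (pos (- k)) \<le> card (pos k)"
    "card (pos k) \<le> card (pos (- k)) + card zero"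
  proof (cases "card (pos (-1)) \<le> card (pos 1)")
    case True then show ?thesis using that[of 1] le by simp
  next
    case False then show ?thesis using that[of "-1"] le by simp
  qed
  \<comment> \<open>conjugation by a translation, after doubling so that the median moves to \<open>0\<close>\<close>
  define f where "f a = (k * (2 * fst a - m + e (snd a) * m), snd a)" for a :: "int \<times> 'h"
  have inj: "inj f" using k(1) by (auto simp: inj_def f_def prod_eq_iff)
  have snd_f [simp]: "snd (f a) = snd a" for a by (simp add: f_def)
  have fst_f: "fst (f a) = k * (2 * fst a - 2 * m)" if "a \<in> R" for a
    using that by (simp add: f_def R_def)
  have img: "{a\<in>f ` A. e (snd a) = -1 \<and> Q (fst a)} = f ` {a\<in>R. Q (k * (2 * fst a - 2 * m))}" for Q
    using fst_f by (auto simp: R_def)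
  have cf: "card (f ` S) = card S" for S using card_image[OF inj_on_subset[OF inj subset_UNIV]] .
  have c: "card {a\<in>f ` A. e (snd a) = -1 \<and> 0 < fst a} = card (pos k)"
    "card {a\<in>f ` A. e (snd a) = -1 \<and> fst a < 0} = card (pos (- k))"
    "{a\<in>f ` A. e (snd a) = -1 \<and> fst a = 0} = f ` zero"
    using img[of "\<lambda>x. 0 < x"] img[of "\<lambda>x. x < 0"] img[of "\<lambda>x. x = 0"] k(1)
    by (auto simp: cf pos_def zero_def)
  have "zero \<noteq> {}" using m(3) by (auto simp: zero_def)
  have "\<exists>l. distinct l \<and> set l = f ` A \<and> admissible 0 l"
  proof (rule reflections_admissible[OF ss])
    show "finite (f ` A)" using A(1) by simp
    have "snd ` f ` A = snd ` A" by (simp add: image_image)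
    then show "snd ` f ` A \<subseteq> carrier H" using A(2) by simp
    show "(0, \<one>) \<notin> f ` A"
    proof
      assume "(0, \<one>) \<in> f ` A"
      then obtain a where a: "a \<in> A" "f a = (0, \<one>)" by force
      then have "a = (0, \<one>)" using k(1) by (cases a) (auto simp: f_def)
      then show False using a(1) A(3) by simp
    qed
    show "{a\<in>f ` A. e (snd a) = -1 \<and> 0 < fst a} \<union> {a\<in>f ` A. e (snd a) = -1 \<and> fst a = 0} \<noteq> {}"
      using \<open>zero \<noteq> {}\<close> unfolding c(3) by simp
  qed (use k c cf in simp_all)
  then obtain l' where l': "distinct l'" "set l' = f ` A" "admissible 0 l'" by blast
  show ?thesis
  proof (rule admissible_transfer[OF inj_on_subset[OF inj subset_UNIV] _ l'])
    fix l assume l: "distinct l" "set l \<subseteq> A" "triv 0 l"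
    have "snd ` set l \<subseteq> carrier H" using l(2) A(2) by auto
    \<comment> \<open>For a trivial word \<open>e (hp l) = 1\<close>, and the two terms in
      \<open>m\<close> cancel.\<close>
    then have "xc (map f l) = k * (2 * xc l - m + e (hp l) * m)"
    proof (induction l)
      case (Cons a l)
      then have IH: "xc (map f l) = k * (2 * xc l - m + e (hp l) * m)" by simp
      show ?case using Cons.prems
        by (simp add: IH) (simp add: f_def e_mult algebra_simps)
    qed simp
    moreover have "hp (map f l) = hp l" by (rule hp_cong) simp
    ultimately show "triv 0 (map f l)" using l(3) by (simp add: triv_def)
  qed
qed

end

section \<open>Independence modulo p and rectification\<close>

definition comb :: "(int \<times> 'h \<Rightarrow> int) \<Rightarrow> (int \<times> 'h) set \<Rightarrow> int"
  where "comb c S = (\<Sum>a\<in>S. c a * fst a)"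

definition dep :: "int \<Rightarrow> nat \<Rightarrow> nat \<Rightarrow> (int \<times> 'h) set \<Rightarrow> int \<Rightarrow> bool"
  where "dep p m M V y \<longleftrightarrow> (\<exists>c. (\<forall>a\<in>V. \<bar>c a\<bar> \<le> int M) \<and> p dvd int m * y - comb c V)"

text \<open>For \<open>m = 1\<close> and \<open>V = {}\<close> this is a dissociated set modulo
  \<open>p\<close>, whatever \<open>K\<close> is. In general \<open>V\<close> and \<open>K\<close>
  describe a bounded span that relations may use freely.\<close>

definition ind :: "int \<Rightarrow> nat \<Rightarrow> nat \<Rightarrow> (int \<times> 'h) set \<Rightarrow> (int \<times> 'h) set \<Rightarrow> bool"
  where "ind p m K V S \<longleftrightarrow> (\<forall>c d. (\<forall>a\<in>S. \<bar>c a\<bar> \<le> int m) \<longrightarrow> (\<forall>a\<in>V. \<bar>d a\<bar> \<le> int K) \<longrightarrow>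
    p dvd comb c S + comb d V \<longrightarrow> (\<forall>a\<in>S. c a = 0))"

lemma indD:
  assumes "ind p m K V S" "\<And>a. a \<in> S \<Longrightarrow> \<bar>c a\<bar> \<le> int m" "\<And>a. a \<in> V \<Longrightarrow> \<bar>d a\<bar> \<le> int K"
    "p dvd comb c S + comb d V" "a \<in> S"
  shows "c a = 0"
  using assms unfolding ind_def by blast

lemma comb_cong: "(\<And>a. a \<in> S \<Longrightarrow> c a = d a) \<Longrightarrow> comb c S = comb d S"
  by (simp add: comb_def)

lemma comb_empty [simp]: "comb c {} = 0"
  by (simp add: comb_def)

lemma comb_union: "finite S \<Longrightarrow> finite T \<Longrightarrow> S \<inter> T = {} \<Longrightarrow> comb c (S \<union> T) = comb c S + comb c T"
  by (simp add: comb_def sum.union_disjoint)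

lemma comb_insert: "finite S \<Longrightarrow> a \<notin> S \<Longrightarrow> comb c (insert a S) = c a * fst a + comb c S"
  by (simp add: comb_def)

lemma comb_mono_neutral:
  "finite S \<Longrightarrow> T \<subseteq> S \<Longrightarrow> (\<And>a. a \<in> S - T \<Longrightarrow> c a = 0) \<Longrightarrow> comb c S = comb c T"
  unfolding comb_def by (rule sum.mono_neutral_right) auto

lemma comb_diff: "comb (\<lambda>a. c a - d a) S = comb c S - comb d S"
  by (simp add: comb_def sum_subtractf algebra_simps)

lemma comb_scale: "comb (\<lambda>a. t * c a) S = t * comb c S"
  by (simp add: comb_def sum_distrib_left algebra_simps)

lemma dep_mono:
  assumes "dep p m M V y" "V \<subseteq> V'" "finite V'" "M \<le> M'"
  shows "dep p m M' V' y"
proof -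
  obtain c where c: "\<forall>a\<in>V. \<bar>c a\<bar> \<le> int M" "p dvd int m * y - comb c V"
    using assms(1) by (auto simp: dep_def)
  let ?c = "\<lambda>a. if a \<in> V then c a else 0"
  have "comb ?c V' = comb ?c V" using assms(2,3) by (intro comb_mono_neutral) auto
  also have "\<dots> = comb c V" by (rule comb_cong) simp
  finally show ?thesis using c assms(4) unfolding dep_def by (intro exI[of _ ?c]) auto
qed

lemma dep_member:
  assumes "finite V" "a \<in> V" "m \<le> M"
  shows "dep p m M V (fst a)"
proof -
  let ?c = "\<lambda>b. if b = a then int m else 0"
  have "comb ?c V = comb ?c {a}" using assms by (intro comb_mono_neutral) auto
  then show ?thesis using assms(3) unfolding dep_def by (intro exI[of _ ?c]) (auto simp: comb_def)
qed

lemma ind_subset: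
  assumes "ind p m K V S" "finite S" "T \<subseteq> S"
  shows "ind p m K V T"
  unfolding ind_def
proof (intro allI impI ballI)
  fix c d a assume h: "\<forall>a\<in>T. \<bar>c a\<bar> \<le> int m" "\<forall>a\<in>V. \<bar>d a\<bar> \<le> int K"
    "p dvd comb c T + comb d V" "a \<in> T"
  let ?c = "\<lambda>a. if a \<in> T then c a else 0"
  have "comb ?c S = comb ?c T" using assms(2,3) by (intro comb_mono_neutral) auto
  also have "\<dots> = comb c T" by (rule comb_cong) simp
  finally have "p dvd comb ?c S + comb d V" using h(3) by simp
  then have "?c a = 0" using h assms(3) by (intro indD[OF assms(1), of ?c d]) auto
  then show "c a = 0" using h(4) by simp
qed

lemma ind_weaken:
  assumes "ind p m K V S" "finite V" "V' \<subseteq> V" "m' \<le> m" "K' \<le> K"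
  shows "ind p m' K' V' S"
  unfolding ind_def
proof (intro allI impI)
  fix c d assume h: "\<forall>a\<in>S. \<bar>c a\<bar> \<le> int m'" "\<forall>a\<in>V'. \<bar>d a\<bar> \<le> int K'"
    "p dvd comb c S + comb d V'"
  let ?d = "\<lambda>a. if a \<in> V' then d a else 0"
  have "comb ?d V = comb ?d V'" using assms(2,3) by (intro comb_mono_neutral) auto
  also have "\<dots> = comb d V'" by (rule comb_cong) simp
  finally have "p dvd comb c S + comb ?d V" using h(3) by simp
  moreover have "\<bar>c a\<bar> \<le> int m" if "a \<in> S" for a using h(1) that assms(4) by force
  moreover have "\<bar>?d a\<bar> \<le> int K" for a using h(2) assms(5) by force
  ultimately show "\<forall>a\<in>S. c a = 0" using indD[OF assms(1), of c ?d] by blast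
qed

text \<open>The coefficient of \<open>a\<close> in a relation divides \<open>m\<close>; this is why \<^const>\<open>dep\<close> concerns the
  multiple \<open>m * y\<close>.\<close>

lemma ind_insert:
  assumes ind: "ind p m K V S" and fin: "finite V" "finite S" "V \<inter> S = {}" "a \<notin> S"
    and m: "m = 1 \<or> m = 2" and M: "m * K \<le> M" "m * m \<le> M"
    and nd: "\<not> dep p m M (V \<union> S) (fst a)"
  shows "ind p m K V (insert a S)"
  unfolding ind_def
proof (intro allI impI)
  fix c d assume h: "\<forall>b\<in>insert a S. \<bar>c b\<bar> \<le> int m" "\<forall>b\<in>V. \<bar>d b\<bar> \<le> int K"
    "p dvd comb c (insert a S) + comb d V"
  have rel: "p dvd c a * fst a + comb c S + comb d V" using h(3) fin by (simp add: comb_insert)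
  have "c a = 0"
  proof (rule ccontr)
    assume nz: "c a \<noteq> 0"
    obtain t where t: "t * c a = int m" "\<bar>t\<bar> \<le> int m"
    proof -
      have "\<bar>c a\<bar> \<le> int m" using h(1) by simp
      then have "c a = 1 \<or> c a = -1 \<or> m = 2 \<and> (c a = 2 \<or> c a = -2)" using m nz by auto
      then consider "c a = 1" | "c a = -1" | "m = 2" "c a = 2" | "m = 2" "c a = -2" by blast
      then show ?thesis
      proof cases
        case 1 then show ?thesis using that[of "int m"] by simp
      next
        case 2 then show ?thesis using that[of "- int m"] by simp
      next
        case 3 then show ?thesis using that[of 1] by simp
      next
        case 4 then show ?thesis using that[of "-1"] by simp
      qed
    qed
    let ?c = "\<lambda>b. - t * (if b \<in> V then d b else c b)"
    have "comb ?c (V \<union> S) = comb ?c V + comb ?c S" using fin by (intro comb_union) auto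
    moreover have "comb ?c V = comb (\<lambda>b. - t * d b) V" by (intro comb_cong) auto
    then have "comb ?c V = - t * comb d V" by (simp only: comb_scale)
    moreover have "comb ?c S = comb (\<lambda>b. - t * c b) S" using fin(3) by (intro comb_cong) auto
    then have "comb ?c S = - t * comb c S" by (simp only: comb_scale)
    ultimately have 1: "comb ?c (V \<union> S) = - t * comb d V + - t * comb c S" by (simp only:)
    have 2: "int m * fst a = t * (c a * fst a)" unfolding t(1)[symmetric] by (rule mult.assoc)
    have "int m * fst a - comb ?c (V \<union> S) = t * (c a * fst a + comb c S + comb d V)"
      unfolding 1 2 by (simp add: algebra_simps)
    then have "p dvd int m * fst a - comb ?c (V \<union> S)" using rel by (simp only: dvd_mult)
    moreover have "\<bar>?c b\<bar> \<le> int M" if "b \<in> V \<union> S" for b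
    proof -
      have "\<bar>if b \<in> V then d b else c b\<bar> \<le> int (max K m)"
        using h(1,2) that by (cases "b \<in> V") force+
      then have "\<bar>t\<bar> * \<bar>if b \<in> V then d b else c b\<bar> \<le> int m * int (max K m)"
        using t(2) by (intro mult_mono) auto
      also have "\<dots> = int (m * max K m)" by simp
      also have "m * max K m \<le> M" using M by (auto simp: max_def)
      then have "int (m * max K m) \<le> int M" by (simp only: of_nat_le_iff)
      finally show ?thesis by (simp add: abs_mult)
    qed
    ultimately have "dep p m M (V \<union> S) (fst a)"
      unfolding dep_def by (intro exI[of _ ?c] conjI ballI)
    then show False using nd by blast
  qed
  moreover have "\<forall>b\<in>S. c b = 0"
  proof -
    have "p dvd comb c S + comb d V" using rel \<open>c a = 0\<close> by simp
    then show ?thesis using indD[OF ind, of c d] h by blast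
  qed
  ultimately show "\<forall>b\<in>insert a S. c b = 0" by simp
qed

text \<open>If \<open>S\<close> is independent then its subset sums are distinct, while dependence on \<open>V\<close> leaves only
  few values for the coefficient vectors of these sums.\<close>

lemma ind_dep_card_bound:
  assumes fin: "finite S" "finite V" and ind: "ind p m 0 {} S" and m: "0 < m"
    and dep: "\<And>a. a \<in> S \<Longrightarrow> dep p m M V (fst a)"
  shows "2 ^ card S \<le> (2 * M * card S + 1) ^ card V"
proof -
  have "\<forall>a\<in>S. \<exists>c. (\<forall>b\<in>V. \<bar>c b\<bar> \<le> int M) \<and> p dvd int m * fst a - comb c V"
    using dep by (auto simp: dep_def)
  then obtain cc where cc: "\<And>a b. a \<in> S \<Longrightarrow> b \<in> V \<Longrightarrow> \<bar>cc a b\<bar> \<le> int M"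
    "\<And>a. a \<in> S \<Longrightarrow> p dvd int m * fst a - comb (cc a) V"
    by metis
  \<comment> \<open>\<open>F T\<close> is the coefficient vector over \<open>V\<close> of
    \<open>m\<close> times the subset sum of \<open>T\<close>. Its entries are at most
    \<open>M * card S\<close> in absolute value, whence the base
    \<open>2 * M * card S + 1\<close>.\<close>
  define F where "F T = restrict (\<lambda>b. \<Sum>a\<in>T. cc a b) V" for T
  let ?r = "int (M * card S)"
  have "F T \<in> V \<rightarrow>\<^sub>E {- ?r..?r}" if "T \<subseteq> S" for T
  proof -
    have "\<bar>\<Sum>a\<in>T. cc a b\<bar> \<le> ?r" if "b \<in> V" for b
    proof -
      have "\<bar>\<Sum>a\<in>T. cc a b\<bar> \<le> (\<Sum>a\<in>T. \<bar>cc a b\<bar>)" by (rule sum_abs)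
      also have "\<dots> \<le> of_nat (card T) * int M"
      proof (rule sum_bounded_above)
        fix a assume "a \<in> T"
        then show "\<bar>cc a b\<bar> \<le> int M" using cc(1)[of a b] that \<open>T \<subseteq> S\<close> by blast
      qed
      also have "\<dots> \<le> of_nat (card S) * int M"
        using card_mono[OF fin(1) \<open>T \<subseteq> S\<close>] by (intro mult_right_mono) auto
      finally show ?thesis by (simp add: mult.commute)
    qed
    then show ?thesis by (auto simp: F_def abs_le_iff minus_le_iff)
  qed
  moreover have "inj_on F (Pow S)"
  proof (rule inj_onI)
    fix T T' assume T: "T \<in> Pow S" "T' \<in> Pow S" "F T = F T'"
    have fT: "finite T" "finite T'" using T fin finite_subset by auto
    have eq: "(\<Sum>a\<in>T. cc a b) = (\<Sum>a\<in>T'. cc a b)" if "b \<in> V" for b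
      using fun_cong[OF T(3), of b] that by (simp add: F_def)
    have swap: "(\<Sum>a\<in>T. comb (cc a) V) = comb (\<lambda>b. \<Sum>a\<in>T. cc a b) V" for T
      unfolding comb_def by (subst sum.swap) (simp add: sum_distrib_right)
    have "(\<Sum>a\<in>T. comb (cc a) V) = (\<Sum>a\<in>T'. comb (cc a) V)"
      unfolding swap by (rule comb_cong) (rule eq)
    moreover have "p dvd (\<Sum>a\<in>T. int m * fst a - comb (cc a) V)"
      "p dvd (\<Sum>a\<in>T'. int m * fst a - comb (cc a) V)"
      using cc(2) T by (auto intro!: dvd_sum)
    then have "p dvd (\<Sum>a\<in>T. int m * fst a - comb (cc a) V) - (\<Sum>a\<in>T'. int m * fst a - comb (cc a) V)"
      by (rule dvd_diff)
    ultimately have d: "p dvd (\<Sum>a\<in>T. int m * fst a) - (\<Sum>a\<in>T'. int m * fst a)"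
      by (simp add: sum_subtractf)
    let ?i = "\<lambda>T a. if a \<in> T then int m else 0"
    have i: "comb (?i U) S = (\<Sum>a\<in>U. int m * fst a)" if "U \<subseteq> S" for U
    proof -
      have "comb (?i U) S = comb (?i U) U" using that fin by (intro comb_mono_neutral) auto
      then show ?thesis by (simp add: comb_def)
    qed
    let ?c = "\<lambda>a. ?i T a - ?i T' a"
    have "p dvd comb ?c S + comb (\<lambda>_. 0) {}"
      using d T by (simp add: comb_diff i)
    then have "?c a = 0" if "a \<in> S" for a
      using that by (intro indD[OF ind, of ?c "\<lambda>_. 0"]) auto
    then have "a \<in> T \<longleftrightarrow> a \<in> T'" if "a \<in> S" for a
      using that m by (fastforce split: if_splits)
    then show "T = T'" using T(1,2) by blast
  qed
  ultimately have "card (Pow S) \<le> card (V \<rightarrow>\<^sub>E {- ?r..?r})"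
    by (intro card_inj_on_le[of F]) (auto intro!: finite_PiE fin)
  also have "\<dots> = card {- ?r..?r} ^ card V" using fin(2) by (simp add: card_PiE)
  also have "card {- ?r..?r} = nat (int (2 * M * card S + 1))"
    unfolding card_atLeastAtMost_int by (rule arg_cong[of _ _ nat]) simp
  also have "\<dots> = 2 * M * card S + 1" by (rule nat_int)
  finally show ?thesis using fin(1) by (simp add: card_Pow)
qed

text \<open>Greedy choice: by \<open>ind_dep_card_bound\<close>, \<open>k\<close> independent
  elements cannot all depend on the at most \<open>v\<close> elements present so far, so
  \<open>D\<close> contains one that can be added.\<close>

lemma ind_extend:
  assumes ind: "ind p m K V Z" and fin: "finite V" "finite Z" "finite D" "V \<inter> Z = {}"
    and D: "ind p m 0 {} D" "k \<le> card D"
    and m: "m = 1 \<or> m = 2" and M: "m * K \<le> M" "m * m \<le> M"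
    and k: "(2 * M * k + 1) ^ v < 2 ^ k" and v: "card V + card Z + j \<le> v"
  shows "\<exists>C. C \<subseteq> D \<and> card C = j \<and> C \<inter> (V \<union> Z) = {} \<and> ind p m K V (Z \<union> C)"
  using v
proof (induction j)
  case 0
  then show ?case using ind by (intro exI[of _ "{}"]) auto
next
  case (Suc j)
  then obtain C where C: "C \<subseteq> D" "card C = j" "C \<inter> (V \<union> Z) = {}" "ind p m K V (Z \<union> C)" by auto
  have fC: "finite C" using C(1) fin(3) finite_subset by blast
  have mM: "m \<le> M" using m M(2) by auto
  have "\<exists>a\<in>D. \<not> dep p m M (V \<union> (Z \<union> C)) (fst a)"
  proof (rule ccontr)
    assume all: "\<not> ?thesis"
    obtain S where S: "S \<subseteq> D" "card S = k" "finite S"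
      using obtain_subset_with_card_n[OF D(2)] by metis
    have "2 ^ card S \<le> (2 * M * card S + 1) ^ card (V \<union> (Z \<union> C))"
      using all S fin fC m by (intro ind_dep_card_bound[OF _ _ ind_subset[OF D(1)]]) auto
    also have "\<dots> \<le> (2 * M * card S + 1) ^ v"
    proof (rule power_increasing)
      have "card (V \<union> (Z \<union> C)) \<le> card V + (card Z + card C)"
        by (meson card_Un_le add_left_mono order_trans)
      then show "card (V \<union> (Z \<union> C)) \<le> v" using Suc.prems C(2) by simp
    qed simp
    finally show False using k S(2) by simp
  qed
  then obtain a where a: "a \<in> D" "\<not> dep p m M (V \<union> (Z \<union> C)) (fst a)" by blast
  have an: "a \<notin> V \<union> (Z \<union> C)" using a(2) dep_member[of "V \<union> (Z \<union> C)" a m M p] fin fC mM by auto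
  have "ind p m K V (insert a (Z \<union> C))"
    by (rule ind_insert[OF C(4) _ _ _ _ m M a(2)]) (use fin fC an C(3) in auto)
  then show ?case
    using a(1) an C fC by (intro exI[of _ "insert a C"]) auto
qed

text \<open>An element that cannot be added to a maximal independent set depends on it;
  \<open>m * m\<close> is the coefficient bound that \<open>ind_insert\<close> yields for
  \<open>K = 0\<close>.\<close>

lemma maximal_ind:
  assumes "finite T" and m: "m = 1 \<or> m = 2"
  obtains B where "B \<subseteq> T" "ind p m 0 {} B" "\<And>a. a \<in> T \<Longrightarrow> dep p m (m * m) B (fst a)"
proof -
  let ?P = "\<lambda>B. B \<subseteq> T \<and> ind p m 0 {} B"
  have "?P {}" by (simp add: ind_def)
  moreover have "\<forall>B. ?P B \<longrightarrow> card B < Suc (card T)" using card_mono[OF assms(1)] by (simp add: less_Suc_eq_le)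
  ultimately have "\<exists>B. ?P B \<and> (\<forall>B'. ?P B' \<longrightarrow> card B' \<le> card B)"
    by (intro ex_has_greatest_nat[where P = ?P and f = card and b = "Suc (card T)" and k = "{}"])
  then obtain B where "?P B \<and> (\<forall>B'. ?P B' \<longrightarrow> card B' \<le> card B)" ..
  then have B: "?P B" "\<forall>B'. ?P B' \<longrightarrow> card B' \<le> card B" by (rule conjunct1, rule conjunct2)
  have fB: "finite B" using B(1) assms(1) finite_subset by blast
  have "dep p m (m * m) B (fst a)" if a: "a \<in> T" for a
  proof (rule ccontr)
    assume nd: "\<not> ?thesis"
    have "a \<notin> B" using nd dep_member[of B a m "m * m" p] fB m by auto
    moreover have "ind p m 0 {} (insert a B)"
      by (rule ind_insert[of p m 0 "{}" B a "m * m"]) (use B(1) fB \<open>a \<notin> B\<close> m nd in auto)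
    ultimately have "card (insert a B) \<le> card B" using B(1) a by (intro mp[OF spec[OF B(2)]]) simp
    then show False using \<open>a \<notin> B\<close> fB by simp
  qed
  then show ?thesis using that[of B] B(1) by blast
qed

text \<open>Dissociated blocks of size \<open>k\<close> are split off while some fibre contains one.
  After that a maximal dissociated subset of a fibre has at most \<open>k\<close> elements, and
  \<open>B\<close> is the union of these subsets.\<close>

lemma extract_ind_blocks:
  assumes "finite T" "finite F" "snd ` T \<subseteq> F" "0 < k"
  shows "\<exists>Ds R B. sorted_wrt (\<lambda>A B. A \<inter> B = {}) Ds \<and>
    (\<forall>D\<in>set Ds. D \<subseteq> T \<and> card D = k \<and> ind p 1 0 {} D \<and> (\<exists>h. \<forall>a\<in>D. snd a = h)) \<and>
    R \<subseteq> T \<and> T = \<Union>(set Ds) \<union> R \<and> \<Union>(set Ds) \<inter> R = {} \<and>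
    B \<subseteq> R \<and> card B \<le> card F * k \<and> (\<forall>a\<in>R. dep p 1 1 B (fst a))"
  using assms(1,3)
proof (induction "card T" arbitrary: T rule: less_induct)
  case less
  show ?case
  proof (cases "0 < k \<and> (\<exists>D. D \<subseteq> T \<and> card D = k \<and> ind p 1 0 {} D \<and> (\<exists>h. \<forall>a\<in>D. snd a = h))")
    case True
    then obtain D where D: "D \<subseteq> T" "card D = k" "ind p 1 0 {} D" "\<exists>h. \<forall>a\<in>D. snd a = h" by blast
    have ne: "D \<noteq> {}" using D(2) True by auto
    then have "card (T - D) < card T" using D(1) less.prems(1) by (intro psubset_card_mono) auto
    moreover have "finite (T - D)" "snd ` (T - D) \<subseteq> F" using less.prems by auto
    ultimately obtain Ds R B where IH: "sorted_wrt (\<lambda>A B. A \<inter> B = {}) Ds"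
      "\<forall>D'\<in>set Ds. D' \<subseteq> T - D \<and> card D' = k \<and> ind p 1 0 {} D' \<and> (\<exists>h. \<forall>a\<in>D'. snd a = h)"
      "R \<subseteq> T - D" "T - D = \<Union>(set Ds) \<union> R" "\<Union>(set Ds) \<inter> R = {}"
      "B \<subseteq> R" "card B \<le> card F * k" "\<forall>a\<in>R. dep p 1 1 B (fst a)"
      using less.hyps[of "T - D"] by (elim meta_impE exE conjE) (assumption | rule that)+
    have "sorted_wrt (\<lambda>A B. A \<inter> B = {}) (D # Ds)" using IH(1,2) by auto
    moreover have "\<forall>D'\<in>set (D # Ds). D' \<subseteq> T \<and> card D' = k \<and> ind p 1 0 {} D' \<and> (\<exists>h. \<forall>a\<in>D'. snd a = h)"
      using IH(2) D by auto
    moreover have "T = \<Union>(set (D # Ds)) \<union> R" "R \<subseteq> T" "\<Union>(set (D # Ds)) \<inter> R = {}"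
      using IH(3-5) D(1) by auto
    ultimately show ?thesis using IH(6-8) by blast
  next
    case False
    define Th where "Th h = {a\<in>T. snd a = h}" for h
    have "\<exists>B. B \<subseteq> Th h \<and> ind p 1 0 {} B \<and> (\<forall>a\<in>Th h. dep p 1 1 B (fst a))" for h
    proof -
      have "finite (Th h)" using less.prems(1) by (simp add: Th_def)
      then show ?thesis using maximal_ind[of "Th h" 1 p] by (metis mult_1)
    qed
    then obtain Bh where Bh: "\<And>h. Bh h \<subseteq> Th h" "\<And>h. ind p 1 0 {} (Bh h)"
      "\<And>h a. a \<in> Th h \<Longrightarrow> dep p 1 1 (Bh h) (fst a)" by metis
    have fBh: "finite (Bh h)" for h
      using Bh(1)[of h] less.prems(1) by (auto simp: Th_def intro: finite_subset)
    have cB: "card (Bh h) \<le> k" for h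
    proof (rule ccontr)
      assume "\<not> ?thesis"
      then have "k \<le> card (Bh h)" by simp
      then obtain D where D: "D \<subseteq> Bh h" "card D = k"
        using obtain_subset_with_card_n[of k "Bh h"] by metis
      have "D \<subseteq> T" "\<forall>a\<in>D. snd a = h" using D(1) Bh(1)[of h] by (auto simp: Th_def)
      moreover have "ind p 1 0 {} D" using ind_subset[OF Bh(2) fBh D(1)] .
      ultimately show False using False D(2) assms(4) by blast
    qed
    define B where "B = \<Union>(Bh ` F)"
    have fB: "finite B" using assms(2) fBh by (auto simp: B_def)
    have BT: "B \<subseteq> T" using Bh(1) by (auto simp: B_def Th_def)
    have "card B \<le> (\<Sum>h\<in>F. card (Bh h))" unfolding B_def by (rule card_UN_le[OF assms(2)])
    also have "\<dots> \<le> card F * k" using sum_bounded_above[of F "\<lambda>h. card (Bh h)" k] cB by simp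
    finally have "card B \<le> card F * k" .
    moreover have "dep p 1 1 B (fst a)" if "a \<in> T" for a
    proof -
      have "snd a \<in> F" using that less.prems(2) by auto
      then have "Bh (snd a) \<subseteq> B" by (auto simp: B_def)
      then show ?thesis using dep_mono[OF Bh(3) _ fB order_refl, of a "snd a"] that by (simp add: Th_def)
    qed
    ultimately show ?thesis using BT by (intro exI[of _ "[]"] exI[of _ T] exI[of _ B]) auto
  qed
qed

section \<open>Dilation into a short interval\<close>

text \<open>Pigeonhole: there are \<open>p\<close> multipliers but only \<open>T ^ card V\<close>
  boxes of side \<open>p / T\<close> for their vectors of residues. The multiplier \<open>t\<close>
  is the difference of two in one box, and \<open>z b\<close> the difference of their
  residues.\<close>

lemma dirichlet_mod:
  fixes p :: int and V :: "(int \<times> 'h) set"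
  assumes V: "finite V" and T: "0 < T" "int T ^ card V < p"
  obtains t z where "0 < t" "t < p" "\<And>b. b \<in> V \<Longrightarrow> p dvd t * fst b - z b"
    "\<And>b. b \<in> V \<Longrightarrow> int T * \<bar>z b\<bar> < p"
proof -
  have p: "0 < p" using T(2) by (meson of_nat_0_le_iff order_le_less_trans zero_le_power)
  define r where "r t b = (t * fst b) mod p" for t and b :: "int \<times> 'h"
  have r: "0 \<le> r t b" "r t b < p" for t b using p by (auto simp: r_def)
  define q where "q t b = int T * r t b div p" for t b
  have qe: "int T * r t b = q t b * p + (int T * r t b) mod p" for t b
    by (simp add: q_def)
  have md: "0 \<le> (int T * r t b) mod p" "(int T * r t b) mod p < p" for t b using p by auto
  have q: "0 \<le> q t b" "q t b < int T" for t b
  proof -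
    show "0 \<le> q t b" using r p by (simp add: q_def pos_imp_zdiv_nonneg_iff)
    have "q t b * p \<le> int T * r t b" using qe[of t b] md[of t b] by linarith
    also have "\<dots> < int T * p" using r T(1) by (intro mult_strict_left_mono) auto
    finally show "q t b < int T" using p by simp
  qed
  define G where "G t = restrict (q t) V" for t
  have "\<not> inj_on G {0..<p}"
  proof
    assume "inj_on G {0..<p}"
    then have "card {0..<p} \<le> card (V \<rightarrow>\<^sub>E {0..<int T})"
      using q by (intro card_inj_on_le[of G]) (auto simp: G_def intro!: finite_PiE V)
    also have "\<dots> = T ^ card V" using V by (simp add: card_PiE)
    finally have "p \<le> int (T ^ card V)" by (simp only: card_atLeastLessThan_int diff_zero nat_le_iff)
    then show False using T(2) by simp
  qed
  then obtain t1 t2 where t: "0 \<le> t1" "t1 < t2" "t2 < p" "G t1 = G t2"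
    unfolding inj_on_def by (metis atLeastLessThan_iff linorder_neqE)
  show ?thesis
  proof (rule that[of "t2 - t1" "\<lambda>b. r t2 b - r t1 b"])
    fix b assume b: "b \<in> V"
    have rd: "p dvd t * fst b - r t b" for t by (simp add: r_def minus_mod_eq_mult_div)
    have "p dvd (t2 * fst b - r t2 b) - (t1 * fst b - r t1 b)" by (rule dvd_diff[OF rd rd])
    then show "p dvd (t2 - t1) * fst b - (r t2 b - r t1 b)" by (simp add: algebra_simps)
    have qq: "q t1 b = q t2 b" using fun_cong[OF t(4), of b] b by (simp add: G_def)
    have "\<bar>int T * r t2 b - int T * r t1 b\<bar> < p"
      using qe[of t1 b, unfolded qq] qe[of t2 b] md[of t1 b] md[of t2 b] by linarith
    then show "int T * \<bar>r t2 b - r t1 b\<bar> < p" by (simp add: abs_mult flip: right_diff_distrib)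
  qed (use t in auto)
qed

context signed_group
begin

text \<open>Multiplication by \<open>s = t * m\<close>, invertible modulo \<open>p\<close>, turns
  coordinates into residues of integers \<open>w a\<close> of absolute value at most
  \<open>M * card V * p / T\<close>. Signed sums of at most \<open>card A\<close> of these stay
  below \<open>p\<close> in absolute value, so they vanish modulo \<open>p\<close> only if they are
  \<open>0\<close>.\<close>

theorem dep_admissible:
  assumes ss: "strongly_sequenceable H" and A: "finite A" "snd ` A \<subseteq> carrier H" "(0, \<one>) \<notin> A"
    and p: "normalization_semidom_class.prime p" "0 < m" "int m < p" and range: "fst ` A \<subseteq> {0..<p}"
    and V: "finite V" "\<And>a. a \<in> A \<Longrightarrow> dep p m M V (fst a)"
    and T: "card A * M * card V < T" "int T ^ card V < p"
  shows "\<exists>l. distinct l \<and> set l = A \<and> admissible p l"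
proof -
  have T0: "0 < T" using T(1) by simp
  have p0: "0 < p" using p(2,3) by simp
  obtain t z where t: "0 < t" "t < p" "\<And>b. b \<in> V \<Longrightarrow> p dvd t * fst b - z b"
    "\<And>b. b \<in> V \<Longrightarrow> int T * \<bar>z b\<bar> < p"
    by (rule dirichlet_mod[OF V(1) T0 T(2)]) auto
  have "\<forall>a\<in>A. \<exists>c. (\<forall>b\<in>V. \<bar>c b\<bar> \<le> int M) \<and> p dvd int m * fst a - comb c V"
    using V(2) by (auto simp: dep_def)
  then obtain cc where cc: "\<And>a b. a \<in> A \<Longrightarrow> b \<in> V \<Longrightarrow> \<bar>cc a b\<bar> \<le> int M"
    "\<And>a. a \<in> A \<Longrightarrow> p dvd int m * fst a - comb (cc a) V"
    by metis
  define w where "w a = (\<Sum>b\<in>V. cc a b * z b)" for a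
  define s where "s = t * int m"
  have "\<not> p dvd t" "\<not> p dvd int m" using t(1,2) p(2,3) by (auto dest!: zdvd_imp_le)
  then have nds: "\<not> p dvd s" using p(1) by (simp add: s_def prime_dvd_mult_iff)
  have sw: "p dvd s * fst a - w a" if a: "a \<in> A" for a
  proof -
    have "p dvd t * (int m * fst a - comb (cc a) V)" using cc(2)[OF a] by simp
    moreover have "p dvd (\<Sum>b\<in>V. cc a b * (t * fst b - z b))" using t(3) by (intro dvd_sum) auto
    ultimately have "p dvd t * (int m * fst a - comb (cc a) V) + (\<Sum>b\<in>V. cc a b * (t * fst b - z b))"
      by (rule dvd_add)
    also have "(\<Sum>b\<in>V. cc a b * (t * fst b - z b)) = t * comb (cc a) V - w a"
      by (simp add: w_def comb_def sum_subtractf sum_distrib_left algebra_simps)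
    finally show ?thesis by (simp add: s_def algebra_simps)
  qed
  have wb: "int T * \<bar>w a\<bar> \<le> int (M * card V) * p" if a: "a \<in> A" for a
  proof -
    have "int T * \<bar>w a\<bar> \<le> int T * (\<Sum>b\<in>V. \<bar>cc a b * z b\<bar>)"
      unfolding w_def by (intro mult_left_mono sum_abs) auto
    also have "\<dots> = (\<Sum>b\<in>V. \<bar>cc a b\<bar> * (int T * \<bar>z b\<bar>))"
      by (simp add: sum_distrib_left abs_mult algebra_simps)
    also have "\<dots> \<le> (\<Sum>b\<in>V. int M * p)"
    proof (rule sum_mono)
      fix b assume b: "b \<in> V"
      show "\<bar>cc a b\<bar> * (int T * \<bar>z b\<bar>) \<le> int M * p"
        using cc(1)[OF a b] t(4)[OF b] by (intro mult_mono) auto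
    qed
    finally show ?thesis by (simp add: algebra_simps)
  qed
  define f where "f a = (w a, snd a)" for a
  have pd: "x = y" if "p dvd s * x - s * y" "x \<in> {0..<p}" "y \<in> {0..<p}" for x y
  proof -
    have "p dvd s * (x - y)" using that(1) by (simp add: algebra_simps)
    then have "p dvd x - y" using nds p(1) by (simp add: prime_dvd_mult_iff)
    then show ?thesis using that(2,3) dvd_imp_le_int[of "x - y" p] by (cases "x = y") auto
  qed
  have inj: "inj_on f A"
  proof (rule inj_onI)
    fix a b assume ab: "a \<in> A" "b \<in> A" "f a = f b"
    have "p dvd (s * fst a - w a) - (s * fst b - w b)" by (rule dvd_diff[OF sw[OF ab(1)] sw[OF ab(2)]])
    then have "p dvd s * fst a - s * fst b" using ab(3) by (simp add: f_def)
    then have "fst a = fst b" using range ab(1,2) by (intro pd) auto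
    then show "a = b" using ab(3) by (simp add: f_def prod_eq_iff)
  qed
  have "\<exists>l. distinct l \<and> set l = f ` A \<and> admissible 0 l"
  proof (rule integer_admissible[OF ss])
    show "finite (f ` A)" using A(1) by simp
    show "snd ` f ` A \<subseteq> carrier H" using A(2) by (auto simp: f_def)
    show "(0, \<one>) \<notin> f ` A"
    proof
      assume "(0, \<one>) \<in> f ` A"
      then obtain a where a: "a \<in> A" "w a = 0" "snd a = \<one>" by (auto simp: f_def)
      then have "p dvd s * fst a - s * 0" using sw[OF a(1)] by simp
      then have "fst a = 0" using range a(1) p0 by (intro pd) auto
      then show False using a(1,3) A(3) by (cases a) auto
    qed
  qed
  then obtain l' where l': "distinct l'" "set l' = f ` A" "admissible 0 l'" by blast
  show ?thesis
  proof (rule admissible_transfer[OF inj _ l'])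
    fix l assume l: "distinct l" "set l \<subseteq> A" "triv p l"
    have "p dvd s * xc l - xc (map f l) \<and> int T * \<bar>xc (map f l)\<bar> \<le> int (length l * (M * card V)) * p"
      using l(2)
    proof (induction l)
      case (Cons a l)
      then have IH: "p dvd s * xc l - xc (map f l)"
        "int T * \<bar>xc (map f l)\<bar> \<le> int (length l * (M * card V)) * p" and a: "a \<in> A" by auto
      have ea: "e (snd a) = 1 \<or> e (snd a) = -1" using a A(2) e_cases by auto
      have "p dvd (s * fst a - w a) + e (snd a) * (s * xc l - xc (map f l))"
        using sw[OF a] IH(1) by (intro dvd_add dvd_mult)
      then have 1: "p dvd s * xc (a # l) - xc (map f (a # l))" by (simp add: f_def algebra_simps)
      have "\<bar>xc (map f (a # l))\<bar> \<le> \<bar>w a\<bar> + \<bar>e (snd a) * xc (map f l)\<bar>"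
        by (simp add: f_def abs_triangle_ineq)
      also have "\<bar>e (snd a) * xc (map f l)\<bar> = \<bar>xc (map f l)\<bar>" using ea by auto
      finally have "int T * \<bar>xc (map f (a # l))\<bar> \<le> int T * (\<bar>w a\<bar> + \<bar>xc (map f l)\<bar>)"
        by (intro mult_left_mono) auto
      also have "\<dots> \<le> int (M * card V) * p + int (length l * (M * card V)) * p"
        using wb[OF a] IH(2) by (simp add: distrib_left)
      finally show ?case using 1 by (simp add: algebra_simps)
    qed auto
    then have pX: "p dvd s * xc l - xc (map f l)"
      and bX: "int T * \<bar>xc (map f l)\<bar> \<le> int (length l * (M * card V)) * p" by auto
    have "length l \<le> card A" using l(1,2) A(1) by (metis card_mono distinct_card)
    then have "length l * (M * card V) \<le> card A * (M * card V)" by (rule mult_right_mono) simp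
    then have "length l * (M * card V) < T" using T(1) unfolding mult.assoc by (rule le_less_trans)
    then have "int (length l * (M * card V)) * p < int T * p"
      using p0 by (intro mult_strict_right_mono) linarith+
    then have "\<bar>xc (map f l)\<bar> < p" using bX T0
      by (meson mult_less_cancel_left_pos of_nat_0_less_iff order_le_less_trans)
    moreover have "p dvd xc (map f l)"
    proof -
      have "p dvd s * xc l" using l(3) by (simp add: triv_def)
      then have "p dvd s * xc l - (s * xc l - xc (map f l))" using pX by (rule dvd_diff)
      then show ?thesis by simp
    qed
    ultimately have "xc (map f l) = 0" using dvd_imp_le_int[of "xc (map f l)" p] p0 by auto
    moreover have "hp (map f l) = hp l" by (rule hp_cong) (simp add: f_def)
    ultimately show "triv 0 (map f l)" using l(3) by (simp add: triv_def)
  qed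
qed

end

section \<open>Chains of pairs\<close>

text \<open>\<open>distinct (flat ps)\<close> says in one condition that all entries of all pairs
  are different.\<close>

definition flat :: "('a \<times> 'a) list \<Rightarrow> 'a list"
  where "flat ps = map fst ps @ map snd ps"

definition els :: "('a \<times> 'a) list \<Rightarrow> 'a set"
  where "els ps = fst ` set ps \<union> snd ` set ps"

lemma set_flat [simp]: "set (flat ps) = els ps"
  by (simp add: flat_def els_def)

lemma length_flat [simp]: "length (flat ps) = 2 * length ps"
  by (simp add: flat_def)

lemma finite_els [simp]: "finite (els ps)"
  by (simp add: els_def)

lemma els_simps [simp]: "els [] = {}" "els (a # ps) = {fst a, snd a} \<union> els ps" "els (ps @ ps') = els ps \<union> els ps'"
  by (auto simp: els_def)

lemma els_mono: "set ps \<subseteq> set ps' \<Longrightarrow> els ps \<subseteq> els ps'"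
  by (auto simp: els_def)

lemma distinct_flat_append:
  "distinct (flat (ps @ ps')) \<longleftrightarrow> distinct (flat ps) \<and> distinct (flat ps') \<and> els ps \<inter> els ps' = {}"
  by (auto simp: flat_def els_def)

lemma card_els: "distinct (flat ps) \<Longrightarrow> card (els ps) = 2 * length ps"
  using distinct_card[of "flat ps"] by simp

lemma card_els_le: "card (els ps) \<le> 2 * length ps"
  using card_length[of "flat ps"] by simp

definition same_fibre :: "(('b \<times> 'h) \<times> ('b \<times> 'h)) list \<Rightarrow> bool"
  where "same_fibre ps \<longleftrightarrow> (\<forall>(a, b)\<in>set ps. snd a = snd b)"

lemma pairing:
  assumes "finite S" "card S = 2 * n" "\<forall>a\<in>S. snd a = h"
  shows "\<exists>ps. length ps = n \<and> distinct (flat ps) \<and> els ps = S \<and> same_fibre ps"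
proof -
  obtain xs where xs: "distinct xs" "set xs = S" using finite_distinct_list assms(1) by blast
  then have len: "length xs = 2 * n" using distinct_card assms(2) by fastforce
  let ?ps = "zip (take n xs) (drop n xs)"
  have flat: "flat ?ps = xs" using len by (simp add: flat_def)
  then have "els ?ps = S" using set_flat[of ?ps] xs(2) by simp
  moreover have "same_fibre ?ps"
  proof -
    have "snd a = snd b" if "(a, b) \<in> set ?ps" for a b
    proof -
      have "a \<in> els ?ps" "b \<in> els ?ps" using that by (force simp: els_def)+
      then show ?thesis using \<open>els ?ps = S\<close> assms(3) by simp
    qed
    then show ?thesis by (auto simp: same_fibre_def)
  qed
  ultimately show ?thesis using flat xs(1) len by (intro exI[of _ ?ps]) simp
qed

abbreviation diss :: "int \<Rightarrow> (int \<times> 'h) set \<Rightarrow> bool"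
  where "diss p \<equiv> ind p 1 0 {}"

text \<open>Two applications of \<open>ind_extend\<close> choose the \<open>2 * q\<close> elements
  for either end; the \<open>2 * q\<close> elements of \<open>D\<close> in excess of
  \<open>k\<close> make the second one possible. The rest may be paired arbitrarily, because subsets
  of \<open>D\<close> are dissociated.\<close>

lemma link_block:
  assumes D: "finite D" "diss p D" "\<forall>a\<in>D. snd a = h" "even (card D)" "k + 2 * q \<le> card D" "2 * q \<le> k"
    and Z: "finite Z" "diss p Z" "card Z \<le> N" "finite Z'" "diss p Z'" "card Z' \<le> N"
    and k: "(2 * k + 1) ^ (N + 2 * q) < 2 ^ k"
  shows "\<exists>ps. distinct (flat ps) \<and> els ps = D \<and> same_fibre ps \<and> 2 * q \<le> length ps \<and>
    diss p (Z \<union> els (take q ps)) \<and> diss p (Z' \<union> els (drop (length ps - q) ps))"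
proof -
  have k': "(2 * 1 * k + 1) ^ (N + 2 * q) < 2 ^ k" using k by simp
  obtain C where C: "C \<subseteq> D" "card C = 2 * q" "diss p (Z \<union> C)"
    using ind_extend[of p 1 0 "{}" Z D k 1 "N + 2 * q" "2 * q"] D Z k' by auto
  have fC: "finite C" using C(1) D(1) finite_subset by blast
  have "diss p (D - C)" using ind_subset[OF D(2,1)] by blast
  moreover have cDC: "card (D - C) = card D - 2 * q" using C fC by (simp add: card_Diff_subset)
  moreover have "k \<le> card (D - C)" using cDC D(5) by linarith
  ultimately obtain C' where C': "C' \<subseteq> D - C" "card C' = 2 * q" "diss p (Z' \<union> C')"
    using ind_extend[of p 1 0 "{}" Z' "D - C" k 1 "N + 2 * q" "2 * q"] D Z k' by auto
  have fC': "finite C'" using C'(1) D(1) finite_subset by blast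
  have cE: "card (D - C - C') = card D - 4 * q"
    using C' fC' cDC by (simp add: card_Diff_subset)
  obtain n where n: "card D = 2 * n" using D(4) by blast
  have "card (D - C - C') = 2 * (n - 2 * q)" using cE n D(5,6) by simp
  moreover have "\<forall>a\<in>D - C - C'. snd a = h" using D(3) by blast
  ultimately obtain pe where pe: "length pe = n - 2 * q" "distinct (flat pe)" "els pe = D - C - C'" "same_fibre pe"
    using pairing[of "D - C - C'" "n - 2 * q" h] D(1) by auto
  have "\<forall>a\<in>C. snd a = h" "\<forall>a\<in>C'. snd a = h" using D(3) C(1) C'(1) by auto
  then obtain pc pl where pc: "length pc = q" "distinct (flat pc)" "els pc = C" "same_fibre pc"
    and pl: "length pl = q" "distinct (flat pl)" "els pl = C'" "same_fibre pl"
    using pairing[OF fC C(2)] pairing[OF fC' C'(2)] by metis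
  let ?ps = "pc @ pe @ pl"
  have "distinct (flat ?ps)" using pc pe pl C'(1) by (auto simp: distinct_flat_append)
  moreover have "els ?ps = D" using pc pe pl C(1) C'(1) by auto
  moreover have "same_fibre ?ps" using pc pe pl by (auto simp: same_fibre_def)
  moreover have "2 * q \<le> length ?ps" using pc pl by simp
  moreover have "take q ?ps = pc" using pc(1) by simp
  moreover have "drop (length ?ps - q) ?ps = pl" using pc(1) pl(1) by simp
  ultimately show ?thesis using C(3) C'(3) pc(3) pl(3) by (intro exI[of _ ?ps]) simp
qed

text \<open>The end of each block is chosen to fit the beginning of the next. Every block has at
  least \<open>2 * q\<close> pairs, so a window of \<open>q\<close> pairs meets at most two of them.
  Both ends of the chain fit \<open>Q\<close>, which later closes it to a cycle.\<close>

lemma link_blocks: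
  assumes "Ds \<noteq> []"
    and "\<And>D. D \<in> set Ds \<Longrightarrow> finite D \<and> diss p D \<and> (\<exists>h. \<forall>a\<in>D. snd a = h) \<and> even (card D) \<and> k + 2 * q \<le> card D"
    and "sorted_wrt (\<lambda>A B. A \<inter> B = {}) Ds"
    and "2 * q \<le> k" and Q: "finite Q" "diss p Q" "card Q \<le> N" "2 * q \<le> N"
    and k: "(2 * k + 1) ^ (N + 2 * q) < 2 ^ k"
  shows "\<exists>ps. distinct (flat ps) \<and> els ps = \<Union>(set Ds) \<and> same_fibre ps \<and> q \<le> length ps \<and>
    diss p (Q \<union> els (take q ps)) \<and> diss p (Q \<union> els (drop (length ps - q) ps)) \<and>
    (\<forall>i. diss p (els (take q (drop i ps))))"
  using assms(1-3)
proof (induction Ds rule: list_nonempty_induct)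
  case (single D)
  then obtain h where h: "\<forall>a\<in>D. snd a = h" by auto
  obtain ps where ps: "distinct (flat ps)" "els ps = D" "same_fibre ps" "2 * q \<le> length ps"
    "diss p (Q \<union> els (take q ps))" "diss p (Q \<union> els (drop (length ps - q) ps))"
    using link_block[of D p h k q Q N Q] single h Q k assms(4) by auto
  have "diss p (els (take q (drop i ps)))" for i
  proof -
    have "els (take q (drop i ps)) \<subseteq> D"
      using ps(2) els_mono[of "take q (drop i ps)" ps] set_take_subset set_drop_subset by fastforce
    then show ?thesis using single(1) ind_subset by auto
  qed
  then show ?case using ps by (intro exI[of _ ps]) auto
next
  case (cons D Ds)
  then obtain ms where ms: "distinct (flat ms)" "els ms = \<Union>(set Ds)" "same_fibre ms" "q \<le> length ms"
    "diss p (Q \<union> els (take q ms))" "diss p (Q \<union> els (drop (length ms - q) ms))"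
    "\<And>i. diss p (els (take q (drop i ms)))"
    by auto
  have "\<exists>h. \<forall>a\<in>D. snd a = h" using cons.prems(1)[of D] by simp
  then obtain h where h: "\<forall>a\<in>D. snd a = h" ..
  have Z: "diss p (els (take q ms))" "card (els (take q ms)) \<le> N"
    using ms(7)[of 0] card_els_le[of "take q ms"] Q(4) by auto
  obtain ps where ps: "distinct (flat ps)" "els ps = D" "same_fibre ps" "2 * q \<le> length ps"
    "diss p (Q \<union> els (take q ps))" "diss p (els (take q ms) \<union> els (drop (length ps - q) ps))"
    using link_block[of D p h k q Q N "els (take q ms)"] cons.prems(1)[of D] h Q k Z assms(4) by auto
  let ?m = "ps @ ms"
  have "D \<inter> \<Union>(set Ds) = {}" using cons.prems(2) by auto
  then have "distinct (flat ?m)" using ps ms by (auto simp: distinct_flat_append)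
  moreover have "same_fibre ?m" using ps ms by (auto simp: same_fibre_def)
  moreover have "take q ?m = take q ps" "drop (length ?m - q) ?m = drop (length ms - q) ms"
    using ps(4) ms(4) by auto
  moreover have "diss p (els (take q (drop i ?m)))" for i
  proof (cases "i + q \<le> length ps")
    case True
    then have sub: "els (take q (drop i ?m)) \<subseteq> D"
      using ps(2) els_mono[of "take q (drop i ps)" ps] set_take_subset set_drop_subset by fastforce
    have "diss p D" "finite D" using cons.prems(1)[of D] by simp_all
    then show ?thesis using sub by (rule ind_subset)
  next
    case ni: False
    show ?thesis
    proof (cases "length ps \<le> i")
      case True then show ?thesis using ms(7) by simp
    next
      case False
      have "set (drop i ps) \<subseteq> set (drop (length ps - q) ps)"
        using ni by (intro set_drop_subset_set_drop) simp
      moreover have "set (take (q - (length ps - i)) ms) \<subseteq> set (take q ms)"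
        by (intro set_take_subset_set_take) simp
      moreover have "set (take q (drop i ?m)) \<subseteq> set (drop i ps) \<union> set (take (q - (length ps - i)) ms)"
        using False set_take_subset[of q "drop i ps"] by auto
      ultimately have "els (take q (drop i ?m)) \<subseteq> els (take q ms) \<union> els (drop (length ps - q) ps)"
        unfolding els_def by blast
      then show ?thesis using ind_subset[OF ps(6)] by auto
    qed
  qed
  ultimately show ?case using ps ms by (intro exI[of _ ?m]) auto
qed

text \<open>Each element of \<open>R\<close> adds at most \<open>N\<close> to a coefficient. For
  \<open>N = 2\<close> this is the origin of the bound \<open>2 * length r\<close> in the
  independence of \<open>Q\<close>.\<close>

lemma dep_span:
  assumes R: "finite R" "\<And>a. a \<in> R \<Longrightarrow> dep p 1 1 B (fst a)" and c: "\<And>a. a \<in> R \<Longrightarrow> \<bar>c a\<bar> \<le> int N"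
  shows "\<exists>d. (\<forall>b\<in>B. \<bar>d b\<bar> \<le> int (N * card R)) \<and> p dvd comb c R - comb d B"
proof -
  have "\<forall>a\<in>R. \<exists>d. (\<forall>b\<in>B. \<bar>d b\<bar> \<le> 1) \<and> p dvd fst a - comb d B"
    using R(2) by (auto simp: dep_def)
  then obtain dd where dd: "\<And>a b. a \<in> R \<Longrightarrow> b \<in> B \<Longrightarrow> \<bar>dd a b\<bar> \<le> 1"
    "\<And>a. a \<in> R \<Longrightarrow> p dvd fst a - comb (dd a) B" by metis
  let ?d = "\<lambda>b. \<Sum>a\<in>R. c a * dd a b"
  have "\<bar>?d b\<bar> \<le> int (N * card R)" if b: "b \<in> B" for b
  proof -
    have "\<bar>?d b\<bar> \<le> (\<Sum>a\<in>R. \<bar>c a * dd a b\<bar>)" by (rule sum_abs)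
    also have "\<dots> \<le> of_nat (card R) * int N"
    proof (rule sum_bounded_above)
      fix a assume "a \<in> R"
      then have "\<bar>c a\<bar> * \<bar>dd a b\<bar> \<le> int N * 1" using c dd(1) b by (intro mult_mono) auto
      then show "\<bar>c a * dd a b\<bar> \<le> int N" by (simp add: abs_mult)
    qed
    finally show ?thesis by (simp add: mult.commute)
  qed
  moreover have "p dvd (\<Sum>a\<in>R. c a * (fst a - comb (dd a) B))"
    using dd(2) by (intro dvd_sum dvd_mult) auto
  moreover have "(\<Sum>a\<in>R. c a * comb (dd a) B) = comb ?d B"
    unfolding comb_def by (simp add: sum_distrib_left sum_distrib_right mult.assoc) (rule sum.swap)
  then have "(\<Sum>a\<in>R. c a * (fst a - comb (dd a) B)) = comb c R - comb ?d B"
    by (simp add: right_diff_distrib sum_subtractf comb_def)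
  ultimately show ?thesis by (intro exI[of _ ?d]) auto
qed

text \<open>A relation among differences is one among the elements, with coefficients
  \<open>g t\<close> and \<open>- g t\<close> on the two members of a pair.\<close>

lemma pair_differences_independent:
  assumes d: "distinct (flat ps)" and Win: "Win \<subseteq> {..<length ps}"
    and ind: "diss p (\<Union>t\<in>Win. {fst (ps ! t), snd (ps ! t)})"
    and g: "\<And>t. t \<in> Win \<Longrightarrow> \<bar>g t\<bar> \<le> 1"
    and dvd: "p dvd (\<Sum>t\<in>Win. g t * (fst (fst (ps ! t)) - fst (snd (ps ! t))))"
    and t: "t \<in> Win"
  shows "g t = 0"
proof -
  have fin: "finite Win" using Win finite_subset by blast
  define f1 where "f1 t = fst (ps ! t)" for t
  define f2 where "f2 t = snd (ps ! t)" for t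
  have dm: "distinct (map fst ps)" "distinct (map snd ps)" "set (map fst ps) \<inter> set (map snd ps) = {}"
    using d by (auto simp: flat_def)
  have inj: "inj_on f1 Win" "inj_on f2 Win"
    using Win dm(1,2) by (auto simp: inj_on_def f1_def f2_def distinct_conv_nth subset_iff)
      (metis nth_map)+
  have dj: "f1 ` Win \<inter> f2 ` Win = {}"
    using Win dm(3) by (fastforce simp: f1_def f2_def)
  have els: "(\<Union>t\<in>Win. {fst (ps ! t), snd (ps ! t)}) = f1 ` Win \<union> f2 ` Win"
    by (auto simp: f1_def f2_def)
  define c where "c a = (if a \<in> f1 ` Win then g (inv_into Win f1 a) else - g (inv_into Win f2 a))" for a
  have c1: "c (f1 t) = g t" if "t \<in> Win" for t using that inj(1) by (simp add: c_def)
  have c2: "c (f2 t) = - g t" if "t \<in> Win" for t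
    using that inj(2) dj by (auto simp: c_def)
  have "comb c (f1 ` Win \<union> f2 ` Win) = comb c (f1 ` Win) + comb c (f2 ` Win)"
    using fin dj by (intro comb_union) auto
  also have "\<dots> = (\<Sum>t\<in>Win. g t * fst (f1 t)) + (\<Sum>t\<in>Win. - g t * fst (f2 t))"
    by (simp add: comb_def sum.reindex[OF inj(1)] sum.reindex[OF inj(2)] c1 c2 cong: sum.cong)
  also have "\<dots> = (\<Sum>t\<in>Win. g t * (fst (f1 t) - fst (f2 t)))"
    by (simp add: sum.distrib[symmetric] algebra_simps)
  finally have "p dvd comb c (f1 ` Win \<union> f2 ` Win) + comb (\<lambda>_. 0) {}"
    using dvd by (simp add: f1_def f2_def)
  then have "c (f1 t) = 0"
    using t g c1 c2 by (intro indD[OF ind[unfolded els], of c "\<lambda>_. 0"]) auto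
  then show ?thesis using c1[OF t] by simp
qed

section \<open>Words with a large independent part\<close>

context signed_group
begin

text \<open>The sign with which the letter at position \<open>k\<close>, counted from
  \<open>0\<close>, enters the sum: the letter itself does not contribute to it.\<close>

definition sgn :: "(int \<times> 'h) list \<Rightarrow> nat \<Rightarrow> int"
  where "sgn l k = e (hp (take k l))"

lemma sgn_cong: "map snd l = map snd l' \<Longrightarrow> sgn l k = sgn l' k"
  unfolding sgn_def by (rule arg_cong[of _ _ e], rule hp_cong) (simp add: take_map[symmetric])

lemma sgn_cases: "snd ` set l \<subseteq> carrier H \<Longrightarrow> sgn l k = 1 \<or> sgn l k = -1"
  unfolding sgn_def by (rule e_cases, rule hp_closed) (use set_take_subset in fastforce)

lemma xc_take:
  assumes "snd ` set l \<subseteq> carrier H" "n \<le> length l"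
  shows "xc (take n l) = (\<Sum>k<n. sgn l k * fst (l ! k))"
  using assms(2)
proof (induction n)
  case (Suc n)
  have "snd ` set (take n l) \<subseteq> carrier H" using assms(1) set_take_subset by fastforce
  then show ?case using Suc by (simp add: take_Suc_conv_app_nth xc_append sgn_def)
qed simp

lemma segment_sum_dvd:
  assumes l: "snd ` set l \<subseteq> carrier H" "i \<le> j" "j \<le> length l"
    and t: "triv p (take (j - i) (drop i l))"
  shows "p dvd (\<Sum>k\<in>{i..<j}. sgn l k * fst (l ! k))"
proof -
  have c: "snd ` set (take i l) \<subseteq> carrier H" using l(1) set_take_subset by fastforce
  have "take j l = take i l @ take (j - i) (drop i l)"
    using l(2) by (metis le_add_diff_inverse take_add)
  then have "xc (take j l) = xc (take i l) + e (hp (take i l)) * xc (take (j - i) (drop i l))"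
    using xc_append[OF c] by metis
  moreover have "(\<Sum>k<j. sgn l k * fst (l ! k)) =
      (\<Sum>k<i. sgn l k * fst (l ! k)) + (\<Sum>k\<in>{i..<j}. sgn l k * fst (l ! k))"
    using sum.atLeastLessThan_concat[of 0 i j "\<lambda>k. sgn l k * fst (l ! k)"] l(2)
    by (simp add: atLeast0LessThan)
  ultimately have "(\<Sum>k\<in>{i..<j}. sgn l k * fst (l ! k)) = e (hp (take i l)) * xc (take (j - i) (drop i l))"
    using xc_take[OF l(1)] l(2,3) by simp
  then show ?thesis using t by (simp add: triv_def)
qed

definition idx :: "'a list \<Rightarrow> 'a \<Rightarrow> nat"
  where "idx l a = inv_into {..<length l} ((!) l) a"

lemma idx_nth: "distinct l \<Longrightarrow> k < length l \<Longrightarrow> idx l (l ! k) = k"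
  unfolding idx_def by (rule inv_into_f_f) (auto simp: inj_on_def nth_eq_iff_index_eq)

lemma segment_sum_comb:
  assumes "distinct l" "j \<le> length l"
  shows "(\<Sum>k\<in>{i..<j}. s k * fst (l ! k)) = comb (\<lambda>a. s (idx l a)) ((!) l ` {i..<j})"
proof -
  have "inj_on ((!) l) {i..<j}" using assms by (auto simp: inj_on_def nth_eq_iff_index_eq)
  then show ?thesis using assms by (simp add: comb_def sum.reindex idx_nth)
qed

lemma admissible_by_segments:
  assumes "\<And>i j. i < j \<Longrightarrow> j \<le> length l \<Longrightarrow> (i, j) \<noteq> (0, length l) \<Longrightarrow> \<not> triv p (take (j - i) (drop i l))"
  shows "admissible p l"
  unfolding admissible_def
proof (intro allI impI)
  fix v assume v: "sublist v l \<and> v \<noteq> [] \<and> v \<noteq> l"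
  then obtain ps ss where l: "l = ps @ v @ ss" using sublistE by blast
  let ?i = "length ps" and ?j = "length ps + length v"
  have "take (?j - ?i) (drop ?i l) = v" using l by simp
  moreover have "length v < length l" using v sublist_length_less by blast
  then have "(?i, ?j) \<noteq> (0, length l)" by auto
  ultimately show "\<not> triv p v" using assms[of ?i ?j] v l by auto
qed

definition pick :: "nat set \<Rightarrow> ('a \<times> 'a) list \<Rightarrow> 'a list"
  where "pick E ps = map (\<lambda>t. if t \<in> E then fst (ps ! t) else snd (ps ! t)) [0..<length ps]"

lemma length_pick [simp]: "length (pick E ps) = length ps"
  by (simp add: pick_def)

lemma nth_pick: "t < length ps \<Longrightarrow> pick E ps ! t = (if t \<in> E then fst (ps ! t) else snd (ps ! t))"
  by (simp add: pick_def)

lemma set_picks: "set (pick E ps) \<union> set (pick (- E) ps) = els ps"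
proof -
  have "els ps = (\<Union>a\<in>set ps. {fst a, snd a})" by (auto simp: els_def)
  also have "set ps = (\<lambda>t. ps ! t) ` {..<length ps}" by (auto simp: set_conv_nth)
  finally have "els ps = (\<Union>t<length ps. {fst (ps ! t), snd (ps ! t)})" by simp
  then show ?thesis by (auto simp: pick_def split: if_splits)
qed

lemma map_snd_pick: "same_fibre ps \<Longrightarrow> map snd (pick E ps) = map (\<lambda>a. snd (fst a)) ps"
  by (rule nth_equalityI) (auto simp: nth_pick same_fibre_def split: prod.splits, metis nth_mem prod.collapse)

end

text \<open>The word of a set with a large independent part. The positions \<open>t\<close> and \<open>t + m\<close> of its second
  half hold the two elements of the \<open>t\<close>-th pair of a list, in an order given by a bit. Hence a
  segment that is neither very short nor almost everything separates many consecutive pairs, and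
  its sum depends injectively on their bits. The set \<open>Q\<close>, independent over the span of \<open>r\<close>, is cut
  into two halves, either of which can be placed at the ends of the word.\<close>

locale word_setup = signed_group H e for H :: "('h, 'm) monoid_scheme" (structure) and e +
  fixes p :: int and q :: nat and r :: "(int \<times> 'h) list"
    and mid :: "((int \<times> 'h) \<times> (int \<times> 'h)) list" and Q B :: "(int \<times> 'h) set" and h0 :: 'h
  assumes q: "0 < q"
    and Q: "finite Q" "ind p 2 (2 * length r) B Q" "\<And>a. a \<in> Q \<Longrightarrow> snd a = h0" "h0 \<in> carrier H"
    and B: "finite B"
    and r: "distinct r" "\<And>a. a \<in> set r \<Longrightarrow> dep p 1 1 B (fst a)" "admissible p r"
      "\<And>a. a \<in> set r \<Longrightarrow> \<not> triv p [a]" "snd ` set r \<subseteq> carrier H"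
    and mid: "distinct (flat mid)" "same_fibre mid" "q \<le> length mid" "snd ` els mid \<subseteq> carrier H"
      "diss p (Q \<union> els (take q mid))" "diss p (Q \<union> els (drop (length mid - q) mid))"
      "\<And>i. diss p (els (take q (drop i mid)))"
    and disj: "Q \<inter> set r = {}" "Q \<inter> els mid = {}" "set r \<inter> els mid = {}"
    and big: "2 * (length r + 8 * q + 2 * length mid + 5) ^ 2 < 2 ^ q"
begin

text \<open>The number of pairs in the cycle: \<open>q\<close>, \<open>2 * q + 1\<close>,
  \<open>length mid\<close> and \<open>q\<close> in this order.\<close>

abbreviation m :: nat where "m \<equiv> 4 * q + 1 + length mid"

abbreviation U :: nat where "U \<equiv> length r + 2"

text \<open>Of the \<open>2 * q + 1\<close> pairs of \<open>Pa\<close>, one goes to the front and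
  \<open>q\<close> to each end of the cycle. \<open>Pb\<close> has the same length so that the
  halves can change places.\<close>

definition halves where "halves Pa Pb \<longleftrightarrow> length Pa = 2 * q + 1 \<and> length Pb = 2 * q + 1 \<and>
  distinct (flat (Pa @ Pb)) \<and> els (Pa @ Pb) = Q"

text \<open>Both ends belong to \<open>Pa\<close>, so a segment lacking fewer than \<open>q\<close>
  positions of the two turns contains all of \<open>Pb\<close> and \<open>mid\<close>. Cyclically,
  \<open>mid\<close> is bordered on both sides by \<open>Q\<close>.\<close>

definition pairs where "pairs Pa Pb = take q (tl Pa) @ Pb @ mid @ drop q (tl Pa)"

text \<open>The product of all of \<open>r\<close> may be trivial. Elements of \<open>Q\<close>
  before and after its first letter prevent \<open>r\<close> from being a segment.\<close>

definition front where "front Pa = [fst (hd Pa)] @ take 1 r @ [snd (hd Pa)] @ drop 1 r"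

definition word where "word Pa Pb E = front Pa @ pick E (pairs Pa Pb) @ pick (- E) (pairs Pa Pb)"

lemma length_front: "length (front Pa) = U"
proof -
  have "length (take 1 r) + length (drop 1 r) = length r" by (metis append_take_drop_id length_append)
  then show ?thesis by (simp add: front_def del: length_take length_drop)
qed

lemma set_front: "set (front Pa) = {fst (hd Pa), snd (hd Pa)} \<union> set r"
proof -
  have "set (take 1 r) \<union> set (drop 1 r) = set r" by (metis append_take_drop_id set_append)
  then show ?thesis by (auto simp: front_def)
qed

lemma halves_sym: "halves Pa Pb \<Longrightarrow> halves Pb Pa"
  by (auto simp: halves_def distinct_flat_append)

context
  fixes Pa Pb assumes h: "halves Pa Pb"
begin

lemma Pa_ne: "Pa \<noteq> []" using h by (auto simp: halves_def)

lemma els_Pa: "els Pa = {fst (hd Pa), snd (hd Pa)} \<union> els (tl Pa)"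
  using Pa_ne by (cases Pa) auto

lemma els_tl: "els (tl Pa) = els (take q (tl Pa)) \<union> els (drop q (tl Pa))"
  by (metis append_take_drop_id els_simps(3))

lemma length_pairs: "length (pairs Pa Pb) = m"
  using h by (simp add: halves_def pairs_def)

lemma els_pairs: "els (pairs Pa Pb) = els (tl Pa) \<union> els Pb \<union> els mid"
  using els_tl by (auto simp: pairs_def)

lemma distinct_pairs: "distinct (flat (pairs Pa Pb))"
proof -
  have d: "distinct (flat Pa)" "distinct (flat Pb)" "els Pa \<inter> els Pb = {}" "els Pa \<union> els Pb = Q"
    using h by (auto simp: halves_def distinct_flat_append)
  have "Pa = [hd Pa] @ take q (tl Pa) @ drop q (tl Pa)" using Pa_ne by simp
  then have t: "distinct (flat (take q (tl Pa)))" "distinct (flat (drop q (tl Pa)))"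
    "els (take q (tl Pa)) \<inter> els (drop q (tl Pa)) = {}"
    using d(1) by (metis distinct_flat_append)+
  have sub: "els (take q (tl Pa)) \<subseteq> els Pa" "els (drop q (tl Pa)) \<subseteq> els Pa"
    using els_Pa els_tl by auto
  then show ?thesis using d t mid(1) disj(2) unfolding pairs_def distinct_flat_append els_simps by blast
qed

lemma halves_fibre:
  assumes "a \<in> set Pa \<union> set Pb"
  shows "snd (fst a) = h0" "snd (snd a) = h0"
proof -
  have "fst a \<in> els Pa \<union> els Pb" "snd a \<in> els Pa \<union> els Pb" using assms by (auto simp: els_def)
  moreover have "els Pa \<union> els Pb = Q" using h by (simp add: halves_def)
  ultimately show "snd (fst a) = h0" "snd (snd a) = h0" using Q(3) by blast+
qed

lemma halves_subset: "set (take q (tl Pa)) \<subseteq> set Pa" "set (drop q (tl Pa)) \<subseteq> set Pa"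
  using set_take_subset[of q "tl Pa"] set_drop_subset[of q "tl Pa"] list.set_sel(2)[OF Pa_ne] by auto

lemma same_fibre_pairs: "same_fibre (pairs Pa Pb)"
proof -
  have "snd (fst x) = snd (snd x)" if "x \<in> set (pairs Pa Pb)" for x
  proof (cases "x \<in> set mid")
    case True
    then show ?thesis using mid(2) by (auto simp: same_fibre_def)
  next
    case False
    then have "x \<in> set Pa \<union> set Pb" using that halves_subset by (auto simp: pairs_def)
    then show ?thesis using halves_fibre by metis
  qed
  then show ?thesis by (auto simp: same_fibre_def)
qed

lemma set_word: "set (word Pa Pb E) = Q \<union> set r \<union> els mid"
  using els_Pa h set_picks[of E "pairs Pa Pb"] by (auto simp: word_def set_front els_pairs halves_def)

lemma length_word: "length (word Pa Pb E) = U + 2 * m"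
  by (simp add: word_def length_pairs length_front)

lemma distinct_word: "distinct (word Pa Pb E)"
proof (rule card_distinct)
  have "card Q = 8 * q + 4"
    using card_els[of "Pa @ Pb"] h by (simp add: halves_def)
  moreover have "card (Q \<union> set r \<union> els mid) = card Q + card (set r) + card (els mid)"
    using Q(1) disj by (simp add: card_Un_disjoint Int_Un_distrib2)
  ultimately show "card (set (word Pa Pb E)) = length (word Pa Pb E)"
    unfolding set_word length_word using card_els[OF mid(1)] distinct_card[OF r(1)] by simp
qed

lemma carrier_word: "snd ` set (word Pa Pb E) \<subseteq> carrier H"
  unfolding set_word using Q(3,4) r(5) mid(4) by auto

text \<open>The right-hand side depends neither on \<open>E\<close> nor on \<open>Pa\<close> and
  \<open>Pb\<close>, so the sign at each position is the same in all words under
  consideration.\<close>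

lemma map_snd_word: "map snd (word Pa Pb E) = [h0] @ map snd (take 1 r) @ [h0] @ map snd (drop 1 r) @
  (let l = replicate (3 * q + 1) h0 @ map (\<lambda>a. snd (fst a)) mid @ replicate q h0 in l @ l)"
proof -
  have rep: "map (\<lambda>a. snd (fst a)) l = replicate (length l) h0" if "set l \<subseteq> set Pa \<union> set Pb" for l
    using that halves_fibre by (induction l) auto
  have sub: "set (take q (tl Pa)) \<subseteq> set Pa \<union> set Pb" "set (drop q (tl Pa)) \<subseteq> set Pa \<union> set Pb" "set Pb \<subseteq> set Pa \<union> set Pb"
    using halves_subset by auto
  have "map (\<lambda>a. snd (fst a)) (pairs Pa Pb) =
      replicate (3 * q + 1) h0 @ map (\<lambda>a. snd (fst a)) mid @ replicate q h0"
  proof -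
    have "length (take q (tl Pa)) = q" "length Pb = 2 * q + 1" "length (drop q (tl Pa)) = q"
      using h by (auto simp: halves_def)
    then have "map (\<lambda>a. snd (fst a)) (pairs Pa Pb) =
        replicate q h0 @ replicate (2 * q + 1) h0 @ map (\<lambda>a. snd (fst a)) mid @ replicate q h0"
      unfolding pairs_def map_append rep[OF sub(1)] rep[OF sub(2)] rep[OF sub(3)] by simp
    moreover have "replicate (3 * q + 1) h0 = replicate q h0 @ replicate (2 * q + 1) h0"
      unfolding replicate_add[symmetric] by (rule arg_cong[of _ _ "\<lambda>n. replicate n h0"]) simp
    ultimately show ?thesis by simp
  qed
  moreover have "snd (fst (hd Pa)) = h0" "snd (snd (hd Pa)) = h0" using halves_fibre[of "hd Pa"] Pa_ne by auto
  ultimately show ?thesis using same_fibre_pairs by (simp add: word_def front_def map_snd_pick Let_def)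
qed

lemma word_front: "k < U \<Longrightarrow> word Pa Pb E ! k = front Pa ! k"
  by (simp add: word_def nth_append length_front)

lemma word_prefix: "k < U \<Longrightarrow> word Pa Pb E ! k \<in> Q \<union> set r"
  using nth_mem[of k "front Pa"] els_Pa h by (auto simp: word_front length_front set_front halves_def)

lemma word_pair:
  assumes "t < m"
  shows "word Pa Pb E ! (U + t) = (if t \<in> E then fst (pairs Pa Pb ! t) else snd (pairs Pa Pb ! t))"
    "word Pa Pb E ! (U + m + t) = (if t \<in> E then snd (pairs Pa Pb ! t) else fst (pairs Pa Pb ! t))"
  using assms by (auto simp: word_def nth_append length_front length_pairs nth_pick)

lemma nth_pairs:
  assumes "t < m"
  shows "t < q \<Longrightarrow> pairs Pa Pb ! t \<in> set (tl Pa)"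
    "q \<le> t \<Longrightarrow> t < 3 * q + 1 \<Longrightarrow> pairs Pa Pb ! t \<in> set Pb"
    "3 * q + 1 \<le> t \<Longrightarrow> t < m - q \<Longrightarrow> pairs Pa Pb ! t = mid ! (t - (3 * q + 1))"
    "m - q \<le> t \<Longrightarrow> pairs Pa Pb ! t \<in> set (tl Pa)"
proof -
  have l: "length (take q (tl Pa)) = q" "length Pb = 2 * q + 1" "length (drop q (tl Pa)) = q"
    using h by (auto simp: halves_def)
  show "pairs Pa Pb ! t \<in> set (tl Pa)" if "t < q"
    using that l nth_mem[of t "take q (tl Pa)"] in_set_takeD by (fastforce simp: pairs_def nth_append)
  show "pairs Pa Pb ! t \<in> set Pb" if "q \<le> t" "t < 3 * q + 1"
    using that l by (auto simp: pairs_def nth_append)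
  show "pairs Pa Pb ! t = mid ! (t - (3 * q + 1))" if "3 * q + 1 \<le> t" "t < m - q"
  proof -
    have "t - q - (2 * q + 1) = t - (3 * q + 1)" by simp
    then show ?thesis using that l unfolding pairs_def nth_append by (auto simp: less_diff_conv)
  qed
  show "pairs Pa Pb ! t \<in> set (tl Pa)" if t: "m - q \<le> t"
  proof -
    have "pairs Pa Pb = (take q (tl Pa) @ Pb @ mid) @ drop q (tl Pa)" by (simp add: pairs_def)
    moreover have "length (take q (tl Pa) @ Pb @ mid) = m - q" using l by simp
    ultimately have "pairs Pa Pb ! t = drop q (tl Pa) ! (t - (m - q))"
      using t by (metis nth_append not_less)
    moreover have "t - (m - q) < length (drop q (tl Pa))" using assms t l by simp
    ultimately show ?thesis using nth_mem in_set_dropD by metis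
  qed
qed

end

end

lemma ind_no_relation:
  assumes "ind p k K V S" "finite S" "T \<subseteq> S" "T \<noteq> {}" "\<And>a. a \<in> T \<Longrightarrow> c a = 1 \<or> c a = -1" "0 < k"
  shows "\<not> p dvd comb c T"
proof
  assume d: "p dvd comb c T"
  have "ind p k K V T" using assms(1-3) by (rule ind_subset)
  then have "c a = 0" if "a \<in> T" for a
  proof (rule indD[of p k K V T c "\<lambda>_. 0"])
    show "\<bar>c b\<bar> \<le> int k" if "b \<in> T" for b using assms(5)[OF that] assms(6) by auto
    show "p dvd comb c T + comb (\<lambda>_. 0) V" using d by (simp add: comb_def)
  qed (use that in auto)
  then show False using assms(4,5) by force
qed

lemma mod_three:
  fixes a k :: nat
  assumes "a < 3 * k"
  shows "a mod k = (if a < k then a else if a < 2 * k then a - k else a - 2 * k)"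
proof -
  consider "a < k" | "k \<le> a" "a < 2 * k" | "2 * k \<le> a" by linarith
  then show ?thesis
  proof cases
    case 3
    then have "a mod k = (a - k) mod k" by (simp add: le_mod_geq)
    also have "\<dots> = (a - k - k) mod k" using 3 by (simp add: le_mod_geq)
    also have "\<dots> = a - 2 * k" using 3 assms by simp
    finally show ?thesis using 3 by simp
  qed (auto simp: le_mod_geq)
qed

section \<open>Segments that separate many pairs\<close>

context word_setup
begin

definition win where "win t0 = (\<lambda>s. (t0 + s) mod m) ` {..<q}"

lemma win_subset: "win t0 \<subseteq> {..<m}"
  by (auto simp: win_def)

lemma card_win:
  assumes "t0 < m"
  shows "card (win t0) = q"
proof -
  have "inj_on (\<lambda>s. (t0 + s) mod m) {..<q}"
  proof (rule inj_onI)
    fix a b assume ab: "a \<in> {..<q}" "b \<in> {..<q}" "(t0 + a) mod m = (t0 + b) mod m"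
    have "t0 + a < 3 * m" "t0 + b < 3 * m" using ab assms by auto
    then show "a = b" using ab assms mod_three[of "t0 + a" m] mod_three[of "t0 + b" m]
      by (simp split: if_splits)
  qed
  then show ?thesis by (simp add: win_def card_image)
qed

text \<open>Pair \<open>t\<close> occupies the opposite positions \<open>t\<close> and
  \<open>t + m\<close> on a cycle of length \<open>2 * m\<close>. If the segment covers at most half
  of the cycle, the first \<open>q\<close> positions from \<open>x\<close> lie in it and their
  opposites outside; otherwise the same applies to its complement, which starts at
  \<open>y\<close>.\<close>

lemma separating_window:
  assumes xy: "x < y" "y \<le> 2 * m" "q \<le> y - x" "y - x \<le> 2 * m - q"
  obtains t0 where "t0 < m" "\<forall>t\<in>win t0. (x \<le> t \<and> t < y) \<noteq> (x \<le> t + m \<and> t + m < y)"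
proof -
  have m0: "0 < m" by simp
  have qm: "q \<le> m" by simp
  show ?thesis
  proof (cases "y - x \<le> m")
    case True
    show ?thesis
    proof (rule that[of "x mod m"], use m0 in simp, rule ballI)
      fix t assume "t \<in> win (x mod m)"
      then obtain s where s: "s < q" "t = (x mod m + s) mod m" by (auto simp: win_def)
      then have "t = (x + s) mod m" by (simp add: mod_add_left_eq)
      moreover have "x + s < 3 * m" using s xy by linarith
      ultimately have "t = (if x + s < m then x + s else if x + s < 2 * m then x + s - m else x + s - 2 * m)"
        using mod_three by presburger
      then show "(x \<le> t \<and> t < y) \<noteq> (x \<le> t + m \<and> t + m < y)"
        using s(1) xy True qm by (simp split: if_splits) linarith+
    qed
  next
    case False
    show ?thesis
    proof (rule that[of "y mod m"], use m0 in simp, rule ballI)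
      fix t assume "t \<in> win (y mod m)"
      then obtain s where s: "s < q" "t = (y mod m + s) mod m" by (auto simp: win_def)
      then have "t = (y + s) mod m" by (simp add: mod_add_left_eq)
      moreover have "y + s < 3 * m" using s xy by linarith
      ultimately have "t = (if y + s < m then y + s else if y + s < 2 * m then y + s - m else y + s - 2 * m)"
        using mod_three by presburger
      then show "(x \<le> t \<and> t < y) \<noteq> (x \<le> t + m \<and> t + m < y)"
        using s(1) xy False qm by (simp split: if_splits) linarith+
    qed
  qed
qed

definition bad where "bad Pa Pb i j = {E \<in> Pow {..<m}.
  p dvd (\<Sum>k\<in>{i..<j}. sgn (word Pa Pb E) k * fst (word Pa Pb E ! k))}"

definition both where "both Pa Pb t = {fst (pairs Pa Pb ! t), snd (pairs Pa Pb ! t)}"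

context
  fixes Pa Pb assumes h: "halves Pa Pb"
begin

lemma sgn_word: "sgn (word Pa Pb E) k = sgn (word Pa Pb {}) k"
  by (rule sgn_cong) (simp only: map_snd_word[OF h])

lemma els_halves: "els Pa \<union> els Pb = Q"
  using h by (simp add: halves_def)

lemma word_mem_both:
  assumes "U \<le> k" "k < U + 2 * m"
  shows "word Pa Pb E ! k \<in> both Pa Pb ((k - U) mod m)"
proof (cases "k < U + m")
  case True
  then have "(k - U) mod m = k - U" "U + (k - U) = k" "k - U < m" using assms by auto
  then show ?thesis using word_pair(1)[OF h, of "k - U" E] unfolding both_def by (metis insert_iff)
next
  case False
  then have "(k - U) mod m = k - U - m" "U + m + (k - U - m) = k" "k - U - m < m"
    using assms by (auto simp: le_mod_geq)
  then show ?thesis using word_pair(2)[OF h, of "k - U - m" E] unfolding both_def by (metis insert_iff)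
qed

lemma pair_Q:
  assumes "t < m" "t < 3 * q + 1 \<or> m - q \<le> t"
  shows "both Pa Pb t \<subseteq> Q"
proof -
  have "pairs Pa Pb ! t \<in> set (tl Pa) \<union> set Pb"
    using nth_pairs[OF h assms(1)] assms(2) by (metis Un_iff not_less)
  then have "pairs Pa Pb ! t \<in> set Pa \<union> set Pb" using list.set_sel(2)[OF Pa_ne[OF h]] by blast
  then show ?thesis unfolding both_def els_halves[symmetric] els_def by blast
qed

lemma pair_mid:
  assumes "3 * q + 1 \<le> t" "t < m - q"
  shows "pairs Pa Pb ! t = mid ! (t - (3 * q + 1))"
  using nth_pairs(3)[OF h _ assms] assms by linarith

lemma both_mid:
  assumes "3 * q + 1 \<le> t" "t < m - q" "mid ! (t - (3 * q + 1)) \<in> set ps"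
  shows "both Pa Pb t \<subseteq> els ps"
  using assms(3) by (auto simp: both_def pair_mid[OF assms(1,2)] els_def)

text \<open>The cycle has more than \<open>q\<close> consecutive pairs from \<open>Q\<close> outside
  \<open>mid\<close>, so a window meets \<open>mid\<close> only in its first \<open>q\<close> pairs,
  only in its last \<open>q\<close> pairs, or lies inside it.\<close>

lemma win_diss:
  assumes t0: "t0 < m"
  shows "diss p (\<Union>t\<in>win t0. both Pa Pb t)" (is "diss p ?S")
proof -
  let ?f = "3 * q + 1"
  have key: "?S \<subseteq> Z" if "\<And>s. s < q \<Longrightarrow> both Pa Pb ((t0 + s) mod m) \<subseteq> Z" for Z
    using that by (auto simp: win_def)
  have fin: "finite (Q \<union> els ps)" for ps using Q(1) by simp
  consider "t0 < ?f" | "?f \<le> t0" "t0 + q \<le> m - q" | "?f \<le> t0" "m - q < t0 + q" by linarith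
  then show ?thesis
  proof cases
    case 1
    have "?S \<subseteq> Q \<union> els (take q mid)"
    proof (rule key)
      fix s assume s: "s < q"
      have lt: "t0 + s < m - q" using 1 s mid(3) by linarith
      then have md: "(t0 + s) mod m = t0 + s" by simp
      show "both Pa Pb ((t0 + s) mod m) \<subseteq> Q \<union> els (take q mid)"
      proof (cases "t0 + s < ?f")
        case True
        then show ?thesis using pair_Q[of "t0 + s"] lt md by auto
      next
        case False
        have lq: "t0 + s - ?f < q" using 1 s by linarith
        then have "take q mid ! (t0 + s - ?f) = mid ! (t0 + s - ?f)" by simp
        moreover have "t0 + s - ?f < length (take q mid)" using lq mid(3) by simp
        ultimately have "mid ! (t0 + s - ?f) \<in> set (take q mid)" by (metis nth_mem)
        then show ?thesis using both_mid[of "t0 + s"] lt False unfolding md by auto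
      qed
    qed
    then show ?thesis using ind_subset[OF mid(5) fin] by blast
  next
    case 2
    have "?S \<subseteq> els (take q (drop (t0 - ?f) mid))"
    proof (rule key)
      fix s assume s: "s < q"
      have lt: "t0 + s < m - q" using 2 s by linarith
      then have md: "(t0 + s) mod m = t0 + s" by simp
      have "take q (drop (t0 - ?f) mid) ! s = mid ! (t0 - ?f + s)" using s 2 by simp
      moreover have "s < length (take q (drop (t0 - ?f) mid))" using s 2 by simp
      ultimately have "mid ! (t0 - ?f + s) \<in> set (take q (drop (t0 - ?f) mid))" by (metis nth_mem)
      moreover have "t0 - ?f + s = t0 + s - ?f" using 2 by linarith
      ultimately show "both Pa Pb ((t0 + s) mod m) \<subseteq> els (take q (drop (t0 - ?f) mid))"
        using both_mid[of "t0 + s"] lt 2(1) unfolding md by auto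
    qed
    then show ?thesis using ind_subset[OF mid(7) finite_els] by blast
  next
    case 3
    have "?S \<subseteq> Q \<union> els (drop (length mid - q) mid)"
    proof (rule key)
      fix s assume s: "s < q"
      have md: "(t0 + s) mod m = (if t0 + s < m then t0 + s else t0 + s - m)"
        using mod_three[of "t0 + s" m] s t0 by auto
      show "both Pa Pb ((t0 + s) mod m) \<subseteq> Q \<union> els (drop (length mid - q) mid)"
      proof (cases "t0 + s < m - q")
        case True
        then have md': "(t0 + s) mod m = t0 + s" by simp
        let ?k = "t0 + s - ?f - (length mid - q)"
        have k: "length mid - q + ?k = t0 + s - ?f" "?k < q" using 3 True s mid(3) by linarith+
        then have "drop (length mid - q) mid ! ?k = mid ! (t0 + s - ?f)" by simp
        moreover have "?k < length (drop (length mid - q) mid)" using k(2) mid(3) by simp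
        ultimately have "mid ! (t0 + s - ?f) \<in> set (drop (length mid - q) mid)" by (metis nth_mem)
        then show ?thesis using both_mid[of "t0 + s"] True 3(1) unfolding md' by auto
      next
        case False
        have "(t0 + s) mod m < m" "(t0 + s) mod m < ?f \<or> m - q \<le> (t0 + s) mod m"
          using md False s t0 by auto
        then show ?thesis using pair_Q[of "(t0 + s) mod m"] by blast
      qed
    qed
    then show ?thesis using ind_subset[OF mid(6) fin] by blast
  qed
qed

text \<open>If two bad choices agree outside the window, their relations differ by a combination of
  pair differences with coefficients \<open>-1\<close>, \<open>0\<close> or \<open>1\<close>, which
  must be trivial. Hence the bits outside the window determine those inside.\<close>

lemma card_bad:
  assumes ij: "U < j" "j \<le> U + 2 * m"
    and x: "x = max i U - U" and y: "y = j - U" and xy: "x < y" "q \<le> y - x" "y - x \<le> 2 * m - q"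
  shows "card (bad Pa Pb i j) \<le> 2 ^ (m - q)"
proof -
  have y2: "y \<le> 2 * m" using ij y by linarith
  obtain t0 where t0: "t0 < m" "\<forall>t\<in>win t0. (x \<le> t \<and> t < y) \<noteq> (x \<le> t + m \<and> t + m < y)"
    by (rule separating_window[OF xy(1) y2 xy(2,3)])
  define Win where "Win = win t0"
  have Win: "Win \<subseteq> {..<m}" "card Win = q" "finite Win"
    using win_subset card_win[OF t0(1)] by (auto simp: Win_def intro: finite_subset)
  have mem: "U + t \<in> {i..<j} \<longleftrightarrow> x \<le> t \<and> t < y" for t using x y ij(1) by auto
  have mem': "U + m + t \<in> {i..<j} \<longleftrightarrow> x \<le> t + m \<and> t + m < y" for t using mem[of "t + m"] by (simp add: ac_simps)
  have one: "(U + t \<in> {i..<j}) \<noteq> (U + m + t \<in> {i..<j})" if "t \<in> Win" for t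
    using t0(2) that unfolding mem mem' Win_def by blast
  let ?W = "word Pa Pb"
  define s where "s = sgn (?W {})"
  have s1: "s k = 1 \<or> s k = -1" for k unfolding s_def by (rule sgn_cases[OF carrier_word[OF h]])
  have sw: "sgn (?W E) = s" for E unfolding s_def by (rule ext, rule sgn_word)
  let ?L = "pairs Pa Pb"
  have "inj_on (\<lambda>E. E - Win) (bad Pa Pb i j)"
  proof (rule inj_onI)
    fix E E' assume E: "E \<in> bad Pa Pb i j" "E' \<in> bad Pa Pb i j" "E - Win = E' - Win"
    define D where "D k = s k * (fst (?W E ! k) - fst (?W E' ! k))" for k
    have "p dvd (\<Sum>k\<in>{i..<j}. s k * fst (?W E ! k))" "p dvd (\<Sum>k\<in>{i..<j}. s k * fst (?W E' ! k))"
      using E(1,2) by (simp_all only: bad_def mem_Collect_eq sw)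
    then have "p dvd (\<Sum>k\<in>{i..<j}. s k * fst (?W E ! k)) - (\<Sum>k\<in>{i..<j}. s k * fst (?W E' ! k))"
      by (rule dvd_diff)
    then have dvdD: "p dvd (\<Sum>k\<in>{i..<j}. D k)"
      by (simp add: D_def sum_subtractf right_diff_distrib)
    \<comment> \<open>By \<open>one\<close>, exactly one of the two positions of a pair in the
      window lies in the segment; \<open>pos t\<close> is that position.\<close>
    define pos where "pos t = (if U + t \<in> {i..<j} then U + t else U + m + t)" for t
    have pos_in: "pos t \<in> {i..<j}" if "t \<in> Win" for t using one[OF that] unfolding pos_def by presburger
    have inj: "inj_on pos Win"
      using Win(1) by (auto simp: inj_on_def pos_def split: if_splits)
    have same: "t \<in> E \<longleftrightarrow> t \<in> E'" if "t \<notin> Win" for t using E(3) that by blast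
    have D0: "D k = 0" if k: "k \<in> {i..<j} - pos ` Win" for k
    proof (cases "k < U")
      case True
      then have "?W E ! k = ?W E' ! k" by (simp add: word_front[OF h])
      then show ?thesis by (simp add: D_def)
    next
      case False
      define t where "t = (if k < U + m then k - U else k - U - m)"
      have tm: "t < m" using False k ij by (auto simp: t_def)
      have kt: "k = U + t \<or> k = U + m + t" using False by (auto simp: t_def)
      have "t \<notin> Win"
      proof
        assume tW: "t \<in> Win"
        have "k = pos t" using kt k one[OF tW] unfolding pos_def by auto
        then show False using k tW by blast
      qed
      then show ?thesis using kt same word_pair[OF h tm] by (auto simp: D_def)
    qed
    have "(\<Sum>k\<in>{i..<j}. D k) = (\<Sum>k\<in>pos ` Win. D k)"
      by (rule sum.mono_neutral_right) (use pos_in D0 in auto)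
    also have "\<dots> = (\<Sum>t\<in>Win. D (pos t))" by (simp add: sum.reindex[OF inj])
    \<comment> \<open>In the second turn the elements of a pair are exchanged, which accounts for
      the factor \<open>-1\<close>.\<close>
    also have "\<dots> = (\<Sum>t\<in>Win. (s (pos t) * (if pos t = U + t then 1 else -1) * (of_bool (t \<in> E) - of_bool (t \<in> E')))
        * (fst (fst (?L ! t)) - fst (snd (?L ! t))))"
    proof (rule sum.cong)
      fix t assume t: "t \<in> Win"
      then have tm: "t < m" using Win(1) by auto
      show "D (pos t) = (s (pos t) * (if pos t = U + t then 1 else -1) * (of_bool (t \<in> E) - of_bool (t \<in> E')))
        * (fst (fst (?L ! t)) - fst (snd (?L ! t)))"
        using word_pair[OF h tm, of E] word_pair[OF h tm, of E']
        unfolding D_def pos_def by (simp add: algebra_simps)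
    qed simp
    finally have dvd: "p dvd (\<Sum>t\<in>Win. (s (pos t) * (if pos t = U + t then 1 else -1) * (of_bool (t \<in> E) - of_bool (t \<in> E')))
        * (fst (fst (?L ! t)) - fst (snd (?L ! t))))" using dvdD by simp
    have "t \<in> E \<longleftrightarrow> t \<in> E'" if t: "t \<in> Win" for t
    proof -
      have "s (pos t) * (if pos t = U + t then 1 else -1) * (of_bool (t \<in> E) - of_bool (t \<in> E')) = 0"
      proof (rule pair_differences_independent[OF distinct_pairs[OF h] _ _ _ dvd t])
        show "Win \<subseteq> {..<length ?L}" using Win(1) length_pairs[OF h] by simp
        show "diss p (\<Union>t\<in>Win. {fst (?L ! t), snd (?L ! t)})"
          using win_diss[OF t0(1)] by (simp add: Win_def both_def)
        show "\<bar>s (pos t) * (if pos t = U + t then 1 else -1) * (of_bool (t \<in> E) - of_bool (t \<in> E'))\<bar> \<le> 1" for t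
          using s1[of "pos t"] by auto
      qed
      then show ?thesis using s1[of "pos t"] by (auto split: if_splits)
    qed
    then show "E = E'" using same by blast
  qed
  moreover have "(\<lambda>E. E - Win) ` bad Pa Pb i j \<subseteq> Pow ({..<m} - Win)"
    by (auto simp: bad_def)
  ultimately have "card (bad Pa Pb i j) \<le> card (Pow ({..<m} - Win))"
    by (intro card_inj_on_le) auto
  also have "\<dots> = 2 ^ (m - q)" using Win by (simp add: card_Pow card_Diff_subset)
  finally show ?thesis .
qed

end

text \<open>The difference counts the positions of the segment behind the front; its bounds are
  those of \<open>separating_window\<close>.\<close>

definition middle where "middle i j \<longleftrightarrow> U < j \<and> j \<le> U + 2 * m \<and>
  q \<le> (j - U) - (max i U - U) \<and> (j - U) - (max i U - U) \<le> 2 * m - q"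

definition good where "good Pa Pb E \<longleftrightarrow> E \<subseteq> {..<m} \<and> (\<forall>i j. middle i j \<longrightarrow> i < j \<longrightarrow> E \<notin> bad Pa Pb i j)"

definition seg where "seg Pa Pb E i j = (!) (word Pa Pb E) ` {i..<j}"

definition coef where "coef Pa Pb E a = sgn (word Pa Pb E) (idx (word Pa Pb E) a)"

text \<open>Union bound over both words and all middle segments. One and the same \<open>E\<close>
  has to serve both words, since their relations are subtracted later.\<close>

lemma exists_good:
  assumes h: "halves Pa Pb"
  obtains E where "good Pa Pb E" "good Pb Pa E"
proof -
  let ?n = "U + 2 * m"
  let ?I = "{(i, j). i < j \<and> j \<le> ?n \<and> middle i j}"
  have I: "?I \<subseteq> {..?n} \<times> {..?n}" by auto
  have fI: "finite ?I" by (rule finite_subset[OF I]) auto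
  have cI: "card ?I \<le> (?n + 1) ^ 2"
    using card_mono[OF _ I] by (simp add: card_cartesian_product power2_eq_square)
  have bnd: "card (\<Union>(i, j)\<in>?I. bad P1 P2 i j) \<le> (?n + 1) ^ 2 * 2 ^ (m - q)" if "halves P1 P2" for P1 P2
  proof -
    have "card (\<Union>(i, j)\<in>?I. bad P1 P2 i j) \<le> (\<Sum>(i, j)\<in>?I. card (bad P1 P2 i j))"
      using card_UN_le[OF fI, of "\<lambda>(i, j). bad P1 P2 i j"] by (simp add: case_prod_beta)
    also have "\<dots> \<le> (\<Sum>(i, j)\<in>?I. 2 ^ (m - q))"
    proof (rule sum_mono)
      fix a assume "a \<in> ?I"
      then obtain i j where a: "a = (i, j)" "i < j" "middle i j" by auto
      have "card (bad P1 P2 i j) \<le> 2 ^ (m - q)"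
        by (rule card_bad[OF that _ _ refl refl]) (use a(2,3) q in \<open>auto simp: middle_def\<close>)
      then show "(case a of (i, j) \<Rightarrow> card (bad P1 P2 i j)) \<le> (case a of (i, j) \<Rightarrow> 2 ^ (m - q))"
        using a by simp
    qed
    also have "\<dots> = card ?I * 2 ^ (m - q)" by (simp add: case_prod_beta)
    also have "\<dots> \<le> (?n + 1) ^ 2 * 2 ^ (m - q)" using cI by (rule mult_right_mono) simp
    finally show ?thesis .
  qed
  let ?X = "(\<Union>(i, j)\<in>?I. bad Pa Pb i j) \<union> (\<Union>(i, j)\<in>?I. bad Pb Pa i j)"
  have "card ?X \<le> 2 * ((?n + 1) ^ 2 * 2 ^ (m - q))"
    using bnd[OF h] bnd[OF halves_sym[OF h]] card_Un_le[of "\<Union>(i, j)\<in>?I. bad Pa Pb i j" "\<Union>(i, j)\<in>?I. bad Pb Pa i j"]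
    by linarith
  \<comment> \<open>The base is \<open>U + 2 * m + 1\<close>, the number of possible end points; the
    assumption \<open>big\<close> has this form for the present estimate.\<close>
  also have "\<dots> = 2 * (length r + 8 * q + 2 * length mid + 5) ^ 2 * 2 ^ (m - q)" by simp
  also have "\<dots> < 2 ^ q * 2 ^ (m - q)" using big by (intro mult_strict_right_mono) auto
  also have "\<dots> = card (Pow {..<m})" by (simp add: card_Pow power_add[symmetric])
  finally have lt: "card ?X < card (Pow {..<m})" .
  have "?X \<noteq> Pow {..<m}"
  proof
    assume "?X = Pow {..<m}"
    then show False using lt by (simp only: less_irrefl)
  qed
  moreover have "?X \<subseteq> Pow {..<m}" by (auto simp: bad_def)
  ultimately obtain E where E: "E \<in> Pow {..<m}" "E \<notin> ?X" by blast
  have gd: "good P1 P2 E" if "E \<notin> (\<Union>(i, j)\<in>?I. bad P1 P2 i j)" for P1 P2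
    using that E(1) by (auto simp: good_def middle_def)
  have "E \<notin> (\<Union>(i, j)\<in>?I. bad Pa Pb i j)" "E \<notin> (\<Union>(i, j)\<in>?I. bad Pb Pa i j)"
    using E(2) unfolding Un_iff de_Morgan_disj by (rule conjunct1, rule conjunct2)
  then show ?thesis by (intro that[OF gd gd])
qed

section \<open>Short, initial and long segments\<close>

context
  fixes Pa Pb and E :: "nat set" assumes h: "halves Pa Pb"
begin

lemma coef_cases: "coef Pa Pb E a = 1 \<or> coef Pa Pb E a = -1"
  unfolding coef_def by (rule sgn_cases[OF carrier_word[OF h]])

lemma trivial_segment_dvd:
  assumes "i < j" "j \<le> U + 2 * m" "triv p (take (j - i) (drop i (word Pa Pb E)))"
  shows "p dvd (\<Sum>k\<in>{i..<j}. sgn (word Pa Pb E) k * fst (word Pa Pb E ! k))"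
    "p dvd comb (coef Pa Pb E) (seg Pa Pb E i j)"
proof -
  show 1: "p dvd (\<Sum>k\<in>{i..<j}. sgn (word Pa Pb E) k * fst (word Pa Pb E ! k))"
    using assms length_word[OF h, of E] by (intro segment_sum_dvd[OF carrier_word[OF h]]) auto
  have "(\<Sum>k\<in>{i..<j}. sgn (word Pa Pb E) k * fst (word Pa Pb E ! k)) = comb (coef Pa Pb E) (seg Pa Pb E i j)"
    unfolding coef_def seg_def
    by (rule segment_sum_comb[OF distinct_word[OF h]]) (use assms(2) length_word[OF h, of E] in simp)
  then show "p dvd comb (coef Pa Pb E) (seg Pa Pb E i j)" using 1 by simp
qed

text \<open>The contribution of \<open>r\<close> is rewritten over \<open>B\<close> by
  \<open>dep_span\<close>, within the coefficient bound that the independence of \<open>Q\<close>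
  allows.\<close>

lemma no_relation_over_span:
  assumes S: "S \<subseteq> Q \<union> set r" "S \<inter> Q \<noteq> {}" and c: "\<And>a. c a = 1 \<or> c a = -1"
  shows "\<not> p dvd comb c S"
proof
  assume d: "p dvd comb c S"
  have fS: "finite S" using S(1) Q(1) finite_subset by auto
  have "S = (S \<inter> Q) \<union> (S \<inter> set r)" using S(1) by blast
  then have "comb c S = comb c ((S \<inter> Q) \<union> (S \<inter> set r))" by simp
  also have "\<dots> = comb c (S \<inter> Q) + comb c (S \<inter> set r)"
    using fS disj(1) by (intro comb_union) auto
  finally have cS: "comb c S = comb c (S \<inter> Q) + comb c (S \<inter> set r)" .
  have "\<bar>c a\<bar> \<le> int 1" for a using c[of a] by auto
  then obtain d where dd: "\<forall>b\<in>B. \<bar>d b\<bar> \<le> int (1 * card (S \<inter> set r))" "p dvd comb c (S \<inter> set r) - comb d B"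
    using dep_span[of "S \<inter> set r" p B c 1] r(2) fS by blast
  have "p dvd (comb c (S \<inter> Q) + comb c (S \<inter> set r)) - (comb c (S \<inter> set r) - comb d B)"
    using d dd(2) unfolding cS by (rule dvd_diff)
  then have "p dvd comb c (S \<inter> Q) + comb d B" by (simp add: algebra_simps)
  moreover have "ind p 2 (2 * length r) B (S \<inter> Q)" using ind_subset[OF Q(2,1)] by blast
  moreover have "\<bar>d b\<bar> \<le> int (2 * length r)" if "b \<in> B" for b
  proof -
    have "card (S \<inter> set r) \<le> length r"
      by (meson List.finite_set card_length card_mono inf_le2 order_trans)
    then show ?thesis using dd(1) that by force
  qed
  moreover have "\<bar>c a\<bar> \<le> int 2" for a using c[of a] by auto
  moreover obtain a where "a \<in> S \<inter> Q" using S(2) by blast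
  ultimately have "c a = 0" by (intro indD[of p 2 "2 * length r" B "S \<inter> Q" c d])
  then show False using c[of a] by auto
qed

text \<open>A segment of the front that meets \<open>Q\<close> is excluded by independence over the
  span of \<open>r\<close>. One that avoids \<open>Q\<close> is the first letter of \<open>r\<close>
  alone or lies in the rest of \<open>r\<close>, hence is proper in \<open>r\<close>.\<close>

lemma prefix_segment:
  assumes ij: "i < j" "j \<le> U"
  shows "\<not> triv p (take (j - i) (drop i (word Pa Pb E)))"
proof
  let ?W = "word Pa Pb E"
  assume t: "triv p (take (j - i) (drop i ?W))"
  have sub: "seg Pa Pb E i j \<subseteq> Q \<union> set r"
    unfolding seg_def by (rule image_subsetI, rule word_prefix[OF h]) (use ij in auto)
  have noQ: "?W ! k \<notin> Q" if "i \<le> k" "k < j" for k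
  proof
    assume "?W ! k \<in> Q"
    moreover have "?W ! k \<in> seg Pa Pb E i j" unfolding seg_def using that by (intro imageI) simp
    ultimately have "seg Pa Pb E i j \<inter> Q \<noteq> {}" by blast
    then show False
      using no_relation_over_span[OF sub] coef_cases trivial_segment_dvd(2)[OF ij(1) _ t] ij(2) by force
  qed
  have eP: "els Pa \<subseteq> Q" using h by (auto simp: halves_def)
  have hd: "fst (hd Pa) \<in> Q" "snd (hd Pa) \<in> Q" using els_Pa[OF h] eP by auto
  have "?W ! 0 = fst (hd Pa)" by (simp add: word_def front_def)
  then have i1: "1 \<le> i" using noQ[of 0] hd ij by (cases i) auto
  obtain a r' where ar: "r = a # r'"
  proof (cases r)
    case Nil
    have "?W ! 1 = snd (hd Pa)" unfolding word_def front_def using Nil by simp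
    moreover have "i \<le> 1" "1 < j" using ij i1 Nil by simp_all
    ultimately have False using noQ[of 1] hd(2) by simp
    then show ?thesis ..
  qed auto
  have W: "?W = fst (hd Pa) # a # snd (hd Pa) # (r' @ pick E (pairs Pa Pb) @ pick (- E) (pairs Pa Pb))"
    unfolding word_def front_def using ar by simp
  have "?W ! 2 = snd (hd Pa)" unfolding W by simp
  then have "\<not> (i \<le> 2 \<and> 2 < j)" using noQ[of 2] hd(2) by metis
  then consider "i = 1" "j = 2" | "3 \<le> i" using i1 ij(1) by linarith
  then show False
  proof cases
    case 1
    then have "take (j - i) (drop i ?W) = [a]" unfolding W by simp
    then show False using t r(4)[of a] ar by simp
  next
    case 2
    have len: "j - 3 \<le> length r'" using ij(2) ar by simp
    have "drop i ?W = drop (i - 3) (r' @ pick E (pairs Pa Pb) @ pick (- E) (pairs Pa Pb))"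
      unfolding W using 2 by (simp add: numeral_3_eq_3 drop_Cons' eval_nat_numeral)
    then have "take (j - i) (drop i ?W) = take (j - i) (drop (i - 3) r')"
      using len 2 ij(1) by simp
    moreover have "sublist (take (j - i) (drop (i - 3) r')) r'"
      by (meson sublist_drop sublist_take sublist_order.order_trans)
    moreover have "sublist r' r" unfolding ar by (simp add: sublist_Cons_right)
    ultimately have sb: "sublist (take (j - i) (drop i ?W)) r" using sublist_order.order_trans by metis
    define v where "v = take (j - i) (drop i ?W)"
    have "length v = j - i" unfolding v_def using ij length_word[OF h, of E] by simp
    moreover have "j - i < length r" "0 < j - i" using ij 2 by auto
    ultimately have "v \<noteq> []" "v \<noteq> r" by auto
    then show False using t r(3) sb unfolding admissible_def v_def by blast
  qed
qed

text \<open>If the segment starts in the front, it reaches at most the first \<open>q\<close> pairs,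
  which lie in \<open>Q\<close>. Otherwise its elements belong to a single window.\<close>

lemma short_segment:
  assumes ij: "i < j" "U < j" "j \<le> U + 2 * m" and short: "(j - U) - (max i U - U) \<le> q"
  shows "\<not> triv p (take (j - i) (drop i (word Pa Pb E)))"
proof
  let ?W = "word Pa Pb E"
  assume t: "triv p (take (j - i) (drop i ?W))"
  note dvd = trivial_segment_dvd(2)[OF ij(1,3) t]
  show False
  proof (cases "i < U")
    case True
    then have jq: "j - U \<le> q" using short by simp
    have WQ: "?W ! k \<in> Q" if k: "U \<le> k" "k < j" for k
    proof -
      have "k < U + 2 * m" "(k - U) mod m < m" using k ij(3) by auto
      moreover have "(k - U) mod m = k - U" "k - U < 3 * q + 1" using k jq by auto
      ultimately show ?thesis
        using word_mem_both[OF h k(1), of E] pair_Q[OF h, of "(k - U) mod m"] by auto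
    qed
    have wk: "?W ! k \<in> Q \<union> set r" if "k < j" for k
      using word_prefix[OF h, of k E] WQ[of k] that by (cases "k < U") auto
    have "seg Pa Pb E i j \<subseteq> Q \<union> set r"
      unfolding seg_def by (rule image_subsetI, rule wk) simp
    moreover have "?W ! U \<in> seg Pa Pb E i j" unfolding seg_def using True ij(2) by (intro imageI) simp
    ultimately show False using no_relation_over_span[of "seg Pa Pb E i j"] WQ[of U] ij(2) coef_cases dvd by blast
  next
    case False
    let ?S = "\<Union>t\<in>win ((i - U) mod m). both Pa Pb t"
    have wk: "?W ! k \<in> ?S" if k: "i \<le> k" "k < j" for k
    proof -
      have "k - i < q" using short False k by (simp add: max_def)
      moreover have "k - U = (i - U) + (k - i)" using False k by linarith
      then have "(k - U) mod m = ((i - U) mod m + (k - i)) mod m" by (simp only: mod_add_left_eq)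
      ultimately have "(k - U) mod m \<in> win ((i - U) mod m)" by (auto simp: win_def)
      moreover have "?W ! k \<in> both Pa Pb ((k - U) mod m)"
        using word_mem_both[OF h, of k E] k False ij(3) by linarith
      ultimately show ?thesis by blast
    qed
    have sub: "seg Pa Pb E i j \<subseteq> ?S"
      unfolding seg_def by (rule image_subsetI, rule wk) simp_all
    have ne: "seg Pa Pb E i j \<noteq> {}" using ij(1) by (auto simp: seg_def)
    have fin: "finite ?S" by (auto simp: win_def both_def)
    have "diss p ?S" by (rule win_diss[OF h]) simp
    from ind_no_relation[OF this fin sub ne, of "coef Pa Pb E"] show False using coef_cases dvd by simp
  qed
qed

lemma trivial_segment_long:
  assumes E: "good Pa Pb E" and ij: "i < j" "j \<le> U + 2 * m"
    and t: "triv p (take (j - i) (drop i (word Pa Pb E)))"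
  shows "U < j" "2 * m - q < (j - U) - (max i U - U)"
proof -
  show Uj: "U < j" using prefix_segment[OF ij(1)] t by (meson not_less)
  have "\<not> (j - U) - (max i U - U) \<le> q" using short_segment[OF ij(1) Uj ij(2)] t by blast
  moreover have "\<not> middle i j"
    using E ij(1) trivial_segment_dvd(1)[OF ij t] unfolding good_def bad_def by blast
  ultimately show "2 * m - q < (j - U) - (max i U - U)" using Uj ij(2) unfolding middle_def by linarith
qed

text \<open>Fewer than \<open>q\<close> of the positions behind the front are missing. They lie at
  its two ends, where only pairs of \<open>Pa\<close> stand.\<close>

lemma long_segment_contains:
  assumes ij: "U < j" "j \<le> U + 2 * m" "2 * m - q < (j - U) - (max i U - U)"
  shows "els Pb \<union> els mid \<subseteq> seg Pa Pb E i j"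
proof -
  have pr: "both Pa Pb t \<subseteq> seg Pa Pb E i j" if t: "q \<le> t" "t < m - q" for t
  proof -
    have k: "U + t \<in> {i..<j}" "U + m + t \<in> {i..<j}" "t < m" using ij t by auto
    have "word Pa Pb E ! (U + t) \<in> seg Pa Pb E i j" "word Pa Pb E ! (U + m + t) \<in> seg Pa Pb E i j"
      unfolding seg_def by (rule imageI, rule k)+
    then show ?thesis unfolding word_pair[OF h k(3)] both_def by (cases "t \<in> E") simp_all
  qed
  have l: "length (take q (tl Pa)) = q" "length Pb = 2 * q + 1" using h by (auto simp: halves_def)
  have "els (Pb @ mid) \<subseteq> seg Pa Pb E i j"
  proof
    fix a assume "a \<in> els (Pb @ mid)"
    then obtain x where x: "x \<in> set (Pb @ mid)" "a \<in> {fst x, snd x}" unfolding els_def by blast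
    then obtain s where s: "s < length (Pb @ mid)" "(Pb @ mid) ! s = x" by (metis in_set_conv_nth)
    have "pairs Pa Pb ! (q + s) = ((Pb @ mid) @ drop q (tl Pa)) ! s"
      unfolding pairs_def using l(1) by (metis append_assoc nth_append_length_plus)
    then have "pairs Pa Pb ! (q + s) = x" using s by (metis nth_append)
    moreover have "q \<le> q + s" "q + s < m - q" using s(1) l(2) by auto
    ultimately show "a \<in> seg Pa Pb E i j" using pr[of "q + s"] x(2) unfolding both_def by blast
  qed
  then show ?thesis by simp
qed

text \<open>A proper segment misses the first or the last letter of the word, and both belong to
  \<open>Q\<close>.\<close>

lemma proper_segment_misses:
  assumes ij: "U < j" "j \<le> U + 2 * m" "(i, j) \<noteq> (0, U + 2 * m)"
  obtains a where "a \<in> Q" "a \<notin> seg Pa Pb E i j"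
proof -
  let ?W = "word Pa Pb E"
  have miss: "?W ! k \<notin> seg Pa Pb E i j" if "k < U + 2 * m" "k < i \<or> j \<le> k" for k
  proof
    assume "?W ! k \<in> seg Pa Pb E i j"
    then obtain k' where k': "k' \<in> {i..<j}" "?W ! k = ?W ! k'" by (auto simp: seg_def)
    then have "k = k'"
      using nth_eq_iff_index_eq[OF distinct_word[OF h, of E], of k k'] length_word[OF h, of E] that(1) ij(2) by simp
    then show False using k'(1) that(2) by auto
  qed
  show ?thesis
  proof (cases "i = 0")
    case True
    let ?k = "U + 2 * m - 1"
    have "(?k - U) mod m = m - 1" using mod_three[of "?k - U" m] by auto
    moreover have "?W ! ?k \<in> both Pa Pb ((?k - U) mod m)"
      by (rule word_mem_both[OF h]) auto
    ultimately have "?W ! ?k \<in> Q" using pair_Q[OF h, of "m - 1"] q by auto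
    moreover have "?W ! ?k \<notin> seg Pa Pb E i j" by (rule miss) (use ij True in auto)
    ultimately show ?thesis using that by blast
  next
    case False
    have "?W ! 0 = fst (hd Pa)" by (simp add: word_def front_def)
    then have "?W ! 0 \<in> Q" using els_Pa[OF h] h by (auto simp: halves_def)
    moreover have "?W ! 0 \<notin> seg Pa Pb E i j" by (rule miss) (use False in auto)
    ultimately show ?thesis using that by blast
  qed
qed

end

text \<open>The halves have equal length, so exchanging them leaves the positions of
  \<open>mid\<close> unchanged; bits and signs agree as well.\<close>

lemma coef_mid:
  assumes h: "halves Pa Pb" and a: "a \<in> els mid"
  shows "coef Pa Pb E a = coef Pb Pa E a"
proof -
  note h' = halves_sym[OF h]
  obtain x where x: "x \<in> set mid" "a \<in> {fst x, snd x}" using a unfolding els_def by blast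
  then obtain s where s: "s < length mid" "mid ! s = x" by (metis in_set_conv_nth)
  let ?t = "3 * q + 1 + s"
  have t: "3 * q + 1 \<le> ?t" "?t < m - q" "?t < m" using s(1) by auto
  have L: "pairs Pa Pb ! ?t = x" "pairs Pb Pa ! ?t = x"
    using pair_mid[OF h t(1,2)] pair_mid[OF h' t(1,2)] s by simp_all
  have "\<exists>k < U + 2 * m. word Pa Pb E ! k = a \<and> word Pb Pa E ! k = a"
  proof (cases "a = (if ?t \<in> E then fst x else snd x)")
    case True
    then show ?thesis using word_pair(1)[OF h t(3), of E] word_pair(1)[OF h' t(3), of E] L t(3)
      by (intro exI[of _ "U + ?t"]) simp
  next
    case False
    then have "a = (if ?t \<in> E then snd x else fst x)" using x(2) by (auto split: if_splits)
    then show ?thesis using word_pair(2)[OF h t(3), of E] word_pair(2)[OF h' t(3), of E] L t(3)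
      by (intro exI[of _ "U + m + ?t"]) simp
  qed
  then obtain k where k: "k < U + 2 * m" "word Pa Pb E ! k = a" "word Pb Pa E ! k = a" by blast
  then have "idx (word Pa Pb E) a = k" "idx (word Pb Pa E) a = k"
    using idx_nth[OF distinct_word[OF h]] idx_nth[OF distinct_word[OF h']] length_word[OF h] length_word[OF h'] by metis+
  moreover have "sgn (word Pa Pb E) k = sgn (word Pb Pa E) k"
    by (rule sgn_cong) (simp only: map_snd_word[OF h] map_snd_word[OF h'])
  ultimately show ?thesis by (simp add: coef_def)
qed

text \<open>A relation among all but a few elements determines, by independence of \<open>Q\<close>, which elements
  of \<open>Q\<close> are missing. In the two words these lie in different halves of \<open>Q\<close>.\<close>

lemma not_both_long:
  assumes h: "halves Pa Pb"
    and S: "S \<subseteq> Q \<union> set r \<union> els mid" "els Pb \<union> els mid \<subseteq> S" "p dvd comb (coef Pa Pb E) S"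
    and S': "S' \<subseteq> Q \<union> set r \<union> els mid" "els Pa \<union> els mid \<subseteq> S'" "p dvd comb (coef Pb Pa E) S'"
    and a: "a \<in> Q" "a \<notin> S"
  shows False
proof -
  note h' = halves_sym[OF h]
  let ?A = "Q \<union> set r \<union> els mid"
  have finA: "finite ?A" using Q(1) by simp
  define f where "f a = (if a \<in> S then coef Pa Pb E a else 0)" for a
  define f' where "f' a = (if a \<in> S' then coef Pb Pa E a else 0)" for a
  \<comment> \<open>The difference of two relations has coefficients up to \<open>2\<close>; hence
    the \<open>2\<close> in the independence of \<open>Q\<close>.\<close>
  define g where "g a = f a - f' a" for a
  have fb: "\<bar>f a\<bar> \<le> 1" "\<bar>f' a\<bar> \<le> 1" for a
    using coef_cases[OF h, of E a] coef_cases[OF h', of E a] by (auto simp: f_def f'_def)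
  then have gb: "\<bar>g a\<bar> \<le> int 2" for a using fb[of a] unfolding g_def by linarith
  have "comb f ?A = comb f S" using finA S(1) by (intro comb_mono_neutral) (auto simp: f_def)
  also have "\<dots> = comb (coef Pa Pb E) S" by (rule comb_cong) (simp add: f_def)
  finally have f: "p dvd comb f ?A" using S(3) by simp
  have "comb f' ?A = comb f' S'" using finA S'(1) by (intro comb_mono_neutral) (auto simp: f'_def)
  also have "\<dots> = comb (coef Pb Pa E) S'" by (rule comb_cong) (simp add: f'_def)
  finally have "p dvd comb f' ?A" using S'(3) by simp
  with f have "p dvd comb f ?A - comb f' ?A" by (rule dvd_diff)
  also have "comb f ?A - comb f' ?A = comb g ?A"
    unfolding comb_diff[symmetric] by (rule comb_cong) (simp add: g_def)
  also have "comb g ?A = comb g (Q \<union> set r)"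
  proof (rule comb_mono_neutral[OF finA])
    fix a assume "a \<in> ?A - (Q \<union> set r)"
    then have "a \<in> els mid" by blast
    then show "g a = 0" using S(2) S'(2) coef_mid[OF h] by (auto simp: g_def f_def f'_def)
  qed auto
  also have "\<dots> = comb g Q + comb g (set r)" using Q(1) disj(1) by (intro comb_union) auto
  finally have d: "p dvd comb g Q + comb g (set r)" .
  obtain d' where d': "\<forall>b\<in>B. \<bar>d' b\<bar> \<le> int (2 * card (set r))" "p dvd comb g (set r) - comb d' B"
    using dep_span[of "set r" p B g 2] r(2) gb by blast
  have "p dvd (comb g Q + comb g (set r)) - (comb g (set r) - comb d' B)" using d d'(2) by (rule dvd_diff)
  then have "p dvd comb g Q + comb d' B" by (simp add: algebra_simps)
  moreover have "\<bar>d' b\<bar> \<le> int (2 * length r)" if "b \<in> B" for b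
    using d'(1) that distinct_card[OF r(1)] by simp
  ultimately have "g a = 0" using gb a(1) by (intro indD[OF Q(2), of g d' a])
  \<comment> \<open>As \<open>a\<close> is missing in \<open>S\<close> it belongs to
    \<open>Pa\<close>, hence to \<open>S'\<close>. So \<open>g a\<close> is \<open>1\<close> or
    \<open>-1\<close>, a contradiction.\<close>
  moreover have "a \<in> S'"
  proof -
    have "a \<in> els Pa \<union> els Pb" using a(1) els_halves[OF h] by simp
    then show ?thesis using a(2) S(2) S'(2) by blast
  qed
  ultimately show False using a(2) coef_cases[OF h', of E a] by (auto simp: g_def f_def f'_def)
qed

theorem admissible_word:
  assumes h: "halves Pa Pb"
  shows "\<exists>l. distinct l \<and> set l = Q \<union> set r \<union> els mid \<and> admissible p l"
proof -
  note h' = halves_sym[OF h]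
  obtain E where E: "good Pa Pb E" "good Pb Pa E" by (rule exists_good[OF h])
  have "admissible p (word Pa Pb E) \<or> admissible p (word Pb Pa E)"
  proof (rule ccontr)
    assume n: "\<not> ?thesis"
    have ex: "\<exists>i j. i < j \<and> j \<le> U + 2 * m \<and> (i, j) \<noteq> (0, U + 2 * m) \<and>
        triv p (take (j - i) (drop i (word P1 P2 E)))" if "halves P1 P2" "\<not> admissible p (word P1 P2 E)" for P1 P2
      using that(2) admissible_by_segments[of "word P1 P2 E" p] length_word[OF that(1), of E] by auto
    obtain i j where ij: "i < j" "j \<le> U + 2 * m" "(i, j) \<noteq> (0, U + 2 * m)"
      "triv p (take (j - i) (drop i (word Pa Pb E)))" using ex[OF h] n by blast
    obtain i' j' where ij': "i' < j'" "j' \<le> U + 2 * m" "(i', j') \<noteq> (0, U + 2 * m)"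
      "triv p (take (j' - i') (drop i' (word Pb Pa E)))" using ex[OF h'] n by blast
    note l = trivial_segment_long[OF h E(1) ij(1,2,4)]
    note l' = trivial_segment_long[OF h' E(2) ij'(1,2,4)]
    have sub: "seg P1 P2 E i j \<subseteq> Q \<union> set r \<union> els mid" if "halves P1 P2" "j \<le> U + 2 * m" for P1 P2 i j
    proof -
      have "word P1 P2 E ! k \<in> set (word P1 P2 E)" if "k < j" for k
        using that \<open>j \<le> U + 2 * m\<close> length_word[OF \<open>halves P1 P2\<close>, of E] by simp
      then show ?thesis unfolding set_word[OF that(1), symmetric, of E] seg_def by (intro image_subsetI) simp
    qed
    obtain a where a: "a \<in> Q" "a \<notin> seg Pa Pb E i j"
      by (rule proper_segment_misses[OF h l(1) ij(2,3)])
    show False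
      by (rule not_both_long[OF h sub[OF h ij(2)] long_segment_contains[OF h l(1) ij(2) l(2)]
            trivial_segment_dvd(2)[OF h ij(1,2,4)]
            sub[OF h' ij'(2)] long_segment_contains[OF h' l'(1) ij'(2) l'(2)]
            trivial_segment_dvd(2)[OF h' ij'(1,2,4)] a])
  qed
  then show ?thesis using distinct_word set_word h h' by metis
qed

end

section \<open>Bounded sets modulo p\<close>

text \<open>With blocks of base size \<open>k = 24 * q ^ 2\<close> this gives
  \<open>(2 * k + 1) ^ (12 * q) < 2 ^ k\<close>, the counting condition for linking; that size is
  the product of \<open>12 * q\<close> and the \<open>2 * q\<close> bits of
  \<open>4 ^ q\<close>.\<close>

lemma quadratic_less_four_power: "10 \<le> q \<Longrightarrow> 48 * q ^ 2 + 1 < (4::nat) ^ q"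
proof (induction q rule: nat_induct_at_least)
  case base
  then show ?case by simp
next
  case (Suc q)
  have "Suc q ^ 2 \<le> 4 * q ^ 2" using Suc.hyps power_mono[of "Suc q" "2 * q" 2] by (simp add: power_mult_distrib)
  then show ?case using Suc.IH by simp
qed

context signed_group
begin

text \<open>If \<open>A\<close> has no large independent set then all of \<open>A\<close> can be dilated into a short interval;
  otherwise a large independent set in a single fibre supplies the set \<open>Q\<close>.\<close>

theorem admissible_of_bound:
  fixes l q d J s0 :: nat
  assumes ss: "strongly_sequenceable H" and fH: "finite (carrier H)"
    and A: "finite A" "snd ` A \<subseteq> carrier H" "(0, \<one>) \<notin> A" "fst ` A \<subseteq> {0..<p}"
    and p: "normalization_semidom_class.prime p" "2 < p"
    and l: "card A \<le> 2 ^ l" "1 \<le> l"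
    and q_def: "q = 10 * l"
    and d_def: "d = card (carrier H) * (24 * q ^ 2 + 2 * q) + (8 * q + 4)"
    and J_def: "J = d * q" and s0_def: "s0 = card (carrier H) * J"
    and bound: "int (4 * card A * s0 + 1) ^ s0 < p"
  shows "\<exists>w. distinct w \<and> set w = A \<and> admissible p w"
proof -
  let ?n = "card A" and ?h = "card (carrier H)"
  \<comment> \<open>\<open>?N\<close> is the size of \<open>Q\<close>, that is
    \<open>4 * q + 2\<close> pairs. The blocks have \<open>2 * q\<close> elements more than
    \<open>?base\<close>, as \<open>link_block\<close> demands. Then \<open>d\<close> bounds
    \<open>card B + ?N\<close>.\<close>
  let ?N = "8 * q + 4" and ?base = "24 * q ^ 2" and ?k = "24 * q ^ 2 + 2 * q"
  let ?T = "4 * card A * s0 + 1"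
  have q10: "10 \<le> q" using l(2) q_def by simp
  have h1: "1 \<le> ?h" using fH one_closed by (simp add: Suc_le_eq card_gt_0_iff) blast
  have Tpow: "int ?T ^ j < p" if "j \<le> s0" for j
  proof -
    have "int ?T ^ j \<le> int ?T ^ s0" using that by (intro power_increasing) auto
    then show ?thesis using bound by linarith
  qed
  obtain S where S: "S \<subseteq> A" "ind p 2 0 {} S" "\<And>a. a \<in> A \<Longrightarrow> dep p 2 (2 * 2) S (fst a)"
    by (rule maximal_ind[OF A(1), of 2 p]) auto
  have fS: "finite S" using S(1) A(1) finite_subset by blast
  show ?thesis
  proof (cases "card S < s0")
    case True
    have "?n * (2 * 2) * card S \<le> ?n * (2 * 2) * s0" using True by (intro mult_left_mono) auto
    moreover have "?n * (2 * 2) * s0 + 1 = ?T" by simp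
    ultimately have "?n * (2 * 2) * card S < ?T" by linarith
    moreover have "int ?T ^ card S < p" using Tpow True by simp
    ultimately show ?thesis
      using S(3) p(2) by (intro dep_admissible[OF ss A(1-3) p(1) _ _ A(4) fS, of 2 "2 * 2" ?T]) auto
  next
    case False
    have "\<exists>h\<in>carrier H. J \<le> card {a\<in>S. snd a = h}"
    proof (rule ccontr)
      assume "\<not> ?thesis"
      then have lt: "card {a\<in>S. snd a = h} < J" if "h \<in> carrier H" for h using that by (meson not_less)
      have "S = (\<Union>h\<in>carrier H. {a\<in>S. snd a = h})" using S(1) A(2) by auto
      then have "card S = card (\<Union>h\<in>carrier H. {a\<in>S. snd a = h})" by simp
      also have "\<dots> \<le> (\<Sum>h\<in>carrier H. card {a\<in>S. snd a = h})" by (rule card_UN_le[OF fH])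
      also have "\<dots> < (\<Sum>h\<in>carrier H. J)"
        using lt fH one_closed by (intro sum_strict_mono) auto
      finally show False using False s0_def by simp
    qed
    then obtain h where h: "h \<in> carrier H" "J \<le> card {a\<in>S. snd a = h}" by blast
    obtain Q1 where Q1: "Q1 \<subseteq> {a\<in>S. snd a = h}" "card Q1 = J" "finite Q1"
      using obtain_subset_with_card_n[OF h(2)] by metis
    have Q1A: "Q1 \<subseteq> A" "Q1 \<subseteq> S" "\<forall>a\<in>Q1. snd a = h" using Q1(1) S(1) by auto
    have iQ1: "ind p 2 0 {} Q1" using ind_subset[OF S(2) fS Q1A(2)] .
    have Jn: "J \<le> ?n" using card_mono[OF A(1) Q1A(1)] Q1(2) by simp
    have "finite (A - Q1)" "snd ` (A - Q1) \<subseteq> carrier H" "0 < ?k" using A q10 by auto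
    from extract_ind_blocks[OF this(1) fH this(2,3), of p]
    obtain Ds R B where X: "sorted_wrt (\<lambda>A B. A \<inter> B = {}) Ds"
      "\<forall>D\<in>set Ds. D \<subseteq> A - Q1 \<and> card D = ?k \<and> diss p D \<and> (\<exists>h. \<forall>a\<in>D. snd a = h)"
      "R \<subseteq> A - Q1" "A - Q1 = \<Union>(set Ds) \<union> R" "\<Union>(set Ds) \<inter> R = {}"
      "B \<subseteq> R" "card B \<le> ?h * ?k" "\<forall>a\<in>R. dep p 1 1 B (fst a)"
      by (elim exE conjE) (rule that)
    have fin: "finite R" "finite B" using X(3,6) A(1) by (meson finite_subset finite_Diff)+
    have RA: "R \<subseteq> A" using X(3) by blast
    have Rn: "card R \<le> ?n" using card_mono[OF A(1) RA] .
    have n1: "1 \<le> ?n"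
    proof -
      have "0 < J" using q10 by (simp add: J_def d_def)
      then show ?thesis using Jn by linarith
    qed
    \<comment> \<open>Both \<open>card A\<close> and \<open>J\<close> are at most
      \<open>2 ^ l\<close>, the latter because \<open>Q1\<close> lies in \<open>A\<close>. Raised to
      the power \<open>d\<close>, this is the counting condition for \<open>Q\<close>, which
      explains \<open>J = d * q\<close>.\<close>
    have small: "2 * (4 * ?n) * J + 1 < 2 ^ q"
    proof -
      have "2 * (4 * ?n) * J + 1 \<le> 8 * (2 ^ l * 2 ^ l) + 1"
        using mult_mono[OF l(1) order_trans[OF Jn l(1)]] by simp
      also have "\<dots> < 16 * (2 ^ l * 2 ^ l)" by (simp add: le_less_trans[of _ "2 ^ l * 2 ^ l"])
      also have "\<dots> = 2 ^ l * 2 ^ l * 2 ^ 4" by simp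
      also have "\<dots> = 2 ^ (l + l + 4)" by (simp only: power_add)
      also have "\<dots> \<le> 2 ^ q" using l(2) q_def by (intro power_increasing) auto
      finally show ?thesis .
    qed
    have "(2 * (4 * ?n) * J + 1) ^ d < (2 ^ q) ^ d"
      using small by (intro power_strict_mono) (auto simp: d_def)
    then have cnt: "(2 * (4 * ?n) * J + 1) ^ d < 2 ^ J" by (simp only: J_def mult.commute[of d q] power_mult)
    have "\<exists>C. C \<subseteq> Q1 \<and> card C = ?N \<and> C \<inter> (B \<union> {}) = {} \<and> ind p 2 (2 * card R) B ({} \<union> C)"
    proof (rule ind_extend[OF _ fin(2) _ Q1(3) _ iQ1])
      show "ind p 2 (2 * card R) B {}" by (simp add: ind_def)
      show "(2 * (4 * ?n) * J + 1) ^ d < 2 ^ J" by (rule cnt)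
      show "2 * (2 * card R) \<le> 4 * ?n" using Rn by simp
      show "card B + card {} + ?N \<le> d" using X(7) by (simp add: d_def)
    qed (use Q1(2) n1 in auto)
    then obtain Q where Q: "Q \<subseteq> Q1" "card Q = ?N" "ind p 2 (2 * card R) B Q" by auto
    have fQ: "finite Q" using Q(1) Q1(3) finite_subset by blast
    have dQ: "diss p Q" using ind_weaken[OF Q(3) fin(2), of "{}" 1 0] by simp
    \<comment> \<open>The rest of the large fibre set becomes one more block, so the list of blocks
      is not empty.\<close>
    let ?D0 = "Q1 - Q"
    have cD0: "card ?D0 = J - ?N" using card_Diff_subset[OF fQ Q(1)] Q(2) Q1(2) by simp
    have "ind p 1 0 {} Q1" using ind_weaken[OF iQ1, of "{}" 1 0] by simp
    then have D0: "diss p ?D0" using ind_subset[of p 1 0 "{}" Q1 ?D0] Q1(3) by blast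
    have kJ: "?k + ?N \<le> J"
    proof -
      have "?k \<le> ?h * ?k" using mult_le_mono1[OF h1, of ?k] by (simp only: mult_1)
      then have "?k + ?N \<le> d" unfolding d_def by (rule add_right_mono)
      also have "\<dots> \<le> J" using q10 by (simp add: J_def)
      finally show ?thesis .
    qed
    \<comment> \<open>Blocks are cut into pairs, so their sizes must be even.\<close>
    have evJ: "even J" by (simp add: J_def q_def)
    have blocks: "finite D \<and> diss p D \<and> (\<exists>h. \<forall>a\<in>D. snd a = h) \<and> even (card D) \<and> ?base + 2 * q \<le> card D"
      if "D \<in> set (?D0 # Ds)" for D
    proof (cases "D = ?D0")
      case True
      have "even (J - ?N)" using evJ kJ by simp
      then show ?thesis using True D0 Q1(3) Q1A(3) cD0 kJ by auto
    next
      case False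
      then have D: "D \<subseteq> A - Q1" "card D = ?k" "diss p D" "\<exists>h. \<forall>a\<in>D. snd a = h" using that X(2) by auto
      moreover have "finite D" using D(1) A(1) by (meson finite_subset finite_Diff)
      ultimately show ?thesis by simp
    qed
    have srt: "sorted_wrt (\<lambda>A B. A \<inter> B = {}) (?D0 # Ds)" using X(1,2) by auto
    have lk: "(2 * ?base + 1) ^ (?N + 2 * q) < 2 ^ ?base"
    proof -
      have "(2 * ?base + 1) ^ (?N + 2 * q) \<le> (2 * ?base + 1) ^ (12 * q)"
        using q10 by (intro power_increasing) auto
      also have "\<dots> < (4 ^ q) ^ (12 * q)"
        using quadratic_less_four_power[OF q10] q10 by (intro power_strict_mono) auto
      also have "\<dots> = (2 ^ (2 * q)) ^ (12 * q)" by (simp add: power_mult)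
      also have "\<dots> = 2 ^ ?base" unfolding power_mult[symmetric]
        by (rule arg_cong[of _ _ "\<lambda>n. 2 ^ n"]) (simp add: power2_eq_square)
      finally show ?thesis .
    qed
    have "2 * q \<le> ?base" using q10 by (simp add: power2_eq_square)
    moreover have "2 * q \<le> ?N" by simp
    ultimately obtain mid where mid: "distinct (flat mid)" "els mid = \<Union>(set (?D0 # Ds))" "same_fibre mid"
      "q \<le> length mid" "diss p (Q \<union> els (take q mid))" "diss p (Q \<union> els (drop (length mid - q) mid))"
      "\<forall>i. diss p (els (take q (drop i mid)))"
      using link_blocks[OF _ blocks srt _ fQ dQ _ _ lk] Q(2) by auto
    have s0B: "card B \<le> s0"
    proof -
      have "?h * ?k \<le> ?h * J" using kJ by (intro mult_left_mono) auto
      then show ?thesis using X(7) unfolding s0_def by (rule order_trans[rotated])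
    qed
    have "\<exists>r. distinct r \<and> set r = R \<and> admissible p r"
    proof (rule dep_admissible[OF ss fin(1) _ _ p(1) _ _ _ fin(2)])
      show "snd ` R \<subseteq> carrier H" "(0, \<one>) \<notin> R" "fst ` R \<subseteq> {0..<p}" using RA A by auto
      show "\<And>a. a \<in> R \<Longrightarrow> dep p 1 1 B (fst a)" using X(8) by blast
      have "card R * 1 * card B \<le> ?n * s0" using Rn s0B by (simp add: mult_mono)
      then show "card R * 1 * card B < ?T" by simp
      show "int ?T ^ card B < p" using Tpow[OF s0B] .
    qed (use p(2) in auto)
    then obtain r where r: "distinct r" "set r = R" "admissible p r" by blast
    have lr: "length r = card R" using distinct_card[OF r(1)] r(2) by simp
    have "card Q = 2 * (4 * q + 2)" using Q(2) by simp
    then obtain ps where ps: "length ps = 4 * q + 2" "distinct (flat ps)" "els ps = Q"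
      using pairing[OF fQ, of "4 * q + 2" h] Q1A(3) Q(1) by blast
    have disj: "Q \<inter> R = {}" "Q \<inter> els mid = {}" "R \<inter> els mid = {}" using Q(1) X(2,3,5) mid(2) Q1A by auto
    have mA: "els mid \<subseteq> A" using mid(2) X(2) Q1A(1) by auto
    have AQ: "A = Q \<union> R \<union> els mid" using X(4) mid(2) Q(1) Q1A(1) by auto
    have total: "?n = ?N + card R + 2 * length mid"
      unfolding AQ using disj fQ fin(1) Q(2) card_els[OF mid(1)]
      by (simp add: card_Un_disjoint Int_Un_distrib2)
    have big: "2 * (length r + 8 * q + 2 * length mid + 5) ^ 2 < 2 ^ q"
    proof -
      have "length r + 8 * q + 2 * length mid + 5 = ?n + 1" using total lr by simp
      also have "\<dots> \<le> 2 * 2 ^ l" using l(1) n1 by simp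
      finally have "2 * (length r + 8 * q + 2 * length mid + 5) ^ 2 \<le> 2 * (2 * 2 ^ l) ^ 2"
        by (intro mult_left_mono power_mono) auto
      also have "\<dots> = 2 ^ 3 * (2 ^ l * 2 ^ l)" by (simp add: power2_eq_square)
      also have "\<dots> = 2 ^ (3 + (l + l))" by (simp only: power_add)
      also have "\<dots> < 2 ^ q" using l(2) q_def by (intro power_strict_increasing) auto
      finally show ?thesis .
    qed
    have AQr: "Q \<union> set r \<union> els mid = A" unfolding r(2) by (rule AQ[symmetric])
    interpret word_setup H e p q r mid Q B h
    proof (unfold_locales)
      show "0 < q" "finite Q" "finite B" "h \<in> carrier H" using q10 fQ fin(2) h(1) by auto
      show "ind p 2 (2 * length r) B Q" using Q(3) lr by simp
      show "\<And>a. a \<in> Q \<Longrightarrow> snd a = h" using Q(1) Q1A(3) by blast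
      show "distinct r" "admissible p r" by (rule r)+
      show "\<And>a. a \<in> set r \<Longrightarrow> dep p 1 1 B (fst a)" using X(8) r(2) by blast
      show "\<not> triv p [a]" if a: "a \<in> set r" for a
      proof
        assume t: "triv p [a]"
        have aA: "a \<in> A" using a r(2) RA by blast
        then have "snd a = \<one>" using t A(2) by (auto simp: triv_def)
        moreover have "p dvd fst a" using t by (simp add: triv_def)
        moreover have "fst a \<in> {0..<p}" using aA A(4) by blast
        ultimately have "a = (0, \<one>)" using zdvd_imp_le[of p "fst a"] by (cases a) force
        then show False using aA A(3) by simp
      qed
      show "snd ` set r \<subseteq> carrier H" using r(2) RA A(2) by blast
      show "snd ` els mid \<subseteq> carrier H" using mA A(2) by blast
      show "Q \<inter> set r = {}" "set r \<inter> els mid = {}" using disj r(2) by auto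
    qed (use mid disj big in auto)
    have ft: "distinct (flat (take (2 * q + 1) ps @ drop (2 * q + 1) ps))"
      "els (take (2 * q + 1) ps @ drop (2 * q + 1) ps) = Q"
      using ps by (simp_all only: append_take_drop_id)
    have hv: "halves (take (2 * q + 1) ps) (drop (2 * q + 1) ps)"
      unfolding halves_def using ps(1) ft by auto
    show ?thesis using admissible_word[OF hv] unfolding AQr .
  qed
qed

end

section \<open>Actions by signs and the return to sequencings\<close>

locale neg_action = comm_group H for H :: "('h, 'm) monoid_scheme" (structure) +
  fixes p :: nat and \<phi> :: "'h \<Rightarrow> int \<Rightarrow> int"
  assumes p: "2 < p"
    and hom: "\<phi> \<in> hom H (AutoGroup (integer_mod_group p))"
    and phi: "\<forall>h\<in>carrier H. \<phi> h \<in> {id_aut (integer_mod_group p), neg_id_aut (integer_mod_group p)}"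
begin

abbreviation Z where "Z \<equiv> integer_mod_group p"

definition sg :: "'h \<Rightarrow> int" where "sg h = (if \<phi> h = id_aut Z then 1 else -1)"

lemma carrier_Z: "carrier Z = {0..<int p}"
  using p by (simp add: carrier_integer_mod_group)

lemma phi_apply: "h \<in> carrier H \<Longrightarrow> x \<in> {0..<int p} \<Longrightarrow> \<phi> h x = (sg h * x) mod int p"
  using phi carrier_Z by (force simp: sg_def id_aut_def neg_id_aut_def)

text \<open>Evaluation at \<open>1\<close> gives the identity modulo \<open>p\<close>; both sides
  are signs, so they differ by at most \<open>2 < p\<close>.\<close>

lemma sg_mult:
  assumes "g \<in> carrier H" "h \<in> carrier H"
  shows "sg (g \<otimes> h) = sg g * sg h"
proof -
  have B: "\<phi> g \<in> Bij (carrier Z)" "\<phi> h \<in> Bij (carrier Z)"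
    using hom assms by (auto simp: hom_def AutoGroup_def auto_def Pi_iff)
  have "\<phi> (g \<otimes> h) = compose (carrier Z) (\<phi> g) (\<phi> h)"
    using hom assms B by (simp add: hom_def AutoGroup_def BijGroup_def)
  then have "\<phi> (g \<otimes> h) 1 = \<phi> g (\<phi> h 1)" using p by (simp add: compose_def carrier_Z)
  moreover have "\<phi> h 1 \<in> {0..<int p}" using phi_apply[of h 1] assms p by simp
  ultimately have "(sg (g \<otimes> h) * 1) mod int p = (sg g * ((sg h * 1) mod int p)) mod int p"
    using phi_apply[of "g \<otimes> h" 1] phi_apply[of g "\<phi> h 1"] phi_apply[of h 1] assms p by simp
  then have "sg (g \<otimes> h) mod int p = (sg g * sg h) mod int p" by (simp add: mod_mult_right_eq)
  then have "int p dvd sg (g \<otimes> h) - sg g * sg h" by (simp add: mod_eq_dvd_iff)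
  moreover have "\<bar>sg (g \<otimes> h) - sg g * sg h\<bar> \<le> 2" by (simp add: sg_def)
  ultimately show ?thesis using p zdvd_imp_le[of "int p" "\<bar>sg (g \<otimes> h) - sg g * sg h\<bar>"] by fastforce
qed

sublocale signed_group H sg
proof unfold_locales
  show "sg h = 1 \<or> sg h = -1" for h by (simp add: sg_def)
qed (rule sg_mult)

abbreviation G where "G \<equiv> semidirect_product Z \<phi> H"

lemma foldr_semidirect:
  assumes "set l \<subseteq> carrier G"
  shows "foldr (\<otimes>\<^bsub>G\<^esub>) l \<one>\<^bsub>G\<^esub> = (xc l mod int p, hp l)"
  using assms
proof (induction l)
  case Nil
  then show ?case by (simp add: semidirect_product_def)
next
  case (Cons a l)
  have a: "fst a \<in> {0..<int p}" "snd a \<in> carrier H"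
    using Cons.prems by (auto simp: semidirect_product_def carrier_Z)
  have "xc l mod int p \<in> {0..<int p}" using p by simp
  from phi_apply[OF a(2) this] have "\<phi> (snd a) (xc l mod int p) = (sg (snd a) * xc l) mod int p"
    by (simp add: mod_mult_right_eq)
  then show ?case using Cons by (simp add: semidirect_product_def case_prod_beta mod_add_right_eq)
qed

text \<open>Two equal partial products enclose a trivial segment. Position \<open>0\<close> stands
  for the identity, and only the pair \<open>(0, length l)\<close> is exempt.\<close>

lemma sequencing_of_admissible:
  assumes A: "A \<subseteq> carrier G" and l: "distinct l" "set l = A" "admissible (int p) l"
  shows "sequencing G A l"
proof -
  have cG: "carrier G = {0..<int p} \<times> carrier H" by (simp add: semidirect_product_def carrier_Z)
  have car: "snd ` set l \<subseteq> carrier H" using A l(2) by (auto simp: cG)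
  have n: "card A = length l" using l(1,2) distinct_card by fastforce
  have pp: "partial_product G l i = (xc (take i l) mod int p, hp (take i l))" for i
    unfolding partial_product_def
    by (rule foldr_semidirect) (use A l(2) set_take_subset[of i l] in auto)
  have ne: "partial_product G l i \<noteq> partial_product G l j" if ij: "i < j" "j \<le> length l" "(i, j) \<noteq> (0, length l)" for i j
  proof
    assume eq: "partial_product G l i = partial_product G l j"
    let ?v = "take (j - i) (drop i l)"
    have tk: "take j l = take i l @ ?v" using ij(1) by (metis le_add_diff_inverse less_imp_le take_add)
    have c: "snd ` set (take i l) \<subseteq> carrier H" using car set_take_subset[of i l] by blast
    have sub: "sublist ?v l" by (meson sublist_drop sublist_take sublist_order.order_trans)
    have cv: "snd ` set ?v \<subseteq> carrier H" using carr_sublist[OF sub car] .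
    have "hp (take i l) \<otimes> hp ?v = hp (take i l) \<otimes> \<one>"
      using eq hp_append[OF c cv] c by (simp add: pp tk)
    then have h1: "hp ?v = \<one>" using c cv by (simp only: l_cancel hp_closed one_closed)
    have "int p dvd xc (take j l) - xc (take i l)" using eq by (simp add: pp mod_eq_dvd_iff[symmetric])
    then have "int p dvd sg (hp (take i l)) * xc ?v" unfolding tk xc_append[OF c] by simp
    then have "int p dvd xc ?v" using e_cases[OF hp_closed[OF c]] by auto
    then have "triv (int p) ?v" using h1 by (simp add: triv_def)
    moreover have "v \<noteq> []" "v \<noteq> l" if "length v = j - i" for v using that ij by auto
    then have "?v \<noteq> []" "?v \<noteq> l" using ij by simp_all
    ultimately show False using l(3) sub unfolding admissible_def by blast
  qed
  have "inj_on (partial_product G l) {1..card A}"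
  proof (rule inj_onI)
    fix i j assume ij: "i \<in> {1..card A}" "j \<in> {1..card A}" "partial_product G l i = partial_product G l j"
    then show "i = j" using ne[of i j] ne[of j i] n by (cases i j rule: linorder_cases) auto
  qed
  moreover have "\<forall>i\<in>{1..card A - 1}. partial_product G l i \<noteq> \<one>\<^bsub>G\<^esub>"
  proof
    fix i assume "i \<in> {1..card A - 1}"
    then have "1 \<le> i" "i \<le> length l - 1" unfolding n by simp_all
    then have i: "0 < i" "i \<le> length l" "i \<noteq> length l" by linarith+
    have "(0, i) \<noteq> (0, length l)" using i(3) by simp
    from ne[OF i(1,2) this] have "partial_product G l i \<noteq> partial_product G l 0" by (rule not_sym)
    then show "partial_product G l i \<noteq> \<one>\<^bsub>G\<^esub>" unfolding partial_product_def by simp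
  qed
  ultimately show ?thesis
    using l(1,2) unfolding sequencing_def valid_ordering_def ordering_of_def by blast
qed

end

section \<open>Choice of the constant and conclusion\<close>

lemma ln_2_ge_half: "1 / 2 \<le> ln (2::real)"
  using ln_le_minus_one[of "1/2::real"] by (simp add: ln_div)

lemma log2_ceiling:
  fixes n :: nat
  assumes "2 \<le> n"
  obtains l :: nat where "n \<le> 2 ^ l" "1 \<le> l" "real l \<le> 4 * ln (real n)"
proof -
  define L where "L = ln (real n)"
  note ln2 = ln_2_ge_half
  have L: "ln 2 \<le> L" using assms by (simp add: L_def)
  define l where "l = nat \<lceil>L / ln 2\<rceil>"
  have q1: "1 \<le> L / ln 2" using L ln2 by (simp add: le_divide_eq)
  have lge: "L / ln 2 \<le> real l" unfolding l_def using q1 by linarith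
  have "L \<le> real l * ln 2" using lge ln2 by (simp add: divide_le_eq)
  then have "ln (real n) \<le> ln (2 ^ l)" by (simp add: L_def ln_realpow)
  then have "real n \<le> 2 ^ l" using assms by simp
  then have "n \<le> 2 ^ l" by (metis of_nat_le_iff of_nat_numeral of_nat_power)
  moreover have "1 \<le> l" using lge q1 by linarith
  moreover have "real l \<le> 4 * ln (real n)"
  proof -
    have "real l \<le> L / ln 2 + 1" unfolding l_def using q1 by linarith
    also have "\<dots> \<le> 2 * (L / ln 2)" using q1 by linarith
    also have "\<dots> \<le> 2 * (L / (1 / 2))" using L ln2 by (intro mult_left_mono divide_left_mono) auto
    finally show ?thesis by (simp add: L_def)
  qed
  ultimately show ?thesis using that by blast
qed

text \<open>The number \<open>s0\<close> of \<open>admissible_of_bound\<close> for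
  \<open>q = 10 * l\<close> and a group \<open>H\<close> of order \<open>h\<close>; it grows like
  \<open>l ^ 3\<close>.\<close>

definition dim_bound :: "nat \<Rightarrow> nat \<Rightarrow> nat"
  where "dim_bound h l = h * ((h * (24 * (10 * l) ^ 2 + 2 * (10 * l)) + (8 * (10 * l) + 4)) * (10 * l))"

lemma parameter_bound:
  fixes h :: nat
  assumes h: "1 \<le> h"
  obtains c :: real where "0 < c"
    "\<And>(p::nat) n l. 2 \<le> n \<Longrightarrow> 1 < p \<Longrightarrow> real n \<le> exp (c * ln (real p) powr (1 / 4)) \<Longrightarrow>
      real l \<le> 4 * ln (real n) \<Longrightarrow> 1 \<le> l \<Longrightarrow>
      (4 * n * dim_bound h l + 1) ^ dim_bound h l < p"
proof -
  \<comment> \<open>\<open>a\<close> collects the factors \<open>h\<close>, \<open>4000 * h\<close>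
    and \<open>10\<close> of the estimate of \<open>dim_bound h l\<close> by
    \<open>a * l ^ 3\<close>.\<close>
  define a where "a = 40000 * real h ^ 2"
  have a1: "40000 \<le> a" using h unfolding a_def by simp
  \<comment> \<open>The product of the constants in the bounds for \<open>s\<close> by
    \<open>L ^ 3\<close> and for \<open>ln ?T\<close> by \<open>L\<close>, where
    \<open>L = ln n\<close>.\<close>
  define C where "C = 64 * a * (2 * (8 + a) + 13)"
  have C0: "0 < C" using a1 by (simp add: C_def)
  define c where "c = 1 / (C + 1)"
  have c: "0 < c" "c \<le> 1" using C0 by (auto simp: c_def)
  have cC: "c ^ 4 * C < 1"
  proof -
    have "c ^ 4 \<le> c ^ 1" using c by (intro power_decreasing) auto
    then have "c ^ 4 * C \<le> c * C" using C0 by (intro mult_right_mono) auto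
    also have "\<dots> < 1" using C0 by (simp add: c_def)
    finally show ?thesis .
  qed
  have "(4 * n * s + 1) ^ s < p"
    if n: "2 \<le> n" and p: "1 < p" and np: "real n \<le> exp (c * ln (real p) powr (1 / 4))"
      and l: "real l \<le> 4 * ln (real n)" "1 \<le> l"
      and s: "s = dim_bound h l"
    for p n l s :: nat
  proof -
    note s_def = s[unfolded dim_bound_def]
    define L where "L = ln (real n)"
    have "ln 2 \<le> L" using n by (simp add: L_def)
    then have L: "1 / 2 \<le> L" using ln_2_ge_half by linarith
    have lnp: "0 < ln (real p)" using p by simp
    have "(h * (24 * (10 * l) ^ 2 + 2 * (10 * l)) + (8 * (10 * l) + 4)) \<le> h * (4000 * l ^ 2)"
    proof -
      have "l \<le> l ^ 2" "1 \<le> l ^ 2" using l(2) by (simp_all add: power2_eq_square)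
      then have "24 * (10 * l) ^ 2 + 2 * (10 * l) + (8 * (10 * l) + 4) \<le> 4000 * l ^ 2"
        by (simp add: power_mult_distrib)
      then have 1: "h * (24 * (10 * l) ^ 2 + 2 * (10 * l) + (8 * (10 * l) + 4)) \<le> h * (4000 * l ^ 2)"
        by (rule mult_le_mono2)
      have "1 * (8 * (10 * l) + 4) \<le> h * (8 * (10 * l) + 4)" using h by (rule mult_le_mono1)
      then show ?thesis using 1 by (simp add: distrib_left)
    qed
    then have "s \<le> h * (h * (4000 * l ^ 2) * (10 * l))" unfolding s_def by (intro mult_le_mono2 mult_le_mono1)
    then have "real s \<le> real (h * (h * (4000 * l ^ 2) * (10 * l)))" by (simp only: of_nat_le_iff)
    also have "\<dots> = a * real l ^ 3" by (simp add: a_def power2_eq_square power3_eq_cube)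
    finally have sa: "real s \<le> a * real l ^ 3" .
    have l3: "real l ^ 3 \<le> (4 * L) ^ 3" using l(1) by (intro power_mono) (auto simp: L_def)
    have "a * real l ^ 3 \<le> a * (4 * L) ^ 3" using l3 a1 by (intro mult_left_mono) auto
    then have sL: "real s \<le> 64 * a * L ^ 3" using sa by (simp add: power_mult_distrib)
    have s1: "1 \<le> s" using h l(2) by (simp add: s_def)
    let ?T = "4 * real n * real s + 1"
    have lnT: "ln ?T \<le> (2 * (8 + a) + 13) * L"
    proof -
      have "1 \<le> real n * real s" using n s1 by (simp add: mult_ge1_I)
      then have "?T \<le> 8 * real n * real s" by linarith
      also have "\<dots> \<le> 8 * real n * (a * real l ^ 3)" using sa by (intro mult_left_mono) auto
      finally have "ln ?T \<le> ln (8 * real n * (a * real l ^ 3))"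
        using n s1 by (intro ln_mono) (auto intro!: add_nonneg_pos)
      also have "\<dots> = ln 8 + L + (ln a + 3 * ln (real l))"
        using n a1 l(2) by (simp add: ln_mult ln_realpow L_def)
      also have "\<dots> \<le> 8 + L + (a + 3 * real l)"
      proof -
        have "ln (8::real) < 8" "ln a < a" "ln (real l) < real l"
          using a1 l(2) by (intro ln_less_self, simp)+
        then show ?thesis by linarith
      qed
      also have "\<dots> \<le> (8 + a) + 13 * L" using l(1) by (simp add: L_def)
      also have "\<dots> \<le> (8 + a) * (2 * L) + 13 * L"
        using mult_left_mono[of 1 "2 * L" "8 + a"] L a1 by simp
      finally show ?thesis by (simp add: algebra_simps)
    qed
    have "real s * ln ?T \<le> (64 * a * L ^ 3) * ((2 * (8 + a) + 13) * L)"
      using sL lnT a1 L n s1 by (intro mult_mono) (auto intro!: ln_ge_zero)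
    also have "\<dots> = C * L ^ 4" by (simp add: C_def power4_eq_xxxx power3_eq_cube)
    also have "L ^ 4 \<le> c ^ 4 * ln (real p)"
    proof -
      have "L \<le> c * ln (real p) powr (1 / 4)"
        using np n unfolding L_def by (metis ln_exp ln_mono of_nat_0_less_iff order_less_le_trans pos2)
      then have "L ^ 4 \<le> (c * ln (real p) powr (1 / 4)) ^ 4" using L by (intro power_mono) auto
      also have "\<dots> = c ^ 4 * ln (real p)"
        using lnp by (simp add: power_mult_distrib powr_power)
      finally show ?thesis .
    qed
    then have "C * L ^ 4 \<le> C * (c ^ 4 * ln (real p))" using C0 by (intro mult_left_mono) auto
    also have "\<dots> = (c ^ 4 * C) * ln (real p)" by simp
    also have "\<dots> < 1 * ln (real p)" using cC lnp by (intro mult_strict_right_mono)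
    finally have "real s * ln ?T < ln (real p)" by simp
    moreover have T0: "0 < ?T" by (intro add_nonneg_pos) auto
    ultimately have "ln (?T ^ s) < ln (real p)" by (simp add: ln_realpow)
    then have "?T ^ s < real p" using p T0 by (subst (asm) ln_less_cancel_iff) auto
    then have "real ((4 * n * s + 1) ^ s) < real p" by (simp add: add.commute)
    then show ?thesis by (simp only: of_nat_less_iff)
  qed
  then show ?thesis using that[OF c(1)] by blast
qed

theorem theorem1p3:
  fixes H :: "('h, 'm) monoid_scheme"
  assumes "comm_group H"
    and "finite (carrier H)"
    and "strongly_sequenceable H"
  shows "\<exists>c::real. c > 0 \<and>
    (\<forall>(p::nat) \<phi> A.
      normalization_semidom_class.prime p \<longrightarrow>
      \<phi> \<in> hom H (AutoGroup (integer_mod_group p)) \<longrightarrow>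
      (\<forall>h\<in>carrier H. \<phi> h \<in> {id_aut (integer_mod_group p), neg_id_aut (integer_mod_group p)}) \<longrightarrow>
      A \<subseteq> carrier (semidirect_product (integer_mod_group p) \<phi> H)
            - {\<one>\<^bsub>semidirect_product (integer_mod_group p) \<phi> H\<^esub>} \<longrightarrow>
      real (card A) \<le> exp (c * ln (real p) powr (1 / 4)) \<longrightarrow>
      sequenceable (semidirect_product (integer_mod_group p) \<phi> H) A)"
proof -
  interpret comm_group H by fact
  let ?h = "card (carrier H)"
  have "1 \<le> ?h" using assms(2) one_closed by (simp add: Suc_le_eq card_gt_0_iff) blast
  then obtain c :: real where c: "0 < c"
    "\<And>(p::nat) n l. 2 \<le> n \<Longrightarrow> 1 < p \<Longrightarrow> real n \<le> exp (c * ln (real p) powr (1 / 4)) \<Longrightarrow>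
      real l \<le> 4 * ln (real n) \<Longrightarrow> 1 \<le> l \<Longrightarrow>
      (4 * n * dim_bound ?h l + 1) ^ dim_bound ?h l < p"
    using parameter_bound by blast
  have "sequenceable (semidirect_product (integer_mod_group p) \<phi> H) A"
    if p: "normalization_semidom_class.prime p"
      and phi: "\<phi> \<in> hom H (AutoGroup (integer_mod_group p))"
        "\<forall>h\<in>carrier H. \<phi> h \<in> {id_aut (integer_mod_group p), neg_id_aut (integer_mod_group p)}"
      and A: "A \<subseteq> carrier (semidirect_product (integer_mod_group p) \<phi> H)
            - {\<one>\<^bsub>semidirect_product (integer_mod_group p) \<phi> H\<^esub>}"
      and cardA: "real (card A) \<le> exp (c * ln (real p) powr (1 / 4))"
    for p :: nat and \<phi> A
  proof -
    let ?G = "semidirect_product (integer_mod_group p) \<phi> H"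
    have prime_int: "normalization_semidom_class.prime (int p)" using p by simp
    have p0: "1 < p" using p by (rule prime_gt_1_nat)
    have cG: "carrier ?G = {0..<int p} \<times> carrier H"
      using p0 by (simp add: semidirect_product_def carrier_integer_mod_group)
    have finA: "finite A" using A assms(2) cG by (auto intro: finite_subset)
    show ?thesis
    proof (cases "card A \<le> 1")
      case True
      obtain l where l: "distinct l" "set l = A" using finite_distinct_list finA by blast
      have "inj_on f {1..card A}" for f :: "nat \<Rightarrow> int \<times> 'h" using True by (auto simp: inj_on_def)
      then have "sequencing ?G A l"
        using l True by (auto simp: sequencing_def valid_ordering_def ordering_of_def)
      then show ?thesis by (auto simp: sequenceable_def)
    next
      case False
      then have n: "2 \<le> card A" by simp
      obtain l :: nat where l: "card A \<le> 2 ^ l" "1 \<le> l" "real l \<le> 4 * ln (real (card A))"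
        by (rule log2_ceiling[OF n])
      let ?s = "?h * ((?h * (24 * (10 * l) ^ 2 + 2 * (10 * l)) + (8 * (10 * l) + 4)) * (10 * l))"
      have b: "(4 * card A * ?s + 1) ^ ?s < p"
        using c(2)[OF n p0 cardA l(3,2)] unfolding dim_bound_def .
      \<comment> \<open>The size condition itself excludes \<open>p = 2\<close>, where
        \<open>id\<close> and \<open>-id\<close> coincide.\<close>
      have "1 \<le> ?s" using \<open>1 \<le> ?h\<close> l(2) by simp
      have "2 * 1 \<le> card A * ?s" using n \<open>1 \<le> ?s\<close> by (rule mult_le_mono)
      then have "2 < 4 * card A * ?s + 1" unfolding mult.assoc[of 4 "card A" ?s] by linarith
      also have "\<dots> \<le> (4 * card A * ?s + 1) ^ ?s" using \<open>1 \<le> ?s\<close> by (intro self_le_power) auto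
      finally have p2: "2 < p" using b by linarith
      interpret neg_action H p \<phi>
        by unfold_locales (use p2 phi in auto)
      have "\<exists>w. distinct w \<and> set w = A \<and> admissible (int p) w"
      proof (rule admissible_of_bound[OF assms(3,2) finA _ _ _ _ _ l(1,2) refl refl refl refl])
        show "snd ` A \<subseteq> carrier H" "fst ` A \<subseteq> {0..<int p}" using A cG by auto
        show "(0, \<one>\<^bsub>H\<^esub>) \<notin> A" using A by (auto simp: semidirect_product_def)
        show "normalization_semidom_class.prime (int p)" by (rule prime_int)
        show "2 < int p" using p2 by simp
        show "int (4 * card A * ?s + 1) ^ ?s < int p" using b by (metis of_nat_less_iff of_nat_power)
      qed
      then obtain w where "distinct w" "set w = A" "admissible (int p) w" by blast
      then have "sequencing ?G A w" using A by (intro sequencing_of_admissible) auto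
      then show ?thesis by (auto simp: sequenceable_def)
    qed
  qed
  then show ?thesis using c(1) by blast
qed

end
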